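(* Let $\Gamma$ be an arbitrary infinite $3$-regular graph and let $\Gamma_0$ be its edge graph. Let $\Sigma\subseteq[0,6]$ be the spectrum of $-\Delta_\Gamma$, let $\mu$ and $P_\lambda(a,b)$ be the spectral measure and kernel of $-\Delta_\Gamma$ described in the context, and define, for vertices $x,y$ of $\Gamma_0$ (edges of $\Gamma$), $$\tilde P_\lambda(x,y)=\frac1{6-\lambda}\sum_{a\in x}\sum_{b\in y}P_\lambda(a,b),$$ where $a\in x$ means that $a$ is an endpoint of the edge $x$. Let $E_6$ be the space of $6$-eigenfunctions of $-\Delta_{\Gamma_0}$ in $\ell^2(\Gamma_0)$ (this may be $0$) and $\tilde P_6$ the orthogonal projection of $\ell^2(\Gamma_0)$ onto $E_6$. Then the spectral resolution of $-\Delta_{\Gamma_0}$ is given by $$F=\tilde P_6F+\int_\Sigma\tilde P_\lambda F\,d\mu(\lambda),$$ where $$-\Delta_{\Gamma_0}\tilde P_\lambda F=\lambda\tilde P_\lambda F$$ for $\mu$-a.e. $\lambda$, and $$\tilde P_\lambda F(x)=\sum_{y\in\Gamma_0}\tilde P_\lambda(x,y)F(y).$$ In particular, the spectrum of $-\Delta_{\Gamma_0}$ is $\Sigma$ (if $E_6=0$) or $\Sigma\cup\{6\}$.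
   Context: For a regular graph $G$, $\Delta_G$ is the graph Laplacian $\Delta_Gf(x)=\sum_{y\sim x}(f(y)-f(x))$, acting on $\ell^2(G)$ (functions on the vertex set). The edge graph $\Gamma_0$ of $\Gamma$ has the edges of $\Gamma$ as vertices, two being adjacent if and only if they share an endpoint; it is $4$-regular. Let $E_I$ be the spectral projections of $-\Delta_\Gamma$ corresponding to intervals $I\subseteq[0,6]$, with kernels $E_I(a,b)$, i.e. $E_If(a)=\sum_{b\in\Gamma}E_I(a,b)f(b)$. Then $\mu$ is a positive measure on $[0,6]$ and $P_\lambda(a,b)$ a function defined for $\mu$-a.e. $\lambda$ such that $E_I(a,b)=\int_IP_\lambda(a,b)\,d\mu(\lambda)$ for all $a,b\in\Gamma$. One has $-\Delta_\Gamma P_\lambda(\cdot,b)=\lambda P_\lambda(\cdot,b)$ for $\mu$-a.e. $\lambda$, and with $P_\lambda f(a)=\sum_{b\in\Gamma}P_\lambda(a,b)f(b)$ the spectral resolution on $\Gamma$ is $f=\int_\Sigma P_\lambda f\,d\mu(\lambda)$, for $f\in\ell^2(\Gamma)$ or, more restrictively, for $f$ of finite support. The measure $\mu$ has no atom at $\lambda=6$ (there are no $6$-eigenfunctions of $-\Delta_\Gamma$ in $\ell^2(\Gamma)$). In the theorem $F$ is a function in $\ell^2(\Gamma_0)$. *)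

theory Defs
  imports "HOL-Analysis.Analysis"
begin

record 'a graph =
  verts :: "'a set"
  edges :: "'a set set"

definition simple_graph :: "'a graph \<Rightarrow> bool" where
  "simple_graph G \<longleftrightarrow> (\<forall>e\<in>edges G. e \<subseteq> verts G \<and> card e = 2)"

definition nbrs :: "'a graph \<Rightarrow> 'a \<Rightarrow> 'a set" where
  "nbrs G x = {y \<in> verts G. {x, y} \<in> edges G}"

definition regular_graph :: "nat \<Rightarrow> 'a graph \<Rightarrow> bool" where
  "regular_graph k G \<longleftrightarrow>
     simple_graph G \<and> (\<forall>x\<in>verts G. finite (nbrs G x) \<and> card (nbrs G x) = k)"

definition edge_graph :: "'a graph \<Rightarrow> 'a set graph" where
  "edge_graph G = \<lparr> verts = edges G,
     edges = {{x, y} | x y. x \<in> edges G \<and> y \<in> edges G \<and> x \<noteq> y \<and> x \<inter> y \<noteq> {}} \<rparr>"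


text \<open>Functions on the vertex set are represented by functions on the whole type that vanish
  off the vertex set, so that equality of operators on \<open>ell2 G\<close> is equality of functions.\<close>

definition laplacian :: "'a graph \<Rightarrow> ('a \<Rightarrow> complex) \<Rightarrow> 'a \<Rightarrow> complex" where
  "laplacian G f x = (if x \<in> verts G then \<Sum>y\<in>nbrs G x. f y - f x else 0)"

abbreviation neg_laplacian :: "'a graph \<Rightarrow> ('a \<Rightarrow> complex) \<Rightarrow> 'a \<Rightarrow> complex" where
  "neg_laplacian G f x \<equiv> - laplacian G f x"

definition ell2 :: "'a graph \<Rightarrow> ('a \<Rightarrow> complex) set" where
  "ell2 G = {f. (\<forall>x. x \<notin> verts G \<longrightarrow> f x = 0) \<and> (\<lambda>x. (cmod (f x))\<^sup>2) summable_on verts G}"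

definition ell2_inner :: "'a graph \<Rightarrow> ('a \<Rightarrow> complex) \<Rightarrow> ('a \<Rightarrow> complex) \<Rightarrow> complex" where
  "ell2_inner G f g = (\<Sum>\<^sub>\<infinity>x\<in>verts G. f x * cnj (g x))"

definition ell2_norm :: "'a graph \<Rightarrow> ('a \<Rightarrow> complex) \<Rightarrow> real" where
  "ell2_norm G f = sqrt (\<Sum>\<^sub>\<infinity>x\<in>verts G. (cmod (f x))\<^sup>2)"

definition ell2_linear :: "'a graph \<Rightarrow> (('a \<Rightarrow> complex) \<Rightarrow> 'a \<Rightarrow> complex) \<Rightarrow> bool" where
  "ell2_linear G T \<longleftrightarrow>
     (\<forall>f\<in>ell2 G. T f \<in> ell2 G) \<and>
     (\<forall>f\<in>ell2 G. \<forall>g\<in>ell2 G. T (\<lambda>x. f x + g x) = (\<lambda>x. T f x + T g x)) \<and>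
     (\<forall>c. \<forall>f\<in>ell2 G. T (\<lambda>x. c * f x) = (\<lambda>x. c * T f x))"

definition ell2_bounded :: "'a graph \<Rightarrow> (('a \<Rightarrow> complex) \<Rightarrow> 'a \<Rightarrow> complex) \<Rightarrow> bool" where
  "ell2_bounded G T \<longleftrightarrow>
     ell2_linear G T \<and> (\<exists>C. \<forall>f\<in>ell2 G. ell2_norm G (T f) \<le> C * ell2_norm G f)"

definition spectrum :: "'a graph \<Rightarrow> (('a \<Rightarrow> complex) \<Rightarrow> 'a \<Rightarrow> complex) \<Rightarrow> complex set" where
  "spectrum G A = {z. \<not> (\<exists>R. ell2_bounded G R \<and>
     (\<forall>f\<in>ell2 G. R (\<lambda>x. A f x - z * f x) = f \<and> (\<lambda>x. A (R f) x - z * R f x) = f))}"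

definition eigenspace :: "'a graph \<Rightarrow> complex \<Rightarrow> ('a \<Rightarrow> complex) set" where
  "eigenspace G c = {f \<in> ell2 G. \<forall>x\<in>verts G. neg_laplacian G f x = c * f x}"

definition proj_onto :: "'a graph \<Rightarrow> ('a \<Rightarrow> complex) set \<Rightarrow> ('a \<Rightarrow> complex) \<Rightarrow> 'a \<Rightarrow> complex" where
  "proj_onto G S f = (THE h. h \<in> S \<and> (\<forall>k\<in>S. ell2_inner G (\<lambda>x. f x - h x) k = 0))"

definition orthogonal_projection :: "'a graph \<Rightarrow> (('a \<Rightarrow> complex) \<Rightarrow> 'a \<Rightarrow> complex) \<Rightarrow> bool" where
  "orthogonal_projection G T \<longleftrightarrow>
     ell2_linear G T \<and>
     (\<forall>f\<in>ell2 G. T (T f) = T f) \<and>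
     (\<forall>f\<in>ell2 G. \<forall>g\<in>ell2 G. ell2_inner G (T f) g = ell2_inner G f (T g))"

definition projection_valued_measure ::
  "'a graph \<Rightarrow> (real set \<Rightarrow> ('a \<Rightarrow> complex) \<Rightarrow> 'a \<Rightarrow> complex) \<Rightarrow> bool" where
  "projection_valued_measure G E \<longleftrightarrow>
     (\<forall>B\<in>sets borel. orthogonal_projection G (E B)) \<and>
     (\<forall>f\<in>ell2 G. E UNIV f = f) \<and>
     (\<forall>A\<in>sets borel. \<forall>B\<in>sets borel. \<forall>f\<in>ell2 G. E (A \<inter> B) f = E A (E B f)) \<and>
     (\<forall>B :: nat \<Rightarrow> real set. range B \<subseteq> sets borel \<and> disjoint_family B \<longrightarrow>
        (\<forall>f\<in>ell2 G. \<forall>g\<in>ell2 G.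
           (\<lambda>i. ell2_inner G (E (B i) f) g) sums ell2_inner G (E (\<Union>i. B i) f) g))"

definition scalar_measure ::
  "'a graph \<Rightarrow> (real set \<Rightarrow> ('a \<Rightarrow> complex) \<Rightarrow> 'a \<Rightarrow> complex) \<Rightarrow> ('a \<Rightarrow> complex) \<Rightarrow> real measure" where
  "scalar_measure G E f =
     measure_of UNIV (sets borel) (\<lambda>B. ennreal (Re (ell2_inner G (E B f) f)))"

text \<open>\<open>A\<close> is the integral of \<open>t\<close> against \<open>E\<close>, in the weak sense.  The diagonal matrix elements
  determine the others by polarization, the scalars being complex.\<close>

definition spectral_projections ::
  "'a graph \<Rightarrow> (('a \<Rightarrow> complex) \<Rightarrow> 'a \<Rightarrow> complex) \<Rightarrow>
   (real set \<Rightarrow> ('a \<Rightarrow> complex) \<Rightarrow> 'a \<Rightarrow> complex) \<Rightarrow> bool" where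
  "spectral_projections G A E \<longleftrightarrow>
     projection_valued_measure G E \<and>
     (\<forall>f\<in>ell2 G. integrable (scalar_measure G E f) (\<lambda>t. t) \<and>
        ell2_inner G (A f) f = complex_of_real (LINT t|scalar_measure G E f. t))"

definition has_kernel ::
  "'a graph \<Rightarrow> (('a \<Rightarrow> complex) \<Rightarrow> 'a \<Rightarrow> complex) \<Rightarrow> ('a \<Rightarrow> 'a \<Rightarrow> complex) \<Rightarrow> bool" where
  "has_kernel G T K \<longleftrightarrow>
     (\<forall>f\<in>ell2 G. \<forall>a\<in>verts G. ((\<lambda>b. K a b * f b) has_sum T f a) (verts G))"

definition spectral_kernel ::
  "'a graph \<Rightarrow> (real set \<Rightarrow> ('a \<Rightarrow> complex) \<Rightarrow> 'a \<Rightarrow> complex) \<Rightarrow>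
   real measure \<Rightarrow> (real \<Rightarrow> 'a \<Rightarrow> 'a \<Rightarrow> complex) \<Rightarrow> bool" where
  "spectral_kernel G E \<mu> P \<longleftrightarrow>
     sets \<mu> = sets (restrict_space borel {0..6}) \<and>
     (\<forall>a\<in>verts G. \<forall>b\<in>verts G. integrable \<mu> (\<lambda>t. P t a b)) \<and>
     (\<forall>I. is_interval I \<and> I \<subseteq> {0..6} \<longrightarrow>
        has_kernel G (E I) (\<lambda>a b. LINT t:I|\<mu>. P t a b))"

text \<open>At \<open>t = 6\<close> the quotient is 0.  When all components of the graph are infinite, \<open>\<mu>\<close> has no
  atom there and the value is irrelevant; an atom coming from a finite bipartite component does
  not contribute either, because \<open>P 6 a b + P 6 a' b = 0\<close> for an edge \<open>{a, a'}\<close>.\<close>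

definition edge_kernel ::
  "(real \<Rightarrow> 'a \<Rightarrow> 'a \<Rightarrow> complex) \<Rightarrow> real \<Rightarrow> 'a set \<Rightarrow> 'a set \<Rightarrow> complex" where
  "edge_kernel P t x y = 1 / complex_of_real (6 - t) * (\<Sum>a\<in>x. \<Sum>b\<in>y. P t a b)"

text \<open>For square-summable \<open>F\<close> and fixed \<open>t\<close>, the series over \<open>y\<close> of \<open>edge_kernel P t x y * F y\<close>
  need not converge unconditionally, since generalized eigenfunctions are not square summable.
  As a series of functions of \<open>t\<close> it converges in \<open>L\<^sup>1(\<mu>)\<close>, along finite sets of
  indices.  This determines the sum up to a \<open>\<mu>\<close>-null set; for finitely supported \<open>F\<close> it is the
  finite sum for almost every \<open>t\<close>.\<close>

definition has_L1_sum ::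
  "real measure \<Rightarrow> ('i \<Rightarrow> real \<Rightarrow> complex) \<Rightarrow> 'i set \<Rightarrow> (real \<Rightarrow> complex) \<Rightarrow> bool" where
  "has_L1_sum M f I g \<longleftrightarrow>
     (\<forall>i\<in>I. integrable M (f i)) \<and> integrable M g \<and>
     ((\<lambda>S. \<integral>\<^sup>+t. ennreal (cmod (g t - (\<Sum>i\<in>S. f i t))) \<partial>M) \<longlongrightarrow> 0)
       (finite_subsets_at_top I)"

end

theory Submission
  imports Defs
begin

text \<open>Write \<open>T\<close> for the incidence operator \<open>T f x = \<Sum>a\<in>x. f a\<close> from functions on vertices to functions
  on edges, \<open>T\<^sup>*\<close> for its adjoint, and \<open>L\<close>, \<open>L\<^sub>0\<close> for the negative Laplacians of the cubic graph and of
  its edge graph.  Then \<open>T\<^sup>* T = 6 - L\<close> and \<open>T T\<^sup>* = 6 - L\<^sub>0\<close>.  Hence the 6-eigenspace of \<open>L\<^sub>0\<close> is the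
  kernel of \<open>T\<^sup>*\<close>, and on its orthogonal complement the spectral projection of \<open>L\<^sub>0\<close> for a Borel set
  \<open>B\<close> has to be \<open>T (6 - L)\<^sup>-\<^sup>1 E(B) T\<^sup>*\<close>, whose kernel is the integral over \<open>B\<close> of the edge kernel.

  The work lies in giving a meaning to this formula at the singularity \<open>t = 6\<close> and for square-summable
  functions instead of finitely supported ones.  Each complex measure \<open>B \<mapsto> \<langle>E(B) u, v\<rangle>\<close> has an
  integrable density \<open>D u v\<close> with respect to \<open>\<mu>\<close>: for point masses it is the given kernel \<open>P\<close>, and in
  general it is an \<open>L\<^sup>1\<close> limit (\<open>setwise_limit_of_densities\<close>, \<open>dens_exists\<close>).  Since densities are
  unique almost everywhere, \<open>D\<close> is sesquilinear, \<open>D (E(B) u) v\<close> is the restriction of \<open>D u v\<close> to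
  \<open>B\<close>, \<open>D (L u) v t = t D u v t\<close>, and \<open>D u u \<ge> 0\<close>.  This replaces the functional calculus.  The
  decisive estimate is \<open>weight_bound\<close>: the integral of \<open>D (T\<^sup>* F) (T\<^sup>* F) t / (6 - t)\<close> is at most
  \<open>\<parallel>F\<parallel>\<^sup>2\<close>.  It makes \<open>W F G t = D (T\<^sup>* F) (T\<^sup>* G) t / (6 - t)\<close> integrable with \<open>L\<^sup>1\<close> norm at most
  \<open>2 \<parallel>F\<parallel> \<parallel>G\<parallel>\<close>, so that integration over \<open>B\<close> defines a bounded operator \<open>Q B\<close>.  From
  \<open>T\<^sup>* Q(B) = E(B) T\<^sup>*\<close> follow \<open>Q(A) Q(B) = Q(A \<inter> B)\<close> and that \<open>F - Q(UNIV) F\<close> is the projection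
  of \<open>F\<close> onto the kernel of \<open>T\<^sup>*\<close>.  The generalized eigenfunction of \<open>F\<close> is \<open>x \<mapsto> W F \<delta>\<^sub>x t\<close>.

  For the spectra, the resolvents of \<open>T\<^sup>* T\<close> and \<open>T T\<^sup>*\<close> determine each other algebraically away from
  0, that is, for \<open>z \<noteq> 6\<close>.  At \<open>z = 6\<close> one needs that \<open>T\<close> is injective if \<open>T\<^sup>*\<close> is: a nonzero
  square-summable element of the kernel of \<open>T\<close> lives on finite components, and these have more edges
  than vertices.\<close>

section \<open>The Hilbert space of square-summable functions\<close>

definition delta :: "'a \<Rightarrow> 'a \<Rightarrow> complex" where
  "delta a = (\<lambda>x. if x = a then 1 else 0)"

definition cutoff :: "'a set \<Rightarrow> ('a \<Rightarrow> complex) \<Rightarrow> 'a \<Rightarrow> complex" where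
  "cutoff S f = (\<lambda>x. if x \<in> S then f x else 0)"

lemma ell2_off: "f \<in> ell2 G \<Longrightarrow> x \<notin> verts G \<Longrightarrow> f x = 0"
  by (auto simp: ell2_def)

lemma ell2_summable: "f \<in> ell2 G \<Longrightarrow> (\<lambda>x. (cmod (f x))\<^sup>2) summable_on verts G"
  by (auto simp: ell2_def)

lemma cmod_add_square_le: "(cmod (a + b))\<^sup>2 \<le> 2 * (cmod a)\<^sup>2 + 2 * (cmod b)\<^sup>2"
proof -
  have "(cmod (a + b))\<^sup>2 \<le> (cmod a + cmod b)\<^sup>2"
    by (intro power_mono norm_triangle_ineq) auto
  also have "\<dots> \<le> 2 * (cmod a)\<^sup>2 + 2 * (cmod b)\<^sup>2"
    using sum_squares_bound[of "cmod a" "cmod b"] by (simp add: power2_sum)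
  finally show ?thesis .
qed

lemma ell2_add [intro]:
  assumes "f \<in> ell2 G" "g \<in> ell2 G" shows "(\<lambda>x. f x + g x) \<in> ell2 G"
proof -
  have "(\<lambda>x. 2 * (cmod (f x))\<^sup>2 + 2 * (cmod (g x))\<^sup>2) summable_on verts G"
    by (intro summable_on_add summable_on_cmult_right ell2_summable assms)
  hence "(\<lambda>x. (cmod (f x + g x))\<^sup>2) summable_on verts G"
    by (rule summable_on_comparison_test) (auto intro: cmod_add_square_le)
  thus ?thesis using assms by (auto simp: ell2_def)
qed

lemma ell2_scale [intro]:
  assumes "f \<in> ell2 G" shows "(\<lambda>x. c * f x) \<in> ell2 G"
  using assms by (auto simp: ell2_def norm_mult power_mult_distrib intro!: summable_on_cmult_right)

lemma ell2_zero [simp, intro]: "(\<lambda>x. 0) \<in> ell2 G"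
  by (auto simp: ell2_def)

lemma ell2_diff [intro]:
  assumes "f \<in> ell2 G" "g \<in> ell2 G" shows "(\<lambda>x. f x - g x) \<in> ell2 G"
  using ell2_add[OF assms(1) ell2_scale[OF assms(2), of "-1"]] by simp

lemma ell2_sum:
  assumes "\<And>i. i \<in> I \<Longrightarrow> f i \<in> ell2 G" shows "(\<lambda>x. \<Sum>i\<in>I. f i x) \<in> ell2 G"
  using assms by (induction I rule: infinite_finite_induct) (auto intro!: ell2_add)

lemma ell2_finite_support:
  assumes "finite S" "S \<subseteq> verts G" "\<And>x. x \<notin> S \<Longrightarrow> f x = 0" shows "f \<in> ell2 G"
proof -
  have "(\<lambda>x. (cmod (f x))\<^sup>2) summable_on verts G \<longleftrightarrow> (\<lambda>x. (cmod (f x))\<^sup>2) summable_on S"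
    using assms by (intro summable_on_cong_neutral) auto
  thus ?thesis using assms by (auto simp: ell2_def)
qed

lemma delta_ell2 [intro]: "a \<in> verts G \<Longrightarrow> delta a \<in> ell2 G"
  by (rule ell2_finite_support[of "{a}"]) (auto simp: delta_def)

lemma cutoff_ell2 [intro]: "f \<in> ell2 G \<Longrightarrow> cutoff S f \<in> ell2 G"
  unfolding ell2_def cutoff_def
  by (auto intro: summable_on_comparison_test[of "\<lambda>x. (cmod (f x))\<^sup>2"])

lemma ell2_inner_summable:
  assumes "f \<in> ell2 G" "g \<in> ell2 G" shows "(\<lambda>x. f x * cnj (g x)) summable_on verts G"
proof -
  have "(\<lambda>x. (cmod (f x))\<^sup>2 + (cmod (g x))\<^sup>2) summable_on verts G"
    by (intro summable_on_add ell2_summable assms)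
  hence "Infinite_Sum.abs_summable_on (\<lambda>x. f x * cnj (g x)) (verts G)"
  proof (rule Infinite_Sum.abs_summable_on_comparison_test')
    fix x
    have "2 * cmod (f x) * cmod (g x) \<le> (cmod (f x))\<^sup>2 + (cmod (g x))\<^sup>2"
      by (rule sum_squares_bound)
    moreover have "0 \<le> cmod (f x) * cmod (g x)" by simp
    ultimately show "norm (f x * cnj (g x)) \<le> (cmod (f x))\<^sup>2 + (cmod (g x))\<^sup>2"
      unfolding norm_mult complex_mod_cnj by linarith
  qed
  thus ?thesis by (rule abs_summable_summable)
qed

lemma ell2_inner_add_left:
  assumes "f \<in> ell2 G" "g \<in> ell2 G" "h \<in> ell2 G"
  shows "ell2_inner G (\<lambda>x. f x + g x) h = ell2_inner G f h + ell2_inner G g h"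
  unfolding ell2_inner_def using assms
  by (subst infsum_add[symmetric]) (auto simp: algebra_simps intro: ell2_inner_summable)

lemma ell2_inner_scale_left: "ell2_inner G (\<lambda>x. c * f x) h = c * ell2_inner G f h"
  unfolding ell2_inner_def by (subst infsum_cmult_right'[symmetric]) (simp add: mult.assoc)

lemma ell2_inner_cnj: "ell2_inner G f g = cnj (ell2_inner G g f)"
  unfolding ell2_inner_def by (subst infsum_cnj[symmetric]) (simp add: mult.commute)

lemma ell2_inner_zero_left [simp]: "ell2_inner G (\<lambda>x. 0) h = 0"
  by (simp add: ell2_inner_def)

lemma ell2_inner_zero_right [simp]: "ell2_inner G h (\<lambda>x. 0) = 0"
  by (simp add: ell2_inner_def)

lemma ell2_inner_diff_left:
  assumes "f \<in> ell2 G" "g \<in> ell2 G" "h \<in> ell2 G"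
  shows "ell2_inner G (\<lambda>x. f x - g x) h = ell2_inner G f h - ell2_inner G g h"
  using ell2_inner_add_left[OF assms(1) ell2_scale[OF assms(2), of "-1"] assms(3)]
    ell2_inner_scale_left[of G "-1" g h] by simp

lemma ell2_inner_add_right:
  assumes "f \<in> ell2 G" "g \<in> ell2 G" "h \<in> ell2 G"
  shows "ell2_inner G h (\<lambda>x. f x + g x) = ell2_inner G h f + ell2_inner G h g"
  by (subst (1 2 3) ell2_inner_cnj) (simp add: ell2_inner_add_left[OF assms])

lemma ell2_inner_scale_right: "ell2_inner G h (\<lambda>x. c * f x) = cnj c * ell2_inner G h f"
  by (subst (1 2) ell2_inner_cnj) (simp add: ell2_inner_scale_left)

lemma ell2_inner_finite_support:
  assumes "finite S" "S \<subseteq> verts G" "\<And>x. x \<notin> S \<Longrightarrow> f x * cnj (g x) = 0"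
  shows "ell2_inner G f g = (\<Sum>x\<in>S. f x * cnj (g x))"
proof -
  have "infsum (\<lambda>x. f x * cnj (g x)) (verts G) = infsum (\<lambda>x. f x * cnj (g x)) S"
    using assms(2,3) by (intro infsum_cong_neutral) auto
  thus ?thesis using assms(1) by (simp add: ell2_inner_def)
qed

lemma ell2_inner_delta_right: "a \<in> verts G \<Longrightarrow> ell2_inner G f (delta a) = f a"
  by (subst ell2_inner_finite_support[of "{a}"]) (auto simp: delta_def)

lemma ell2_norm_nonneg [simp]: "0 \<le> ell2_norm G f"
  unfolding ell2_norm_def by (intro real_sqrt_ge_zero infsum_nonneg) auto

lemma ell2_norm_square: "(ell2_norm G f)\<^sup>2 = (\<Sum>\<^sub>\<infinity>x\<in>verts G. (cmod (f x))\<^sup>2)"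
  unfolding ell2_norm_def by (simp add: infsum_nonneg)

lemma ell2_inner_self:
  assumes f: "f \<in> ell2 G" shows "ell2_inner G f f = of_real ((ell2_norm G f)\<^sup>2)"
proof -
  have "ell2_inner G f f = (\<Sum>\<^sub>\<infinity>x\<in>verts G. of_real ((cmod (f x))\<^sup>2))"
    unfolding ell2_inner_def by (simp only: complex_norm_square)
  also have "\<dots> = of_real (\<Sum>\<^sub>\<infinity>x\<in>verts G. (cmod (f x))\<^sup>2)"
    by (rule infsumI) (rule has_sum_of_real[OF has_sum_infsum[OF ell2_summable[OF f]]])
  finally show ?thesis by (simp only: ell2_norm_square)
qed

lemma ell2_norm_eq_0_iff: "f \<in> ell2 G \<Longrightarrow> ell2_norm G f = 0 \<longleftrightarrow> f = (\<lambda>x. 0)"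
proof
  assume f: "f \<in> ell2 G" and 0: "ell2_norm G f = 0"
  show "f = (\<lambda>x. 0)"
  proof
    fix x show "f x = 0"
    proof (cases "x \<in> verts G")
      case True
      have "(cmod (f x))\<^sup>2 = 0"
        using nonneg_infsum_le_0D[of "\<lambda>x. (cmod (f x))\<^sup>2" "verts G" x] 0 True ell2_summable[OF f]
          ell2_norm_square[of G f] by simp
      thus ?thesis by simp
    qed (simp add: ell2_off[OF f])
  qed
qed (simp add: ell2_norm_def)

lemma ell2_norm_scale: "ell2_norm G (\<lambda>x. c * f x) = cmod c * ell2_norm G f"
  unfolding ell2_norm_def
  by (simp add: norm_mult power_mult_distrib infsum_cmult_right' real_sqrt_mult)

text \<open>The optimal weight is \<open>s\<^sup>2 = B / A\<close>; if \<open>A\<close> or \<open>B\<close> vanishes, let \<open>s\<close> tend to infinity or to 0.\<close>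

lemma amgm_optimize:
  fixes A B X :: real
  assumes "0 \<le> A" "0 \<le> B" and le: "\<And>s. s > 0 \<Longrightarrow> X \<le> c * (s\<^sup>2 * A\<^sup>2 + B\<^sup>2 / s\<^sup>2)" and c: "0 \<le> c"
  shows "X \<le> 2 * c * (A * B)"
proof (cases "A = 0 \<or> B = 0")
  case True
  have "X \<le> 0"
  proof (rule field_le_epsilon)
    fix e :: real assume e: "0 < e"
    define K where "K = c * (A\<^sup>2 + B\<^sup>2)"
    have K: "K \<ge> 0" unfolding K_def using c by simp
    define r where "r = e / (K + 1)"
    have r: "r > 0" "K * r \<le> e"
      using K e by (auto simp: r_def field_simps)
    show "X \<le> 0 + e"
    proof (cases "A = 0")
      case True
      have "X \<le> c * (B\<^sup>2 * r)" using le[of "1 / sqrt r"] r True by (simp add: power_divide)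
      thus ?thesis using r True by (simp add: K_def mult.assoc)
    next
      case False
      hence "B = 0" using \<open>A = 0 \<or> B = 0\<close> by simp
      have "X \<le> c * (r * A\<^sup>2)" using le[of "sqrt r"] r \<open>B = 0\<close> by simp
      thus ?thesis using r \<open>B = 0\<close> by (simp add: K_def mult_ac)
    qed
  qed
  thus ?thesis using True by auto
next
  case False
  hence *: "A > 0" "B > 0" using assms by auto
  define s where "s = sqrt (B / A)"
  have "s > 0" "s\<^sup>2 = B / A" using * by (auto simp: s_def)
  hence "s\<^sup>2 * A\<^sup>2 + B\<^sup>2 / s\<^sup>2 = 2 * (A * B)" using * by (simp add: field_simps power2_eq_square)
  thus ?thesis using le[OF \<open>s > 0\<close>] by simp
qed

lemma ell2_cauchy_schwarz:
  assumes "f \<in> ell2 G" "g \<in> ell2 G"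
  shows "cmod (ell2_inner G f g) \<le> ell2_norm G f * ell2_norm G g"
proof -
  \<comment> \<open>Sum the weighted arithmetic-geometric mean inequality termwise and optimize the weight afterwards.\<close>
  have "cmod (ell2_inner G f g) \<le> 2 * (1/2) * (ell2_norm G f * ell2_norm G g)"
  proof (rule amgm_optimize)
    fix s :: real assume s: "s > 0"
    have F: "((\<lambda>x. (cmod (f x))\<^sup>2) has_sum (ell2_norm G f)\<^sup>2) (verts G)"
      "((\<lambda>x. (cmod (g x))\<^sup>2) has_sum (ell2_norm G g)\<^sup>2) (verts G)"
      unfolding ell2_norm_square by (intro has_sum_infsum ell2_summable assms)+
    have 1: "((\<lambda>x. 1/2 * (s\<^sup>2 * (cmod (f x))\<^sup>2 + (1/s\<^sup>2) * (cmod (g x))\<^sup>2)) has_sum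
        1/2 * (s\<^sup>2 * (ell2_norm G f)\<^sup>2 + (1/s\<^sup>2) * (ell2_norm G g)\<^sup>2)) (verts G)"
      by (intro has_sum_cmult_right has_sum_add F)
    have 2: "((\<lambda>x. f x * cnj (g x)) has_sum ell2_inner G f g) (verts G)"
      using ell2_inner_summable[OF assms] by (simp add: ell2_inner_def)
    have 3: "norm (f x * cnj (g x)) \<le> 1/2 * (s\<^sup>2 * (cmod (f x))\<^sup>2 + (1/s\<^sup>2) * (cmod (g x))\<^sup>2)" for x
    proof -
      have "2 * (s * cmod (f x)) * (cmod (g x) / s) \<le> (s * cmod (f x))\<^sup>2 + (cmod (g x) / s)\<^sup>2"
        by (rule sum_squares_bound)
      thus ?thesis using s by (simp add: norm_mult power_mult_distrib power_divide)
    qed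
    have "cmod (ell2_inner G f g) \<le> 1/2 * (s\<^sup>2 * (ell2_norm G f)\<^sup>2 + (1/s\<^sup>2) * (ell2_norm G g)\<^sup>2)"
      by (rule norm_infsum_le[OF 2 1 3])
    thus "cmod (ell2_inner G f g) \<le> 1/2 * (s\<^sup>2 * (ell2_norm G f)\<^sup>2 + (ell2_norm G g)\<^sup>2 / s\<^sup>2)" by simp
  qed auto
  thus ?thesis by simp
qed

lemma ell2_norm_triangle:
  assumes "f \<in> ell2 G" "g \<in> ell2 G"
  shows "ell2_norm G (\<lambda>x. f x + g x) \<le> ell2_norm G f + ell2_norm G g"
proof (rule power2_le_imp_le)
  have "of_real ((ell2_norm G (\<lambda>x. f x + g x))\<^sup>2) = ell2_inner G (\<lambda>x. f x + g x) (\<lambda>x. f x + g x)"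
    using assms by (simp add: ell2_inner_self ell2_add)
  also have "\<dots> = of_real ((ell2_norm G f)\<^sup>2) + of_real ((ell2_norm G g)\<^sup>2) + (ell2_inner G f g + cnj (ell2_inner G f g))"
    using assms ell2_inner_cnj[of G g f]
    by (simp add: ell2_inner_add_left ell2_inner_add_right ell2_add ell2_inner_self)
  also have "\<dots> = of_real ((ell2_norm G f)\<^sup>2 + (ell2_norm G g)\<^sup>2 + 2 * Re (ell2_inner G f g))"
    by (simp add: complex_add_cnj)
  finally have "(ell2_norm G (\<lambda>x. f x + g x))\<^sup>2 = (ell2_norm G f)\<^sup>2 + (ell2_norm G g)\<^sup>2 + 2 * Re (ell2_inner G f g)"
    using of_real_eq_iff by blast
  also have "\<dots> \<le> (ell2_norm G f + ell2_norm G g)\<^sup>2"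
    using ell2_cauchy_schwarz[OF assms] complex_Re_le_cmod[of "ell2_inner G f g"] by (simp add: power2_sum)
  finally show "(ell2_norm G (\<lambda>x. f x + g x))\<^sup>2 \<le> (ell2_norm G f + ell2_norm G g)\<^sup>2" .
qed auto

lemma ell2_norm_tail_tendsto:
  assumes f: "f \<in> ell2 G"
  shows "((\<lambda>S. ell2_norm G (\<lambda>x. f x - cutoff S f x)) \<longlongrightarrow> 0) (finite_subsets_at_top (verts G))"
proof -
  have *: "(ell2_norm G (\<lambda>x. f x - cutoff S f x))\<^sup>2 = (ell2_norm G f)\<^sup>2 - (\<Sum>x\<in>S. (cmod (f x))\<^sup>2)"
    if "finite S" "S \<subseteq> verts G" for S
  proof -
    have "(ell2_norm G (\<lambda>x. f x - cutoff S f x))\<^sup>2 = infsum (\<lambda>x. (cmod (f x))\<^sup>2) (verts G - S)"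
      unfolding ell2_norm_square by (intro infsum_cong_neutral) (auto simp: cutoff_def)
    thus ?thesis using that by (simp add: infsum_Diff ell2_summable f ell2_norm_square)
  qed
  have "((\<lambda>S. (ell2_norm G f)\<^sup>2 - (\<Sum>x\<in>S. (cmod (f x))\<^sup>2)) \<longlongrightarrow> (ell2_norm G f)\<^sup>2 - (ell2_norm G f)\<^sup>2)
      (finite_subsets_at_top (verts G))"
    unfolding ell2_norm_square
    by (intro tendsto_diff tendsto_const infsum_tendsto ell2_summable f)
  hence "((\<lambda>S. sqrt ((ell2_norm G f)\<^sup>2 - (\<Sum>x\<in>S. (cmod (f x))\<^sup>2))) \<longlongrightarrow> sqrt 0)
      (finite_subsets_at_top (verts G))"
    by (intro tendsto_real_sqrt) simp
  moreover have "\<forall>\<^sub>F S in finite_subsets_at_top (verts G).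
      sqrt ((ell2_norm G f)\<^sup>2 - (\<Sum>x\<in>S. (cmod (f x))\<^sup>2)) = ell2_norm G (\<lambda>x. f x - cutoff S f x)"
    by (rule eventually_finite_subsets_at_top_weakI) (simp flip: *)
  ultimately show ?thesis by (simp add: tendsto_cong)
qed

lemma ell2_eqI:
  assumes "f \<in> ell2 G" "g \<in> ell2 G" "\<And>h. h \<in> ell2 G \<Longrightarrow> ell2_inner G f h = ell2_inner G g h"
  shows "f = g"
proof
  fix x show "f x = g x"
  proof (cases "x \<in> verts G")
    case True
    thus ?thesis using assms(3)[of "delta x"] by (simp add: ell2_inner_delta_right delta_ell2)
  qed (simp add: ell2_off[OF assms(1)] ell2_off[OF assms(2)])
qed

lemma ell2_approx_seq:
  assumes f: "f \<in> ell2 G"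
  obtains S where "\<And>n. finite (S n)" "\<And>n. S n \<subseteq> verts G"
    "(\<lambda>n. ell2_norm G (\<lambda>x. f x - cutoff (S n) f x)) \<longlonglongrightarrow> 0"
proof -
  have "\<exists>S. finite S \<and> S \<subseteq> verts G \<and> ell2_norm G (\<lambda>x. f x - cutoff S f x) < 1 / real (Suc n)" for n
  proof -
    have "\<forall>\<^sub>F S in finite_subsets_at_top (verts G). ell2_norm G (\<lambda>x. f x - cutoff S f x) < 1 / real (Suc n)"
      by (rule order_tendstoD[OF ell2_norm_tail_tendsto[OF f]]) simp
    thus ?thesis unfolding eventually_finite_subsets_at_top by blast
  qed
  then obtain S where S: "\<And>n. finite (S n)" "\<And>n. S n \<subseteq> verts G"
      "\<And>n. ell2_norm G (\<lambda>x. f x - cutoff (S n) f x) < 1 / real (Suc n)" by metis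
  have "(\<lambda>n. ell2_norm G (\<lambda>x. f x - cutoff (S n) f x)) \<longlonglongrightarrow> 0"
    by (rule tendsto_sandwich[OF _ _ tendsto_const LIMSEQ_Suc[OF lim_1_over_n]])
       (use S(3) in \<open>auto intro!: always_eventually less_imp_le\<close>)
  thus ?thesis using S that by blast
qed

text \<open>The Riesz representation theorem in coordinates.  Applying the form to the cut-off of \<open>R\<close> to a finite
  set gives a bound on the partial sums of \<open>(cmod (R x))\<^sup>2\<close>.  The form and the inner product with \<open>R\<close>
  agree on finitely supported functions, and both are continuous.\<close>

lemma bounded_form_represented:
  fixes q :: "('a \<Rightarrow> complex) \<Rightarrow> complex"
  assumes add: "\<And>H K. H \<in> ell2 G \<Longrightarrow> K \<in> ell2 G \<Longrightarrow> q (\<lambda>x. H x + K x) = q H + q K"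
    and scale: "\<And>c H. H \<in> ell2 G \<Longrightarrow> q (\<lambda>x. c * H x) = cnj c * q H"
    and bound: "\<And>H. H \<in> ell2 G \<Longrightarrow> cmod (q H) \<le> C * ell2_norm G H"
  defines "R \<equiv> \<lambda>x. if x \<in> verts G then q (delta x) else 0"
  shows "R \<in> ell2 G" "\<And>H. H \<in> ell2 G \<Longrightarrow> ell2_inner G R H = q H"
proof -
  have fin: "q (cutoff S H) = (\<Sum>x\<in>S. R x * cnj (H x))" if "finite S" "S \<subseteq> verts G" for S H
    using that
  proof (induction S)
    case empty
    have "q (\<lambda>x. 0 * 0) = cnj 0 * q (\<lambda>x. 0)" by (rule scale) auto
    thus ?case by (simp add: cutoff_def)
  next
    case (insert a S)
    have "cutoff (insert a S) H = (\<lambda>x. H a * delta a x + cutoff S H x)"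
      using insert by (auto simp: cutoff_def delta_def fun_eq_iff)
    moreover have "cutoff S H \<in> ell2 G" "delta a \<in> ell2 G"
      using insert by (auto intro: ell2_finite_support[of S] simp: cutoff_def)
    ultimately show ?case using insert by (simp add: add scale ell2_scale R_def mult.commute)
  qed
  have bd: "(\<Sum>x\<in>S. (cmod (R x))\<^sup>2) \<le> C\<^sup>2" if S: "finite S" "S \<subseteq> verts G" for S
  proof -
    define A where "A = (\<Sum>x\<in>S. (cmod (R x))\<^sup>2)"
    have A0: "A \<ge> 0" by (simp add: A_def sum_nonneg)
    have cE: "cutoff S R \<in> ell2 G"
      using S by (auto intro: ell2_finite_support[of S] simp: cutoff_def)
    have "of_real ((ell2_norm G (cutoff S R))\<^sup>2) = (\<Sum>x\<in>S. cutoff S R x * cnj (cutoff S R x))"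
      unfolding ell2_inner_self[OF cE, symmetric]
      by (rule ell2_inner_finite_support[OF S]) (simp add: cutoff_def)
    also have "\<dots> = (\<Sum>x\<in>S. R x * cnj (R x))"
      by (intro sum.cong) (auto simp: cutoff_def)
    also have "\<dots> = of_real A"
      unfolding A_def of_real_sum by (simp only: complex_norm_square)
    finally have nA: "(ell2_norm G (cutoff S R))\<^sup>2 = A" using of_real_eq_iff by blast
    have "q (cutoff S R) = of_real A"
      unfolding fin[OF S] A_def of_real_sum by (simp only: complex_norm_square)
    hence "A \<le> C * ell2_norm G (cutoff S R)" using bound[OF cE] A0 by simp
    moreover have "ell2_norm G (cutoff S R) = sqrt A" unfolding nA[symmetric] by simp
    ultimately have AA: "sqrt A * sqrt A \<le> C * sqrt A" using A0 by simp
    show ?thesis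
    proof (cases "A = 0")
      case False
      hence "sqrt A > 0" using A0 by simp
      hence "sqrt A \<le> C" using AA by (simp only: mult_le_cancel_right_pos)
      hence "(sqrt A)\<^sup>2 \<le> C\<^sup>2" using \<open>sqrt A > 0\<close> by (intro power_mono) auto
      thus ?thesis using A0 by (simp add: A_def)
    qed (simp add: A_def)
  qed
  have "(\<lambda>x. (cmod (R x))\<^sup>2) summable_on verts G"
    by (rule nonneg_bdd_above_summable_on) (auto intro!: bdd_aboveI[of _ "C\<^sup>2"] bd)
  thus R: "R \<in> ell2 G" by (auto simp: ell2_def R_def)
  show "ell2_inner G R H = q H" if H: "H \<in> ell2 G" for H
  proof -
    let ?F = "finite_subsets_at_top (verts G)"
    have qd: "q (\<lambda>x. H x - cutoff S H x) = q H - q (cutoff S H)" for S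
      using add[OF H ell2_scale[OF cutoff_ell2[OF H], of "-1"]] scale[OF cutoff_ell2[OF H], of "-1"] by simp
    have "((\<lambda>S. \<Sum>x\<in>S. R x * cnj (H x)) \<longlongrightarrow> ell2_inner G R H) ?F"
      unfolding ell2_inner_def by (intro infsum_tendsto ell2_inner_summable R H)
    moreover have "((\<lambda>S. \<Sum>x\<in>S. R x * cnj (H x)) \<longlongrightarrow> q H) ?F"
    proof -
      have "((\<lambda>S. q H - (\<Sum>x\<in>S. R x * cnj (H x))) \<longlongrightarrow> 0) ?F"
      proof (rule Lim_null_comparison)
        show "((\<lambda>S. C * ell2_norm G (\<lambda>x. H x - cutoff S H x)) \<longlongrightarrow> 0) ?F"
          using tendsto_mult[OF tendsto_const[of C] ell2_norm_tail_tendsto[OF H]] by simp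
        show "\<forall>\<^sub>F S in ?F. norm (q H - (\<Sum>x\<in>S. R x * cnj (H x))) \<le> C * ell2_norm G (\<lambda>x. H x - cutoff S H x)"
          by (rule eventually_finite_subsets_at_top_weakI)
             (simp only: fin[symmetric] qd[symmetric] bound[OF ell2_diff[OF H cutoff_ell2[OF H]]])
      qed
      from tendsto_diff[OF tendsto_const[of "q H"] this] show ?thesis by simp
    qed
    ultimately show ?thesis by (rule tendsto_unique[rotated]) simp
  qed
qed

section \<open>The incidence operator of a cubic graph\<close>

locale cubic_graph =
  fixes \<Gamma> :: "'a graph"
  assumes cubic: "regular_graph 3 \<Gamma>"
begin

definition star :: "'a \<Rightarrow> 'a set set" where
  "star a = {x \<in> edges \<Gamma>. a \<in> x}"

definition inc :: "('a \<Rightarrow> complex) \<Rightarrow> 'a set \<Rightarrow> complex" where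
  "inc f x = (if x \<in> edges \<Gamma> then \<Sum>a\<in>x. f a else 0)"

definition inc_adj :: "('a set \<Rightarrow> complex) \<Rightarrow> 'a \<Rightarrow> complex" where
  "inc_adj F a = (if a \<in> verts \<Gamma> then \<Sum>x\<in>star a. F x else 0)"

abbreviation "\<Gamma>\<^sub>0 \<equiv> edge_graph \<Gamma>"

abbreviation "V \<equiv> ell2 \<Gamma>"
abbreviation "V0 \<equiv> ell2 \<Gamma>\<^sub>0"
abbreviation "ip \<equiv> ell2_inner \<Gamma>"
abbreviation "ip0 \<equiv> ell2_inner \<Gamma>\<^sub>0"
abbreviation "nrm \<equiv> ell2_norm \<Gamma>"
abbreviation "nrm0 \<equiv> ell2_norm \<Gamma>\<^sub>0"

lemma verts_edge_graph [simp]: "verts (edge_graph \<Gamma>) = edges \<Gamma>"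
  by (simp add: edge_graph_def)

lemma edge_card: "x \<in> edges \<Gamma> \<Longrightarrow> card x = 2"
  and edge_subset: "x \<in> edges \<Gamma> \<Longrightarrow> x \<subseteq> verts \<Gamma>"
  and card_nbrs: "a \<in> verts \<Gamma> \<Longrightarrow> card (nbrs \<Gamma> a) = 3"
  and finite_nbrs: "a \<in> verts \<Gamma> \<Longrightarrow> finite (nbrs \<Gamma> a)"
  using cubic by (auto simp: regular_graph_def simple_graph_def)

lemma finite_edge: "x \<in> edges \<Gamma> \<Longrightarrow> finite x"
  using edge_card card.infinite by fastforce

lemma nbrs_ne: "y \<in> nbrs \<Gamma> a \<Longrightarrow> y \<noteq> a"
  using edge_card[of "{a, y}"] by (auto simp: nbrs_def)

lemma star_bij: "a \<in> verts \<Gamma> \<Longrightarrow> bij_betw (\<lambda>y. {a, y}) (nbrs \<Gamma> a) (star a)"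
proof (rule bij_betw_imageI)
  show "inj_on (\<lambda>y. {a, y}) (nbrs \<Gamma> a)" by (auto simp: inj_on_def doubleton_eq_iff)
  show "(\<lambda>y. {a, y}) ` nbrs \<Gamma> a = star a"
  proof safe
    fix x assume "x \<in> star a"
    hence x: "x \<in> edges \<Gamma>" "a \<in> x" by (auto simp: star_def)
    obtain u v where uv: "x = {u, v}" "u \<noteq> v" using edge_card[OF x(1)] by (auto simp: card_2_iff)
    define y where "y = (if a = u then v else u)"
    have "x = {a, y}" using uv x(2) by (auto simp: y_def)
    moreover have "y \<in> nbrs \<Gamma> a" using x edge_subset[OF x(1)] \<open>x = {a, y}\<close> by (auto simp: nbrs_def)
    ultimately show "x \<in> (\<lambda>y. {a, y}) ` nbrs \<Gamma> a" by blast
  qed (auto simp: nbrs_def star_def)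
qed

lemma finite_star: "a \<in> verts \<Gamma> \<Longrightarrow> finite (star a)"
  using star_bij finite_nbrs bij_betw_finite by blast

lemma card_star: "a \<in> verts \<Gamma> \<Longrightarrow> card (star a) = 3"
  using star_bij card_nbrs bij_betw_same_card by metis

lemma flag_swap: "bij_betw (\<lambda>(x, a). (a, x)) (Sigma (edges \<Gamma>) (\<lambda>x. x)) (Sigma (verts \<Gamma>) star)"
  by (rule bij_betw_byWitness[where f' = "\<lambda>(a, x). (x, a)"])
     (use edge_subset in \<open>auto simp: star_def\<close>)

text \<open>Every vertex lies on three edges: the sum over the incident pairs, which is wanted edge by edge, is
  first computed vertex by vertex.\<close>

lemma flag_sum_vert:
  fixes h :: "'a \<Rightarrow> real"
  assumes "h summable_on verts \<Gamma>" "\<And>a. a \<in> verts \<Gamma> \<Longrightarrow> 0 \<le> h a"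
  shows "((\<lambda>(x, a). h a) has_sum 3 * infsum h (verts \<Gamma>)) (Sigma (edges \<Gamma>) (\<lambda>x. x))"
proof -
  have f: "((\<lambda>x. (\<lambda>(a, x). h a) (a, x)) has_sum 3 * h a) (star a)" if "a \<in> verts \<Gamma>" for a
    using that by (intro has_sum_finiteI) (simp_all add: finite_star card_star)
  have "(\<lambda>(a, x). h a) summable_on Sigma (verts \<Gamma>) star"
    by (rule summable_on_SigmaI[OF f summable_on_cmult_right[OF assms(1)]]) (use assms(2) in auto)
  hence "((\<lambda>(a, x). h a) has_sum 3 * infsum h (verts \<Gamma>)) (Sigma (verts \<Gamma>) star)"
    by (intro has_sum_SigmaI[OF f] has_sum_cmult_right has_sum_infsum assms) auto
  hence "((\<lambda>p. (\<lambda>(a, x). h a) ((\<lambda>(x, a). (a, x)) p)) has_sum 3 * infsum h (verts \<Gamma>)) (Sigma (edges \<Gamma>) (\<lambda>x. x))"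
    by (subst has_sum_reindex_bij_betw[OF flag_swap])
  thus ?thesis by (simp add: case_prod_unfold)
qed

lemma cmod_sum_square_le: "(cmod (\<Sum>i\<in>I. z i))\<^sup>2 \<le> real (card I) * (\<Sum>i\<in>I. (cmod (z i))\<^sup>2)"
proof -
  have "(cmod (\<Sum>i\<in>I. z i))\<^sup>2 \<le> (\<Sum>i\<in>I. cmod (z i))\<^sup>2"
    by (intro power_mono norm_sum) auto
  also have "\<dots> \<le> (\<Sum>i\<in>I. (cmod (z i))\<^sup>2) * real (card I)"
    by (rule sum_squared_le_sum_of_squares)
  finally show ?thesis by (simp add: mult.commute)
qed

lemma inc_bounded:
  assumes f: "f \<in> V"
  shows "inc f \<in> V0" "(nrm0 (inc f))\<^sup>2 \<le> 6 * (nrm f)\<^sup>2"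
proof -
  let ?k = "\<lambda>x. 2 * (\<Sum>a\<in>x. (cmod (f a))\<^sup>2)"
  have "((\<lambda>(x, a). (cmod (f a))\<^sup>2) has_sum 3 * (nrm f)\<^sup>2) (Sigma (edges \<Gamma>) (\<lambda>x. x))"
    unfolding ell2_norm_square by (rule flag_sum_vert) (auto intro: ell2_summable f)
  hence "((\<lambda>x. \<Sum>a\<in>x. (cmod (f a))\<^sup>2) has_sum 3 * (nrm f)\<^sup>2) (edges \<Gamma>)"
    by (rule has_sum_SigmaD) (auto intro!: has_sum_finiteI finite_edge)
  hence k: "(?k has_sum 2 * (3 * (nrm f)\<^sup>2)) (edges \<Gamma>)"
    by (rule has_sum_cmult_right)
  have le: "(cmod (inc f x))\<^sup>2 \<le> ?k x" if "x \<in> edges \<Gamma>" for x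
    using cmod_sum_square_le[of f x] that by (simp add: inc_def edge_card)
  have s: "(\<lambda>x. (cmod (inc f x))\<^sup>2) summable_on edges \<Gamma>"
    by (rule summable_on_comparison_test[OF has_sum_imp_summable[OF k] le]) auto
  thus "inc f \<in> V0" by (auto simp: ell2_def inc_def)
  show "(nrm0 (inc f))\<^sup>2 \<le> 6 * (nrm f)\<^sup>2"
    using has_sum_mono[OF has_sum_infsum[OF s] k le] by (simp add: ell2_norm_square)
qed

lemmas inc_ell2 [intro] = inc_bounded(1)

lemma inc_norm_le:
  assumes "f \<in> V" shows "nrm0 (inc f) \<le> sqrt 6 * nrm f"
  by (rule power2_le_imp_le) (use inc_bounded(2)[OF assms] in \<open>simp_all add: power_mult_distrib\<close>)

lemma inc_add: "inc (\<lambda>a. f a + g a) = (\<lambda>x. inc f x + inc g x)"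
  and inc_scale: "inc (\<lambda>a. c * f a) = (\<lambda>x. c * inc f x)"
  and inc_adj_add: "inc_adj (\<lambda>x. F x + H x) = (\<lambda>a. inc_adj F a + inc_adj H a)"
  and inc_adj_scale: "inc_adj (\<lambda>x. c * F x) = (\<lambda>a. c * inc_adj F a)"
  and inc_adj_diff: "inc_adj (\<lambda>x. F x - H x) = (\<lambda>a. inc_adj F a - inc_adj H a)"
  by (auto simp: inc_def inc_adj_def sum.distrib sum_distrib_left sum_subtractf)

lemma inc_zero [simp]: "inc (\<lambda>a. 0) = (\<lambda>x. 0)" and inc_adj_zero [simp]: "inc_adj (\<lambda>a. 0) = (\<lambda>x. 0)"
  by (auto simp: inc_def inc_adj_def)

text \<open>The form \<open>f \<mapsto> \<langle>F, T f\<rangle>\<close> is bounded, hence represented by a square-summable function, and its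
  values at point masses are those of \<open>inc_adj F\<close>.\<close>

lemma
  assumes F: "F \<in> V0"
  shows inc_adj_ell2 [intro]: "inc_adj F \<in> V"
    and inc_adjoint': "f \<in> V \<Longrightarrow> ip (inc_adj F) f = ip0 F (inc f)"
proof -
  let ?q = "\<lambda>f. ip0 F (inc f)"
  have add: "?q (\<lambda>x. f x + g x) = ?q f + ?q g" if "f \<in> V" "g \<in> V" for f g
    unfolding inc_add by (rule ell2_inner_add_right[OF that[THEN inc_ell2] F])
  have scale: "?q (\<lambda>x. c * f x) = cnj c * ?q f" if "f \<in> V" for c f
    unfolding inc_scale by (rule ell2_inner_scale_right)
  have bound: "cmod (?q f) \<le> (nrm0 F * sqrt 6) * nrm f" if "f \<in> V" for f
    using order_trans[OF ell2_cauchy_schwarz[OF F inc_ell2[OF that]]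
        mult_left_mono[OF inc_norm_le[OF that] ell2_norm_nonneg]] by (simp add: mult.assoc)
  have delta: "?q (delta a) = inc_adj F a" if a: "a \<in> verts \<Gamma>" for a
  proof -
    have d: "inc (delta a) x = (if x \<in> star a then 1 else 0)" for x
      using finite_edge[of x] by (simp add: inc_def star_def delta_def)
    have "?q (delta a) = (\<Sum>x\<in>star a. F x * cnj (inc (delta a) x))"
    proof (rule ell2_inner_finite_support[OF finite_star[OF a]])
      show "star a \<subseteq> verts \<Gamma>\<^sub>0" by (auto simp: star_def)
      show "F x * cnj (inc (delta a) x) = 0" if "x \<notin> star a" for x using that by (simp add: d)
    qed
    thus ?thesis using a by (simp add: d inc_adj_def)
  qed
  have "inc_adj F = (\<lambda>x. if x \<in> verts \<Gamma> then ?q (delta x) else 0)"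
    using delta by (auto simp: inc_adj_def fun_eq_iff)
  note eq = this and r = bounded_form_represented[of \<Gamma> ?q, OF add scale bound]
  show "inc_adj F \<in> V" unfolding eq by (rule r(1)) simp_all
  show "ip (inc_adj F) f = ip0 F (inc f)" if "f \<in> V"
    unfolding eq by (rule r(2)) (simp_all add: that)
qed

lemma inc_adjoint:
  assumes "f \<in> V" "F \<in> V0"
  shows "ip0 (inc f) F = ip f (inc_adj F)"
  by (subst (1 2) ell2_inner_cnj) (simp add: inc_adjoint'[OF assms(2,1)])

lemma inc_adj_norm_le:
  assumes F: "F \<in> V0" shows "nrm (inc_adj F) \<le> sqrt 6 * nrm0 F"
proof -
  let ?n = "nrm (inc_adj F)"
  have u: "inc_adj F \<in> V" using F by auto
  have "?n\<^sup>2 = cmod (ip0 F (inc (inc_adj F)))"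
    unfolding inc_adjoint'[OF F u, symmetric] ell2_inner_self[OF u] by (simp add: norm_power)
  also have "\<dots> \<le> nrm0 F * (sqrt 6 * ?n)"
    by (rule order_trans[OF ell2_cauchy_schwarz[OF F inc_ell2[OF u]]
          mult_left_mono[OF inc_norm_le[OF u] ell2_norm_nonneg]])
  finally have "?n * ?n \<le> (sqrt 6 * nrm0 F) * ?n" by (simp add: power2_eq_square mult_ac)
  thus ?thesis by (cases "?n = 0") (use ell2_norm_nonneg[of \<Gamma> "inc_adj F"] in \<open>auto simp: less_le\<close>)
qed

text \<open>The edge from \<open>a\<close> to a neighbour \<open>y\<close> contributes \<open>f a + f y\<close>, and there are three of them.\<close>

lemma inc_adj_inc_pointwise:
  assumes a: "a \<in> verts \<Gamma>" shows "inc_adj (inc f) a = 6 * f a - neg_laplacian \<Gamma> f a"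
proof -
  have "inc_adj (inc f) a = (\<Sum>x\<in>star a. inc f x)" using a by (simp add: inc_adj_def)
  also have "\<dots> = (\<Sum>y\<in>nbrs \<Gamma> a. inc f {a, y})"
    by (rule sum.reindex_bij_betw[OF star_bij[OF a], symmetric])
  also have "\<dots> = (\<Sum>y\<in>nbrs \<Gamma> a. f a + f y)"
    using nbrs_ne by (intro sum.cong) (fastforce simp: inc_def nbrs_def)+
  also have "\<dots> = 6 * f a - neg_laplacian \<Gamma> f a"
    using a by (simp add: laplacian_def sum.distrib sum_subtractf card_nbrs)
  finally show ?thesis .
qed

lemma nbrs_edge_graph:
  assumes x: "x \<in> edges \<Gamma>" shows "nbrs \<Gamma>\<^sub>0 x = (\<Union>a\<in>x. star a - {x})"
  using x unfolding nbrs_def edge_graph_def star_def by (auto simp: doubleton_eq_iff)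

lemma star_Int: 
  assumes "a \<noteq> b" "y \<in> star a" "y \<in> star b" "x \<in> star a" "x \<in> star b" shows "y = x"
proof -
  have "z = {a, b}" if "z \<in> star a" "z \<in> star b" for z
  proof (rule card_subset_eq[symmetric])
    show "{a, b} \<subseteq> z" "finite z" "card {a, b} = card z"
      using that assms(1) by (auto simp: star_def edge_card finite_edge)
  qed
  thus ?thesis using assms by blast
qed

lemma sum_nbrs_edge_graph:
  assumes x: "x \<in> edges \<Gamma>"
  shows "(\<Sum>y\<in>nbrs \<Gamma>\<^sub>0 x. F y) = (\<Sum>a\<in>x. \<Sum>y\<in>star a - {x}. F y)"
  unfolding nbrs_edge_graph[OF x]
proof (rule sum.UNION_disjoint)
  show "finite x" using x by (rule finite_edge)
  show "\<forall>a\<in>x. finite (star a - {x})" using edge_subset[OF x] finite_star by auto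
  show "\<forall>a\<in>x. \<forall>b\<in>x. a \<noteq> b \<longrightarrow> (star a - {x}) \<inter> (star b - {x}) = {}"
    using star_Int[of _ _ _ x] x unfolding star_def by blast
qed

text \<open>Through its two endpoints the edge \<open>x\<close> meets itself twice and each adjacent edge once.\<close>

lemma inc_inc_adj_pointwise:
  assumes x: "x \<in> edges \<Gamma>" shows "inc (inc_adj F) x = 6 * F x - neg_laplacian \<Gamma>\<^sub>0 F x"
proof -
  have *: "(\<Sum>a\<in>x. inc_adj H a) = 2 * H x + (\<Sum>y\<in>nbrs \<Gamma>\<^sub>0 x. H y)" for H
  proof -
    have "inc_adj H a = H x + (\<Sum>y\<in>star a - {x}. H y)" if "a \<in> x" for a
      using that x edge_subset[OF x] finite_star[of a]
      by (auto simp: inc_adj_def intro!: sum.remove simp: star_def)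
    hence "(\<Sum>a\<in>x. inc_adj H a) = (\<Sum>a\<in>x. H x + (\<Sum>y\<in>star a - {x}. H y))" by simp
    thus ?thesis using x by (simp add: sum.distrib sum_nbrs_edge_graph edge_card)
  qed
  \<comment> \<open>The constant function 1 shows that the edge graph is 4-regular.\<close>
  have "(\<Sum>a\<in>x. inc_adj (\<lambda>_. 1) a) = (\<Sum>a\<in>x. 3)"
    using edge_subset[OF x] by (intro sum.cong) (auto simp: inc_adj_def card_star)
  hence "complex_of_nat (card (nbrs \<Gamma>\<^sub>0 x)) = 4" using *[of "\<lambda>_. 1"] x by (simp add: edge_card)
  thus ?thesis using *[of F] x by (simp add: inc_def laplacian_def sum_subtractf)
qed

lemma inc_adj_inc:
  assumes "f \<in> V" shows "inc_adj (inc f) = (\<lambda>x. 6 * f x - neg_laplacian \<Gamma> f x)"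
proof
  fix a show "inc_adj (inc f) a = 6 * f a - neg_laplacian \<Gamma> f a"
    using ell2_off[OF assms, of a]
    by (cases "a \<in> verts \<Gamma>") (simp_all add: inc_adj_inc_pointwise, simp add: inc_adj_def laplacian_def)
qed

lemma inc_inc_adj:
  assumes "F \<in> V0" shows "inc (inc_adj F) = (\<lambda>x. 6 * F x - neg_laplacian \<Gamma>\<^sub>0 F x)"
proof
  fix a show "inc (inc_adj F) a = 6 * F a - neg_laplacian \<Gamma>\<^sub>0 F a"
    using ell2_off[OF assms, of a]
    by (cases "a \<in> edges \<Gamma>") (simp_all add: inc_inc_adj_pointwise, simp add: inc_def laplacian_def)
qed

abbreviation lap :: "('a \<Rightarrow> complex) \<Rightarrow> 'a \<Rightarrow> complex" where "lap \<equiv> neg_laplacian \<Gamma>"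
abbreviation lap0 :: "('a set \<Rightarrow> complex) \<Rightarrow> 'a set \<Rightarrow> complex" where "lap0 \<equiv> neg_laplacian \<Gamma>\<^sub>0"

lemma lap_eq: "f \<in> V \<Longrightarrow> lap f = (\<lambda>x. 6 * f x - inc_adj (inc f) x)"
  by (simp add: inc_adj_inc)

lemma lap0_eq: "F \<in> V0 \<Longrightarrow> lap0 F = (\<lambda>x. 6 * F x - inc (inc_adj F) x)"
  by (simp add: inc_inc_adj)

lemma laplacian_eq: "f \<in> V \<Longrightarrow> laplacian \<Gamma> f x = inc_adj (inc f) x - 6 * f x"
  by (simp add: inc_adj_inc)

lemma laplacian0_eq: "F \<in> V0 \<Longrightarrow> laplacian \<Gamma>\<^sub>0 F x = inc (inc_adj F) x - 6 * F x"
  by (simp add: inc_inc_adj)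

lemma lap_ell2: "f \<in> V \<Longrightarrow> lap f \<in> V"
  unfolding lap_eq by (intro ell2_diff ell2_scale inc_adj_ell2 inc_ell2)

lemma lap_inner:
  assumes "f \<in> V" "g \<in> V"
  shows "ip (lap f) g = 6 * ip f g - ip0 (inc f) (inc g)"
  unfolding lap_eq[OF assms(1)] using assms
  by (simp add: ell2_inner_diff_left ell2_scale inc_adj_ell2 inc_ell2 ell2_inner_scale_left inc_adjoint')

lemma lap0_inner:
  assumes "F \<in> V0" "H \<in> V0"
  shows "ip0 (lap0 F) H = 6 * ip0 F H - ip (inc_adj F) (inc_adj H)"
  unfolding lap0_eq[OF assms(1)] using assms
  by (simp add: ell2_inner_diff_left ell2_scale inc_adj_ell2 inc_ell2 ell2_inner_scale_left inc_adjoint)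

text \<open>\<open>T T\<^sup>* F = 0\<close> forces \<open>\<parallel>T\<^sup>* F\<parallel>\<^sup>2 = \<langle>F, T T\<^sup>* F\<rangle> = 0\<close>.\<close>

lemma eigenspace6: "F \<in> eigenspace \<Gamma>\<^sub>0 6 \<longleftrightarrow> F \<in> V0 \<and> inc_adj F = (\<lambda>a. 0)"
proof -
  have "inc_adj F = (\<lambda>a. 0)" if F: "F \<in> V0" and 6: "\<forall>x\<in>edges \<Gamma>. lap0 F x = 6 * F x"
  proof -
    have "inc (inc_adj F) = (\<lambda>x. 0)"
      using 6 inc_inc_adj_pointwise[of _ F] by (auto simp: inc_def fun_eq_iff)
    hence "ip (inc_adj F) (inc_adj F) = 0"
      using inc_adjoint'[OF F inc_adj_ell2[OF F]] by simp
    thus ?thesis using ell2_norm_eq_0_iff[OF inc_adj_ell2[OF F]] ell2_inner_self[OF inc_adj_ell2[OF F]] by simp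
  qed
  moreover have "lap0 F x = 6 * F x" if "inc_adj F = (\<lambda>a. 0)" "x \<in> edges \<Gamma>" for x
  proof -
    have "6 * F x - lap0 F x = 0" using inc_inc_adj_pointwise[OF that(2), of F] that(1) by simp
    thus ?thesis by (simp only: right_minus_eq)
  qed
  ultimately show ?thesis unfolding eigenspace_def by auto
qed

end

section \<open>Integrable densities\<close>

text \<open>Measures that live on a Borel subset of the line, with the trace of the Borel sets.  Integrals over an
  arbitrary Borel set \<open>B\<close> then make sense: they only see the part of \<open>B\<close> in the space.\<close>

locale sub_borel_measure =
  fixes M :: "real measure"
  assumes id_measurable: "(\<lambda>t. t) \<in> borel_measurable M" and sets_subset: "sets M \<subseteq> sets borel"
begin

lemma borel_measurableI: "g \<in> borel_measurable borel \<Longrightarrow> g \<in> borel_measurable M"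
  by (rule measurable_compose[OF id_measurable])

lemma integrable_bounded_mult:
  fixes f :: "real \<Rightarrow> complex" and g :: "real \<Rightarrow> real"
  assumes f: "integrable M f" and g: "g \<in> borel_measurable borel" and C: "\<And>t. t \<in> space M \<Longrightarrow> \<bar>g t\<bar> \<le> C"
  shows "integrable M (\<lambda>t. g t *\<^sub>R f t)"
proof (rule Bochner_Integration.integrable_bound[where f = "\<lambda>t. C *\<^sub>R f t"])
  show "integrable M (\<lambda>t. C *\<^sub>R f t)" by (rule integrable_scaleR_right[OF f])
  show "(\<lambda>t. g t *\<^sub>R f t) \<in> borel_measurable M"
    by (rule borel_measurable_scaleR[OF borel_measurableI[OF g] borel_measurable_integrable[OF f]])
  show "AE t in M. norm (g t *\<^sub>R f t) \<le> norm (C *\<^sub>R f t)"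
  proof (rule AE_I2)
    fix t assume "t \<in> space M"
    hence "\<bar>g t\<bar> \<le> \<bar>C\<bar>" using C by fastforce
    thus "norm (g t *\<^sub>R f t) \<le> norm (C *\<^sub>R f t)" by (simp add: mult_right_mono)
  qed
qed

lemma integrable_restrict:
  fixes f :: "real \<Rightarrow> complex"
  assumes f: "integrable M f" and B: "B \<in> sets borel"
  shows "set_integrable M B f"
  unfolding set_integrable_def
proof (rule integrable_bounded_mult[OF f])
  show "indicat_real B \<in> borel_measurable borel" using B by (rule borel_measurable_indicator)
  show "\<bar>indicat_real B t\<bar> \<le> 1" for t by (simp add: indicator_def)
qed

lemma L1_norm_le_setwise:
  fixes f :: "real \<Rightarrow> complex"
  assumes f: "integrable M f" and le: "\<And>B. B \<in> sets borel \<Longrightarrow> cmod (LINT t:B|M. f t) \<le> c"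
  shows "(LINT t|M. cmod (f t)) \<le> 4 * c"
proof -
  \<comment> \<open>On a set where a real function has constant sign its integral is the integral of its modulus.\<close>
  have half: "(LINT t|M. \<bar>h (f t)\<bar>) \<le> 2 * c" if h: "h = Re \<or> h = Im" for h :: "complex \<Rightarrow> real"
  proof -
    have bl: "bounded_linear h" using h bounded_linear_Re bounded_linear_Im by auto
    have hf: "integrable M (\<lambda>t. h (f t))" using integrable_bounded_linear[OF bl f] .
    have hle: "\<bar>h z\<bar> \<le> cmod z" for z using h abs_Re_le_cmod abs_Im_le_cmod by auto
    define A where "A = {t \<in> space M. h (f t) > 0}"
    define B where "B = {t \<in> space M. h (f t) < 0}"
    have AB: "A \<in> sets M" "B \<in> sets M" unfolding A_def B_def using hf by measurable
    have eq: "h (LINT t:S|M. f t) = (LINT t|M. indicator S t * h (f t))" if "S \<in> sets M" for S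
    proof -
      have "set_integrable M S f" using that sets_subset integrable_restrict[OF f] by auto
      hence "h (LINT t:S|M. f t) = (LINT t|M. h (indicator S t *\<^sub>R f t))"
        unfolding set_lebesgue_integral_def set_integrable_def by (rule integral_bounded_linear[OF bl, symmetric])
      thus ?thesis by (simp add: linear_scale[OF bounded_linear.linear[OF bl]])
    qed
    have i: "integrable M (\<lambda>t. indicator S t * h (f t))" if "S \<in> sets M" for S
      using integrable_mult_indicator[OF that hf] by simp
    have "(LINT t|M. \<bar>h (f t)\<bar>) = (LINT t|M. indicator A t * h (f t) - indicator B t * h (f t))"
      by (rule Bochner_Integration.integral_cong) (auto simp: A_def B_def indicator_def)
    also have "\<dots> = h (LINT t:A|M. f t) - h (LINT t:B|M. f t)"
      by (simp add: i eq AB)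
    also have "\<dots> \<le> c + c"
      using hle[of "LINT t:A|M. f t"] hle[of "LINT t:B|M. f t"] le[of A] le[of B] AB sets_subset
      by (auto simp: subset_iff)
    finally show ?thesis by simp
  qed
  have i: "integrable M (\<lambda>t. \<bar>Re (f t)\<bar>)" "integrable M (\<lambda>t. \<bar>Im (f t)\<bar>)"
    using f by (auto intro: integrable_abs)
  have "(LINT t|M. cmod (f t)) \<le> (LINT t|M. \<bar>Re (f t)\<bar> + \<bar>Im (f t)\<bar>)"
    using f i by (intro integral_mono) (auto intro: cmod_le)
  also have "\<dots> \<le> 4 * c" using half[of Re] half[of Im] i by simp
  finally show ?thesis .
qed

lemma AE_zeroI:
  fixes f :: "real \<Rightarrow> complex"
  assumes f: "integrable M f" and 0: "\<And>B. B \<in> sets borel \<Longrightarrow> (LINT t:B|M. f t) = 0"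
  shows "AE t in M. f t = 0"
proof -
  have "(LINT t|M. cmod (f t)) \<le> 4 * 0" by (rule L1_norm_le_setwise[OF f]) (simp add: 0)
  moreover have "(LINT t|M. cmod (f t)) \<ge> 0" by simp
  ultimately have "(LINT t|M. cmod (f t)) = 0" by simp
  thus ?thesis using f by (subst (asm) integral_nonneg_eq_0_iff_AE) auto
qed

lemma AE_nonnegI:
  fixes f :: "real \<Rightarrow> complex"
  assumes f: "integrable M f"
    and nn: "\<And>B. B \<in> sets borel \<Longrightarrow> (LINT t:B|M. f t) \<in> \<real> \<and> 0 \<le> Re (LINT t:B|M. f t)"
  shows "AE t in M. f t \<in> \<real> \<and> 0 \<le> Re (f t)"
proof -
  have Im: "(LINT t:B|M. complex_of_real (Im (f t))) = 0" if "B \<in> sets borel" for B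
  proof -
    have "(LINT t:B|M. Im (f t)) = Im (LINT t:B|M. f t)"
      using integrable_restrict[OF f that] unfolding set_lebesgue_integral_def set_integrable_def
      by (subst integral_Im[symmetric]) auto
    thus ?thesis using nn[OF that] by (simp add: set_integral_complex_of_real complex_is_Real_iff)
  qed
  have 1: "AE t in M. complex_of_real (Im (f t)) = 0"
    by (rule AE_zeroI[OF _ Im]) (use f in auto)
  define B where "B = {t \<in> space M. Re (f t) < 0}"
  have B: "B \<in> sets M" unfolding B_def using f by measurable
  have i: "integrable M (\<lambda>t. indicator B t * (- Re (f t)))"
    using integrable_mult_indicator[OF B, of "\<lambda>t. - Re (f t)"] f by simp
  have "(LINT t|M. indicator B t * (- Re (f t))) = - Re (LINT t:B|M. f t)"
    using integrable_restrict[OF f, of B] B sets_subset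
    unfolding set_lebesgue_integral_def set_integrable_def
    by (subst integral_Re[symmetric]) (auto simp: subset_iff)
  also have "\<dots> \<le> 0" using nn[of B] B sets_subset by auto
  finally have "(LINT t|M. indicator B t * (- Re (f t))) \<le> 0" .
  moreover have "(LINT t|M. indicator B t * (- Re (f t))) \<ge> 0"
    by (rule integral_nonneg_AE) (auto simp: B_def indicator_def)
  ultimately have "(LINT t|M. indicator B t * (- Re (f t))) = 0" by simp
  hence 2: "AE t in M. indicator B t * (- Re (f t)) = 0"
    by (subst (asm) integral_nonneg_eq_0_iff_AE[OF i]) (auto simp: B_def indicator_def)
  show ?thesis using 1 2 AE_space
    by eventually_elim (auto simp: complex_is_Real_iff B_def indicator_def split: if_splits)
qed

text \<open>By \<open>L1_norm_le_setwise\<close>, convergence that is uniform over all Borel sets controls distances in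
  \<open>L\<^sup>1\<close>, so a subsequence telescopes to a series that converges absolutely in \<open>L\<^sup>1\<close>.\<close>

lemma setwise_limit_of_densities:
  fixes f :: "nat \<Rightarrow> real \<Rightarrow> complex" and N :: "real set \<Rightarrow> complex"
  assumes f: "\<And>n. integrable M (f n)"
    and le: "\<And>n B. B \<in> sets borel \<Longrightarrow> cmod ((LINT t:B|M. f n t) - N B) \<le> e n" and e: "e \<longlonglongrightarrow> 0"
  obtains g where "integrable M g" "\<And>B. B \<in> sets borel \<Longrightarrow> (LINT t:B|M. g t) = N B"
proof -
  have "\<exists>k. e k \<le> (1/2)^n" for n :: nat
  proof -
    have "\<forall>\<^sub>F k in sequentially. e k < (1/2)^n" by (rule order_tendstoD[OF e]) simp
    thus ?thesis by (auto simp: eventually_sequentially intro: less_imp_le)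
  qed
  then obtain r where r: "\<And>n. e (r n) \<le> (1/2)^n" by metis
  define d where "d n t = f (r (Suc n)) t - f (r n) t" for n t
  have di: "integrable M (d n)" for n unfolding d_def using f by auto
  have dB: "(LINT t:B|M. d n t) = (LINT t:B|M. f (r (Suc n)) t) - (LINT t:B|M. f (r n) t)"
    if "B \<in> sets borel" for n B
    unfolding d_def using integrable_restrict[OF f that] by simp
  have dle: "(LINT t|M. cmod (d n t)) \<le> 4 * (2 * (1/2)^n)" for n
  proof (rule L1_norm_le_setwise[OF di])
    fix B :: "real set" assume B: "B \<in> sets borel"
    have "cmod (LINT t:B|M. d n t) \<le> cmod ((LINT t:B|M. f (r (Suc n)) t) - N B) + cmod ((LINT t:B|M. f (r n) t) - N B)"
      unfolding dB[OF B] by (rule norm_triangle_ineq4[of "x - z" "y - z" for x y z, simplified])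
    also have "\<dots> \<le> (1/2)^Suc n + (1/2)^n"
      using le[OF B, of "r (Suc n)"] le[OF B, of "r n"] r[of n] r[of "Suc n"] by linarith
    also have "\<dots> \<le> 2 * (1/2)^n" by simp
    finally show "cmod (LINT t:B|M. d n t) \<le> 2 * (1/2)^n" .
  qed
  have sd: "summable (\<lambda>n. LINT t|M. cmod (d n t))"
    by (rule summable_comparison_test_ev[of _ "\<lambda>n. 4 * (2 * (1/2)^n)"])
       (use dle in \<open>auto intro!: summable_mult summable_geometric\<close>)
  have AE: "AE t in M. summable (\<lambda>n. norm (d n t))"
  proof -
    have m: "(\<lambda>t. \<Sum>n. ennreal (norm (d n t))) \<in> borel_measurable M"
      using borel_measurable_integrable[OF di] by measurable
    have "(\<integral>\<^sup>+t. (\<Sum>n. ennreal (norm (d n t))) \<partial>M) = (\<Sum>n. \<integral>\<^sup>+t. ennreal (norm (d n t)) \<partial>M)"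
      using borel_measurable_integrable[OF di] by (intro nn_integral_suminf) measurable
    also have "\<dots> = (\<Sum>n. ennreal (LINT t|M. cmod (d n t)))"
      using di by (subst nn_integral_eq_integral) auto
    also have "\<dots> = ennreal (\<Sum>n. LINT t|M. cmod (d n t))"
      by (rule suminf_ennreal2) (use sd in auto)
    finally have "(\<integral>\<^sup>+t. (\<Sum>n. ennreal (norm (d n t))) \<partial>M) \<noteq> \<infinity>" by simp
    from nn_integral_PInf_AE[OF m this] show ?thesis
      by eventually_elim (auto intro: summable_suminf_not_top)
  qed
  define g where "g t = f (r 0) t + (\<Sum>n. d n t)" for t
  have gi: "integrable M g"
    unfolding g_def using f integrable_suminf[OF di AE sd] by auto
  have "(LINT t:B|M. g t) = N B" if B: "B \<in> sets borel" for B
  proof -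
    let ?d = "\<lambda>n t. indicator B t *\<^sub>R d n t"
    have bi: "integrable M (?d n)" for n
      using integrable_restrict[OF di B] unfolding set_integrable_def .
    have bAE: "AE t in M. summable (\<lambda>n. norm (?d n t))"
      using AE by eventually_elim (auto simp: indicator_def)
    have bs: "summable (\<lambda>n. LINT t|M. norm (?d n t))"
    proof (rule summable_comparison_test_ev[OF _ sd], rule always_eventually, rule allI)
      fix n show "norm (LINT t|M. norm (?d n t)) \<le> (LINT t|M. cmod (d n t))"
        using integral_mono[OF integrable_norm[OF bi] integrable_norm[OF di], of n n]
        by (simp add: indicator_def)
    qed
    have sm: "(\<lambda>n. LINT t:B|M. d n t) sums (LINT t:B|M. (\<Sum>n. d n t))"
    proof -
      have "(\<lambda>n. LINT t|M. ?d n t) sums (LINT t|M. (\<Sum>n. ?d n t))"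
        by (rule sums_integral[OF bi bAE bs])
      moreover have "(\<Sum>n. ?d n t) = indicator B t *\<^sub>R (\<Sum>n. d n t)" for t
        by (cases "t \<in> B") auto
      ultimately show ?thesis by (simp add: set_lebesgue_integral_def)
    qed
    have "(\<lambda>n. LINT t:B|M. f n t) \<longlonglongrightarrow> N B"
    proof (rule LIM_zero_cancel, rule Lim_null_comparison[OF _ e])
      show "\<forall>\<^sub>F n in sequentially. norm ((LINT t:B|M. f n t) - N B) \<le> e n"
        using le[OF B] by auto
    qed
    have "(\<lambda>n. LINT t:B|M. f (r n) t) \<longlonglongrightarrow> N B"
    proof (rule LIM_zero_cancel, rule Lim_null_comparison)
      show "\<forall>\<^sub>F n in sequentially. norm ((LINT t:B|M. f (r n) t) - N B) \<le> (1/2)^n"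
        using le[OF B] r order_trans by (intro always_eventually) blast
      show "(\<lambda>n. (1/2::real)^n) \<longlonglongrightarrow> 0" by (rule LIMSEQ_realpow_zero) auto
    qed
    hence "(\<lambda>n. LINT t:B|M. d n t) sums (N B - (LINT t:B|M. f (r 0) t))"
      unfolding dB[OF B] by (rule telescope_sums)
    hence "(LINT t:B|M. (\<Sum>n. d n t)) = N B - (LINT t:B|M. f (r 0) t)"
      using sm sums_unique2 by blast
    thus ?thesis unfolding g_def
      using integrable_restrict[OF f B] integrable_restrict[OF integrable_suminf[OF di AE sd] B] by simp
  qed
  thus ?thesis using gi that by blast
qed

lemma set_integral_sums:
  fixes f :: "real \<Rightarrow> complex"
  assumes f: "integrable M f" and B: "\<And>i. B i \<in> sets borel" "disjoint_family B"
  shows "(\<lambda>i. LINT t:B i|M. f t) sums (LINT t:(\<Union>i. B i)|M. f t)"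
proof -
  let ?C = "\<lambda>n. \<Union>i<n. B i"
  have C: "?C n \<in> sets borel" for n using B(1) by auto
  have "(\<lambda>n. LINT t:?C n|M. f t) \<longlonglongrightarrow> (LINT t:(\<Union>i. B i)|M. f t)"
    unfolding set_lebesgue_integral_def
  proof (rule integral_dominated_convergence[where w = "\<lambda>t. cmod (f t)"])
    show "AE t in M. (\<lambda>n. indicat_real (?C n) t *\<^sub>R f t) \<longlonglongrightarrow> indicat_real (\<Union>i. B i) t *\<^sub>R f t"
    proof (rule AE_I2, cases)
      fix t assume "t \<in> (\<Union>i. B i)"
      then obtain i where i: "t \<in> B i" by auto
      have "\<forall>\<^sub>F n in sequentially. indicat_real (?C n) t *\<^sub>R f t = indicat_real (\<Union>i. B i) t *\<^sub>R f t"
        using eventually_gt_at_top[of i] by eventually_elim (use i in \<open>force simp: indicator_def\<close>)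
      thus "(\<lambda>n. indicat_real (?C n) t *\<^sub>R f t) \<longlonglongrightarrow> indicat_real (\<Union>i. B i) t *\<^sub>R f t"
        by (rule tendsto_eventually)
    qed (auto intro: tendsto_const)
    show "(\<lambda>t. indicat_real (?C n) t *\<^sub>R f t) \<in> borel_measurable M" for n
      using integrable_restrict[OF f C] unfolding set_integrable_def by (rule borel_measurable_integrable)
    show "(\<lambda>t. indicat_real (\<Union>i. B i) t *\<^sub>R f t) \<in> borel_measurable M"
      by (rule borel_measurable_integrable)
         (rule integrable_restrict[OF f, unfolded set_integrable_def], use B(1) in auto)
    show "integrable M (\<lambda>t. cmod (f t))" by (rule integrable_norm[OF f])
    show "AE t in M. norm (indicat_real (?C n) t *\<^sub>R f t) \<le> cmod (f t)" for n
      by (rule AE_I2) (simp add: indicator_def)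
  qed
  moreover have "(LINT t:?C n|M. f t) = (\<Sum>i<n. LINT t:B i|M. f t)" for n
  proof (induction n)
    case 0 show ?case by (simp add: set_lebesgue_integral_def)
  next
    case (Suc n)
    have "?C (Suc n) = ?C n \<union> B n" by (auto simp: less_Suc_eq)
    moreover have "?C n \<inter> B n = {}"
    proof -
      have "B i \<inter> B n = {}" if "i < n" for i
        by (rule disjoint_family_onD[OF B(2)]) (use that in simp_all)
      thus ?thesis by blast
    qed
    ultimately have "(LINT t:?C (Suc n)|M. f t) = (LINT t:?C n|M. f t) + (LINT t:B n|M. f t)"
      using set_integral_Un[OF _ integrable_restrict[OF f C] integrable_restrict[OF f B(1)]] by simp
    thus ?case using Suc by simp
  qed
  ultimately show ?thesis by (simp add: sums_def)
qed

end

lemma borel_sigma_rational_rays: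
  "sets (borel :: real measure) = sigma_sets UNIV (range (\<lambda>q::rat. {..real_of_rat q}))"
proof -
  have "borel = sigma UNIV (range (\<lambda>q::rat. {..real_of_rat q}))"
  proof (rule borel_eq_sigmaI1[OF borel_eq_atMost])
    fix x :: "real set" assume "x \<in> range atMost"
    then obtain a where a: "x = {..a}" by auto
    have "x = (\<Inter>q\<in>{q. a < real_of_rat q}. {..real_of_rat q})"
    proof safe
      fix y assume y: "y \<in> (\<Inter>q\<in>{q. a < real_of_rat q}. {..real_of_rat q})"
      show "y \<in> x"
      proof (rule ccontr)
        assume "y \<notin> x"
        hence "a < y" by (simp add: a)
        then obtain q where "a < real_of_rat q" "real_of_rat q < y" using of_rat_dense by blast
        thus False using y by force
      qed
    qed (auto simp: a)
    also have "\<dots> \<in> sets (sigma UNIV (range (\<lambda>q::rat. {..real_of_rat q})))"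
    proof (rule sets.countable_INT')
      show "{q. a < real_of_rat q} \<noteq> {}" using of_rat_dense[of a "a + 1"] by auto
    qed auto
    finally show "x \<in> sets (sigma UNIV (range (\<lambda>q::rat. {..real_of_rat q})))" .
  qed auto
  thus ?thesis by (metis sets_measure_of top_greatest Pow_UNIV)
qed

text \<open>Complex measures on the line, as set functions of which only the values at Borel sets are meant.\<close>

definition charge :: "(real set \<Rightarrow> complex) \<Rightarrow> bool" where
  "charge N \<longleftrightarrow> (\<forall>B :: nat \<Rightarrow> real set. range B \<subseteq> sets borel \<longrightarrow> disjoint_family B \<longrightarrow>
     (\<lambda>i. N (B i)) sums N (\<Union>i. B i))"

lemma charge_empty:
  assumes "charge N" shows "N {} = 0"
proof -
  have "(\<lambda>i::nat. N {}) sums N {}"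
    using assms[unfolded charge_def, rule_format, of "\<lambda>_. {}"] by (simp add: disjoint_family_on_def)
  hence "summable (\<lambda>i::nat. N {})" by (rule sums_summable)
  thus ?thesis by (simp add: summable_const_iff)
qed

lemma charge_Un:
  assumes N: "charge N" and A: "A \<in> sets borel" and B: "B \<in> sets borel" and AB: "A \<inter> B = {}"
  shows "N (A \<union> B) = N A + N B"
proof -
  define C where "C i = (if i = 0 then A else if i = 1 then B else {})" for i :: nat
  have "range C \<subseteq> sets borel" using A B by (auto simp: C_def)
  moreover have "disjoint_family C" using AB by (auto simp: C_def disjoint_family_on_def)
  ultimately have "(\<lambda>i. N (C i)) sums N (\<Union>i. C i)" using N by (simp add: charge_def)
  moreover have "(\<Union>i. C i) = A \<union> B"
  proof
    show "A \<union> B \<subseteq> (\<Union>i. C i)" using UN_upper[of 0 UNIV C] UN_upper[of 1 UNIV C] by (auto simp: C_def)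
  qed (auto simp: C_def split: if_splits)
  moreover have "(\<lambda>i. N (C i)) sums (\<Sum>i\<in>{0,1}. N (C i))"
    by (rule sums_finite) (auto simp: C_def charge_empty[OF N])
  ultimately have "N (A \<union> B) = (\<Sum>i\<in>{0,1::nat}. N (C i))" using sums_unique2 by metis
  thus ?thesis by (simp add: C_def)
qed

text \<open>The rational rays form a countable generator that is stable under intersection.  Countability
  matters: for \<open>B \<mapsto> \<langle>E(B) u, v\<rangle>\<close> to vanish, countably many conditions on \<open>u\<close> and \<open>v\<close> suffice.\<close>

lemma charges_eq:
  assumes N1: "charge N1" and N2: "charge N2"
    and total: "N1 UNIV = N2 UNIV" and rays: "\<And>q. N1 {..real_of_rat q} = N2 {..real_of_rat q}"
    and A: "A \<in> sets borel"
  shows "N1 A = N2 A"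
proof -
  have diff: "N (UNIV - B) = N UNIV - N B" if "charge N" "B \<in> sets borel" for N B
    using charge_Un[OF that(1,2), of "UNIV - B"] that(2) by simp
  have "Int_stable (range (\<lambda>q::rat. {..real_of_rat q}))"
  proof (rule Int_stableI_image)
    fix p q :: rat
    show "\<exists>k\<in>UNIV. {..real_of_rat p} \<inter> {..real_of_rat q} = {..real_of_rat k}"
      by (rule bexI[of _ "min p q"]) (auto simp: min_def of_rat_less_eq)
  qed
  moreover have "range (\<lambda>q::rat. {..real_of_rat q}) \<subseteq> Pow UNIV" by simp
  moreover have "A \<in> sigma_sets UNIV (range (\<lambda>q::rat. {..real_of_rat q}))"
    using A borel_sigma_rational_rays by simp
  ultimately show ?thesis
  proof (induction rule: sigma_sets_induct_disjoint)
    case (union B)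
    have "range B \<subseteq> sets borel" using union(2) borel_sigma_rational_rays by simp
    hence "(\<lambda>i. N1 (B i)) sums N1 (\<Union>i. B i)" "(\<lambda>i. N2 (B i)) sums N2 (\<Union>i. B i)"
      using N1 N2 union(1) by (simp_all add: charge_def)
    thus ?case using union(3) by (simp add: sums_unique2)
  next
    case (compl B)
    hence "B \<in> sets borel" using borel_sigma_rational_rays by simp
    thus ?case using compl(2) total by (simp add: diff N1 N2)
  qed (use rays charge_empty[OF N1] charge_empty[OF N2] in auto)
qed

section \<open>Spectral densities\<close>

lemma pvm_charge:
  assumes "projection_valued_measure G E" "f \<in> ell2 G" "g \<in> ell2 G"
  shows "charge (\<lambda>B. ell2_inner G (E B f) g)"
  using assms unfolding projection_valued_measure_def charge_def by blast

lemma pvm_inner_self: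
  assumes E: "projection_valued_measure G E" and B: "B \<in> sets borel" and f: "f \<in> ell2 G"
  shows "ell2_inner G (E B f) f = of_real ((ell2_norm G (E B f))\<^sup>2)"
proof -
  have op: "orthogonal_projection G (E B)" using E B unfolding projection_valued_measure_def by blast
  hence EB: "E B f \<in> ell2 G" using f unfolding orthogonal_projection_def ell2_linear_def by blast
  have "ell2_inner G (E B f) f = ell2_inner G (E B (E B f)) f"
    using op f unfolding orthogonal_projection_def by simp
  also have "\<dots> = ell2_inner G (E B f) (E B f)"
    using op f EB unfolding orthogonal_projection_def by simp
  finally show ?thesis by (simp add: ell2_inner_self[OF EB])
qed

text \<open>The set function \<open>B \<mapsto> \<langle>E(B) f, f\<rangle> = \<parallel>E(B) f\<parallel>\<^sup>2\<close> is a measure, so \<open>measure_of\<close> does not replace it by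
  a default.\<close>

lemma
  assumes E: "projection_valued_measure G E" and f: "f \<in> ell2 G"
  shows sets_scalar_measure: "sets (scalar_measure G E f) = sets borel"
    and emeasure_scalar_measure:
      "B \<in> sets borel \<Longrightarrow> emeasure (scalar_measure G E f) B = ennreal (Re (ell2_inner G (E B f) f))"
proof -
  let ?m = "\<lambda>B. Re (ell2_inner G (E B f) f)"
  have sa: "sigma_algebra UNIV (sets (borel :: real measure))"
    by (metis sets.sigma_algebra_axioms space_borel)
  show s: "sets (scalar_measure G E f) = sets borel"
    unfolding scalar_measure_def using sets.sigma_sets_eq[of "borel :: real measure"] by simp
  note charge = pvm_charge[OF E f f]
  have nn: "0 \<le> ?m B" if "B \<in> sets borel" for B using pvm_inner_self[OF E that f] by simp
  assume B: "B \<in> sets borel"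
  show "emeasure (scalar_measure G E f) B = ennreal (?m B)"
    unfolding scalar_measure_def
  proof (rule emeasure_measure_of_sigma[OF sa _ _ B])
    have "ell2_inner G (E {} f) f = 0" by (rule charge_empty[OF charge])
    thus "positive (sets borel) (\<lambda>B. ennreal (?m B))" by (simp add: positive_def)
    show "countably_additive (sets borel) (\<lambda>B. ennreal (?m B))"
    proof (rule countably_additiveI)
      fix C :: "nat \<Rightarrow> real set"
      assume C: "range C \<subseteq> sets borel" "disjoint_family C" "(\<Union>i. C i) \<in> sets borel"
      have "(\<lambda>i. ?m (C i)) sums ?m (\<Union>i. C i)"
        using charge C by (intro sums_Re) (simp add: charge_def)
      hence "(\<lambda>i. ennreal (?m (C i))) sums ennreal (?m (\<Union>i. C i))"
        using nn C by (subst sums_ennreal) (auto simp: image_subset_iff)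
      thus "(\<Sum>i. ennreal (?m (C i))) = ennreal (?m (\<Union>i. C i))" by (rule sums_unique[symmetric])
    qed
  qed
qed

context sub_borel_measure
begin

lemma charge_set_integral:
  fixes f :: "real \<Rightarrow> complex"
  assumes "integrable M f" shows "charge (\<lambda>B. LINT t:B|M. f t)"
  using set_integral_sums[OF assms] by (auto simp: charge_def image_subset_iff)

lemma eq_distr_density:
  fixes g :: "real \<Rightarrow> real"
  assumes sN: "sets N = sets borel" and g: "integrable M g" and nn: "AE t in M. 0 \<le> g t"
    and N: "\<And>B. B \<in> sets borel \<Longrightarrow> emeasure N B = ennreal (LINT t|M. indicator B t * g t)"
  shows "N = distr (density M (\<lambda>t. ennreal (g t))) borel (\<lambda>t. t)"
proof (rule measure_eqI)
  let ?D = "density M (\<lambda>t. ennreal (g t))"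
  have id: "(\<lambda>t. t) \<in> measurable ?D borel" using id_measurable by simp
  have m: "(\<lambda>t. ennreal (g t)) \<in> borel_measurable M" using g by measurable
  fix B assume "B \<in> sets N"
  hence B: "B \<in> sets borel" using sN by simp
  have vB: "(\<lambda>t. t) -` B \<inter> space M \<in> sets M" by (rule measurable_sets[OF id_measurable B])
  have "emeasure (distr ?D borel (\<lambda>t. t)) B = emeasure ?D ((\<lambda>t. t) -` B \<inter> space M)"
    using emeasure_distr[OF id B] by simp
  also have "\<dots> = (\<integral>\<^sup>+t. ennreal (g t) * indicator ((\<lambda>t. t) -` B \<inter> space M) t \<partial>M)"
    by (rule emeasure_density[OF m vB])
  also have "\<dots> = (\<integral>\<^sup>+t. ennreal (indicator B t * g t) \<partial>M)"
    by (rule nn_integral_cong) (simp add: indicator_def)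
  also have "\<dots> = ennreal (LINT t|M. indicator B t * g t)"
  proof (rule nn_integral_eq_integral)
    have "integrable M (\<lambda>t. Re (indicat_real B t *\<^sub>R complex_of_real (g t)))"
      using integrable_restrict[OF integrable_of_real[OF g] B]
      unfolding set_integrable_def by (rule integrable_Re)
    thus "integrable M (\<lambda>t. indicat_real B t * g t)" by simp
    show "AE t in M. 0 \<le> indicat_real B t * g t" using nn by eventually_elim simp
  qed
  finally show "emeasure N B = emeasure (distr ?D borel (\<lambda>t. t)) B" using N[OF B] by simp
qed (simp add: sN)

lemma
  fixes g :: "real \<Rightarrow> real" and h :: "real \<Rightarrow> real"
  assumes sN: "sets N = sets borel" and g: "integrable M g" and nn: "AE t in M. 0 \<le> g t"
    and N: "\<And>B. B \<in> sets borel \<Longrightarrow> emeasure N B = ennreal (LINT t|M. indicator B t * g t)"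
    and h: "h \<in> borel_measurable borel"
  shows integral_density_eq: "(LINT t|N. h t) = (LINT t|M. g t * h t)"
    and integrable_density_iff: "integrable N h \<longleftrightarrow> integrable M (\<lambda>t. g t * h t)"
proof -
  let ?D = "density M (\<lambda>t. ennreal (g t))"
  have id: "(\<lambda>t. t) \<in> measurable ?D borel" using id_measurable by simp
  have gm: "g \<in> borel_measurable M" using g by (rule borel_measurable_integrable)
  have hM: "h \<in> borel_measurable M" by (rule borel_measurableI[OF h])
  have N': "N = distr ?D borel (\<lambda>t. t)" by (rule eq_distr_density[OF sN g nn N])
  show "(LINT t|N. h t) = (LINT t|M. g t * h t)"
    by (subst N', subst integral_distr[OF id h]) (simp add: integral_density[OF hM gm nn])
  show "integrable N h \<longleftrightarrow> integrable M (\<lambda>t. g t * h t)"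
    by (subst N', subst integrable_distr_eq[OF id h]) (simp add: integrable_density[OF hM gm nn])
qed

end

locale cubic_spectral = cubic_graph \<Gamma> for \<Gamma> :: "'a graph" +
  fixes E :: "real set \<Rightarrow> ('a \<Rightarrow> complex) \<Rightarrow> 'a \<Rightarrow> complex"
    and \<mu> :: "real measure" and P :: "real \<Rightarrow> 'a \<Rightarrow> 'a \<Rightarrow> complex"
  assumes sp: "spectral_projections \<Gamma> (neg_laplacian \<Gamma>) E" and sk: "spectral_kernel \<Gamma> E \<mu> P"
begin

lemma sets_\<mu>: "sets \<mu> = sets (restrict_space borel {0..6})" and space_\<mu>: "space \<mu> = {0..6}"
proof -
  show s: "sets \<mu> = sets (restrict_space borel {0..6})" using sk by (simp add: spectral_kernel_def)
  show "space \<mu> = {0..6}" using sets_eq_imp_space_eq[OF s] by (simp add: space_restrict_space)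
qed

sublocale sub_borel_measure \<mu>
proof
  show "(\<lambda>t. t) \<in> borel_measurable \<mu>"
    unfolding measurable_cong_sets[OF sets_\<mu> refl] by (rule measurable_restrict_space1) simp
  show "sets \<mu> \<subseteq> sets borel" unfolding sets_\<mu> by (auto simp: sets_restrict_space)
qed

lemma E_pvm: "projection_valued_measure \<Gamma> E"
  using sp by (simp add: spectral_projections_def)

lemma E_projection: "B \<in> sets borel \<Longrightarrow> orthogonal_projection \<Gamma> (E B)"
  using E_pvm by (simp add: projection_valued_measure_def)

lemma E_linear: "B \<in> sets borel \<Longrightarrow> ell2_linear \<Gamma> (E B)"
  using E_projection by (simp add: orthogonal_projection_def)

lemma E_ell2 [intro]: "B \<in> sets borel \<Longrightarrow> f \<in> V \<Longrightarrow> E B f \<in> V"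
  using E_linear[of B] by (simp add: ell2_linear_def)

lemma E_add: "B \<in> sets borel \<Longrightarrow> f \<in> V \<Longrightarrow> g \<in> V \<Longrightarrow>
    E B (\<lambda>x. f x + g x) = (\<lambda>x. E B f x + E B g x)"
  using E_linear[of B] by (simp add: ell2_linear_def)

lemma E_scale: "B \<in> sets borel \<Longrightarrow> f \<in> V \<Longrightarrow> E B (\<lambda>x. c * f x) = (\<lambda>x. c * E B f x)"
  using E_linear[of B] by (simp add: ell2_linear_def)

lemma E_selfadjoint: "B \<in> sets borel \<Longrightarrow> f \<in> V \<Longrightarrow> g \<in> V \<Longrightarrow>
    ip (E B f) g = ip f (E B g)"
  using E_projection[of B] by (simp add: orthogonal_projection_def)

lemma E_Int: "A \<in> sets borel \<Longrightarrow> B \<in> sets borel \<Longrightarrow> f \<in> V \<Longrightarrow> E (A \<inter> B) f = E A (E B f)"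
  using E_pvm by (simp add: projection_valued_measure_def)

lemma E_UNIV: "f \<in> V \<Longrightarrow> E UNIV f = f"
  using E_pvm by (simp add: projection_valued_measure_def)

lemma E_charge: "f \<in> V \<Longrightarrow> g \<in> V \<Longrightarrow> charge (\<lambda>B. ip (E B f) g)"
  by (rule pvm_charge[OF E_pvm])

lemma E_norm_le: 
  assumes B: "B \<in> sets borel" and f: "f \<in> V" shows "nrm (E B f) \<le> nrm f"
proof -
  have "(nrm (E B f))\<^sup>2 = cmod (ip (E B f) f)"
    unfolding pvm_inner_self[OF E_pvm B f] by (simp add: norm_power)
  also have "\<dots> \<le> nrm (E B f) * nrm f"
    by (rule ell2_cauchy_schwarz) (use B f in auto)
  finally have "nrm (E B f) * nrm (E B f) \<le> nrm (E B f) * nrm f"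
    by (simp add: power2_eq_square)
  thus ?thesis
    using ell2_norm_nonneg[of \<Gamma> "E B f"] ell2_norm_nonneg[of \<Gamma> f] mult_le_cancel_left_pos
    by (cases "nrm (E B f) = 0") (auto simp: less_le)
qed

text \<open>On the range of \<open>E B\<close> the scalar measure lives on \<open>B\<close>.  If \<open>B\<close> lies strictly on one side of \<open>c\<close> but
  the mean \<open>\<langle>L u, u\<rangle>\<close> lies on the other, the measure must vanish.  The sign \<open>s\<close> selects the side.\<close>

lemma range_E_trivial:
  assumes u: "u \<in> V" and B: "B \<in> sets borel" and EB: "E B u = u"
    and neg: "\<And>t. t \<in> B \<Longrightarrow> s * (t - c) < 0"
    and pos: "0 \<le> s * (Re (ip (lap u) u) - c * (nrm u)\<^sup>2)"
  shows "u = (\<lambda>x. 0)"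
proof -
  define N where "N = scalar_measure \<Gamma> E u"
  have sN: "sets N = sets borel" unfolding N_def by (rule sets_scalar_measure[OF E_pvm u])
  have spN: "space N = UNIV" using sets_eq_imp_space_eq[OF sN] by simp
  have eN: "emeasure N A = ennreal (Re (ip (E A u) u))" if "A \<in> sets borel" for A
    unfolding N_def by (rule emeasure_scalar_measure[OF E_pvm u that])
  have tot: "emeasure N UNIV = ennreal ((nrm u)\<^sup>2)"
    by (subst eN) (simp_all add: E_UNIV u ell2_inner_self)
  interpret N: finite_measure N by (rule finite_measureI) (simp add: spN tot)
  have I: "integrable N (\<lambda>t. t)" "ip (lap u) u = of_real (LINT t|N. t)"
    using sp u unfolding spectral_projections_def N_def by auto
  have "emeasure N (UNIV - B) = 0"
  proof -
    have "ip (E (B \<union> (UNIV - B)) u) u = ip (E B u) u + ip (E (UNIV - B) u) u"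
      by (rule charge_Un[OF E_charge[OF u u]]) (use B in auto)
    hence "ip (E (UNIV - B) u) u = 0" by (simp add: E_UNIV u EB)
    thus ?thesis using B by (simp add: eN)
  qed
  hence AEB: "AE t in N. t \<in> B" using B sN spN by (intro AE_I[of _ _ "UNIV - B"]) auto
  have i: "integrable N (\<lambda>t. - (s * (t - c)))" using I(1) by auto
  have "(LINT t|N. - (s * (t - c))) = - (s * (Re (ip (lap u) u) - c * (nrm u)\<^sup>2))"
    using I by (simp add: measure_def spN tot)
  also have "\<dots> \<le> 0" using pos by simp
  finally have le: "(LINT t|N. - (s * (t - c))) \<le> 0" .
  have nn: "AE t in N. 0 \<le> - (s * (t - c))" using AEB by eventually_elim (use neg in force)
  have "(LINT t|N. - (s * (t - c))) = 0" using le integral_nonneg_AE[OF nn] by simp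
  hence "AE t in N. - (s * (t - c)) = 0" using integral_nonneg_eq_0_iff_AE[OF i nn] by simp
  with AEB have "AE t in N. False" by eventually_elim (use neg in force)
  then obtain Z where "{t \<in> space N. \<not> False} \<subseteq> Z" "emeasure N Z = 0" "Z \<in> sets N"
    by (rule AE_E)
  hence "emeasure N (space N) = 0" using emeasure_mono[of "space N" Z N] by simp
  hence "nrm u = 0" using tot spN by (simp add: ennreal_eq_0_iff)
  thus ?thesis using ell2_norm_eq_0_iff[OF u] by simp
qed

lemma lap_numerical_range:
  assumes u: "u \<in> V"
  shows "0 \<le> Re (ip (lap u) u)" "Re (ip (lap u) u) \<le> 6 * (nrm u)\<^sup>2"
  using inc_bounded(2)[OF u]
  by (simp_all add: lap_inner[OF u u] ell2_inner_self[OF u] ell2_inner_self[OF inc_ell2[OF u]])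

text \<open>Because \<open>0 \<le> L \<le> 6\<close>.\<close>

lemma E_Icc:
  assumes u: "u \<in> V" shows "E {0..6} u = u"
proof -
  have 1: "E {..<0} u = (\<lambda>x. 0)"
    by (rule range_E_trivial[where B = "{..<0}" and s = 1 and c = 0])
       (use u lap_numerical_range[OF E_ell2[OF _ u], of "{..<0}"] in \<open>auto simp: E_Int[symmetric]\<close>)
  have 2: "E {6<..} u = (\<lambda>x. 0)"
    by (rule range_E_trivial[where B = "{6<..}" and s = "-1" and c = 6])
       (use u lap_numerical_range[OF E_ell2[OF _ u], of "{6<..}"] in \<open>auto simp: E_Int[symmetric]\<close>)
  show ?thesis
  proof (rule ell2_eqI)
    fix v assume v: "v \<in> V"
    have "ip (E ({..<0} \<union> ({0..6} \<union> {6<..})) u) v =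
        ip (E {..<0} u) v + ip (E ({0..6} \<union> {6<..}) u) v"
      by (rule charge_Un[OF E_charge[OF u v]]) auto
    moreover have "ip (E ({0..6} \<union> {6<..}) u) v = ip (E {0..6} u) v + ip (E {6<..} u) v"
      by (rule charge_Un[OF E_charge[OF u v]]) auto
    moreover have "{..<0} \<union> ({0..6} \<union> {6<..}) = (UNIV :: real set)" by auto
    ultimately show "ip (E {0..6} u) v = ip u v" by (simp add: 1 2 E_UNIV u)
  qed (use u in auto)
qed

text \<open>\<open>d\<close> is the density with respect to \<open>\<mu>\<close> of the complex measure \<open>B \<mapsto> \<langle>E(B) u, v\<rangle>\<close>.\<close>

definition dens :: "('a \<Rightarrow> complex) \<Rightarrow> ('a \<Rightarrow> complex) \<Rightarrow> (real \<Rightarrow> complex) \<Rightarrow> bool" where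
  "dens u v d \<longleftrightarrow> integrable \<mu> d \<and> (\<forall>B\<in>sets borel. ip (E B u) v = (LINT t:B|\<mu>. d t))"

lemma dens_integrable: "dens u v d \<Longrightarrow> integrable \<mu> d"
  and dens_inner: "dens u v d \<Longrightarrow> B \<in> sets borel \<Longrightarrow> ip (E B u) v = (LINT t:B|\<mu>. d t)"
  by (auto simp: dens_def)

lemma set_integral_space_eq:
  "A \<inter> {0..6} = B \<inter> {0..6} \<Longrightarrow> (LINT t:A|\<mu>. f t) = (LINT t:B|\<mu>. f t)"
  unfolding set_lebesgue_integral_def
  by (rule Bochner_Integration.integral_cong) (auto simp: space_\<mu> indicator_def set_eq_iff)

text \<open>The kernel represents the projections for intervals in \<open>{0..6}\<close> only.  These include the traces of
  the rays, which determine the complex measure.\<close>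

lemma dens_delta:
  assumes a: "a \<in> verts \<Gamma>" and b: "b \<in> verts \<Gamma>"
  shows "dens (delta b) (delta a) (\<lambda>t. P t a b)"
proof -
  have i: "integrable \<mu> (\<lambda>t. P t a b)" using sk a b by (simp add: spectral_kernel_def)
  have db: "delta b \<in> V" and da: "delta a \<in> V" using a b by auto
  have iv: "ip (E I (delta b)) (delta a) = (LINT t:I|\<mu>. P t a b)"
    if I: "is_interval I" "I \<subseteq> {0..6}" for I
  proof -
    have "((\<lambda>b'. (LINT t:I|\<mu>. P t a b') * delta b b') has_sum E I (delta b) a) (verts \<Gamma>)"
      using sk that a db unfolding spectral_kernel_def has_kernel_def by blast
    moreover have "((\<lambda>b'. (LINT t:I|\<mu>. P t a b') * delta b b') has_sum (LINT t:I|\<mu>. P t a b)) (verts \<Gamma>)"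
      by (rule has_sum_finite_neutralI[of "{b}"]) (use b in \<open>auto simp: delta_def\<close>)
    ultimately show ?thesis using has_sum_unique a by (simp add: ell2_inner_delta_right) blast
  qed
  have cl: "ip (E B (delta b)) (delta a) = ip (E (B \<inter> {0..6}) (delta b)) (delta a)"
    if "B \<in> sets borel" for B using that by (simp add: E_Int E_Icc db)
  have "ip (E B (delta b)) (delta a) = (LINT t:B|\<mu>. P t a b)" if B: "B \<in> sets borel" for B
  proof (rule charges_eq[OF E_charge[OF db da] charge_set_integral[OF i] _ _ B])
    show "ip (E UNIV (delta b)) (delta a) = (LINT t:UNIV|\<mu>. P t a b)"
      by (subst cl, simp, subst iv) (auto intro!: set_integral_space_eq is_interval_cc)
    fix q
    have "is_interval ({..real_of_rat q} \<inter> {0..6})" by (intro is_interval_Int is_interval_cc is_interval_ic)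
    thus "ip (E {..real_of_rat q} (delta b)) (delta a) = (LINT t:{..real_of_rat q}|\<mu>. P t a b)"
      by (subst cl, simp, subst iv) (auto intro!: set_integral_space_eq)
  qed
  thus ?thesis using i by (simp add: dens_def)
qed

lemma dens_zero: "dens u v d \<Longrightarrow> dens (\<lambda>x. 0) v (\<lambda>t. 0)"
proof -
  have "E B (\<lambda>x. 0) = (\<lambda>x. 0)" if "B \<in> sets borel" for B
    using E_scale[OF that ell2_zero, of 0] by simp
  thus "dens u v d \<Longrightarrow> dens (\<lambda>x. 0) v (\<lambda>t. 0)" by (simp add: dens_def set_lebesgue_integral_def)
qed

lemma dens_add_left:
  assumes "dens u v d" "dens u' v d'" "u \<in> V" "u' \<in> V" "v \<in> V"
  shows "dens (\<lambda>x. u x + u' x) v (\<lambda>t. d t + d' t)"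
  unfolding dens_def
proof (intro conjI ballI)
  show "integrable \<mu> (\<lambda>t. d t + d' t)" using assms(1,2)[THEN dens_integrable] by auto
  fix B :: "real set" assume B: "B \<in> sets borel"
  show "ip (E B (\<lambda>x. u x + u' x)) v = (LINT t:B|\<mu>. d t + d' t)"
    using set_integral_add(2)[OF assms(1,2)[THEN dens_integrable, THEN integrable_restrict[OF _ B]]]
    by (simp add: E_add ell2_inner_add_left assms B E_ell2 dens_inner[OF assms(1) B] dens_inner[OF assms(2) B])
qed

lemma dens_scale_left:
  assumes "dens u v d" "u \<in> V"
  shows "dens (\<lambda>x. c * u x) v (\<lambda>t. c * d t)"
  using assms dens_integrable[OF assms(1)]
  by (simp add: dens_def E_scale ell2_inner_scale_left)

lemma dens_cnj:
  assumes "dens u v d" "u \<in> V" "v \<in> V"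
  shows "dens v u (\<lambda>t. cnj (d t))"
  unfolding dens_def
proof (intro conjI ballI)
  show "integrable \<mu> (\<lambda>t. cnj (d t))" using dens_integrable[OF assms(1)] by simp
  fix B :: "real set" assume B: "B \<in> sets borel"
  have "ip (E B v) u = cnj (ip (E B u) v)"
    using E_selfadjoint[OF B assms(3,2)] ell2_inner_cnj by metis
  also have "\<dots> = cnj (LINT t|\<mu>. indicator B t *\<^sub>R d t)"
    by (simp add: dens_inner[OF assms(1) B] set_lebesgue_integral_def)
  also have "\<dots> = (LINT t|\<mu>. cnj (indicator B t *\<^sub>R d t))" by (rule Bochner_Integration.integral_cnj[symmetric])
  also have "\<dots> = (LINT t:B|\<mu>. cnj (d t))" by (simp add: set_lebesgue_integral_def)
  finally show "ip (E B v) u = (LINT t:B|\<mu>. cnj (d t))" .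
qed

lemma dens_add_right:
  assumes "dens u v d" "dens u v' d'" "u \<in> V" "v \<in> V" "v' \<in> V"
  shows "dens u (\<lambda>x. v x + v' x) (\<lambda>t. d t + d' t)"
  using dens_cnj[OF dens_add_left[OF dens_cnj[OF assms(1,3,4)] dens_cnj[OF assms(2,3,5)] assms(4,5,3)]]
    assms by (simp add: ell2_add)

lemma dens_scale_right:
  assumes "dens u v d" "u \<in> V" "v \<in> V"
  shows "dens u (\<lambda>x. c * v x) (\<lambda>t. cnj c * d t)"
  using dens_cnj[OF dens_scale_left[OF dens_cnj[OF assms] assms(3)]] assms by (simp add: ell2_scale)

lemma dens_unique:
  assumes "dens u v d" "dens u v d'" shows "AE t in \<mu>. d t = d' t"
proof -
  have i: "integrable \<mu> d" "integrable \<mu> d'" using assms dens_integrable by auto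
  have "AE t in \<mu>. d t - d' t = 0"
  proof (rule AE_zeroI)
    fix B :: "real set" assume B: "B \<in> sets borel"
    show "(LINT t:B|\<mu>. d t - d' t) = 0"
      using dens_inner[OF assms(1) B] dens_inner[OF assms(2) B]
        set_integral_diff(2)[OF i[THEN integrable_restrict[OF _ B]]] by simp
  qed (use i in auto)
  thus ?thesis by simp
qed

lemma dens_cutoff_left:
  assumes S: "finite S" "S \<subseteq> verts \<Gamma>" and v: "v \<in> V"
    and d: "\<And>b. b \<in> verts \<Gamma> \<Longrightarrow> dens (delta b) v (d b)"
    and ne: "verts \<Gamma> \<noteq> {}"
  shows "dens (cutoff S u) v (\<lambda>t. \<Sum>b\<in>S. u b * d b t)"
  using S
proof (induction S)
  case empty
  obtain b where "b \<in> verts \<Gamma>" using ne by auto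
  thus ?case using dens_zero[OF d] by (simp add: cutoff_def)
next
  case (insert b S)
  have "cutoff (insert b S) u = (\<lambda>x. u b * delta b x + cutoff S u x)"
    using insert by (auto simp: cutoff_def delta_def fun_eq_iff)
  moreover have "cutoff S u \<in> V"
    using insert by (auto intro: ell2_finite_support[of S] simp: cutoff_def)
  ultimately show ?case
    using insert dens_add_left[OF dens_scale_left[OF d[of b]], of "cutoff S u" "\<lambda>t. \<Sum>b\<in>S. u b * d b t" "u b"] v
    by (simp add: ell2_scale delta_ell2)
qed

lemma E_inner_cutoff_le:
  assumes B: "B \<in> sets borel" and u: "u \<in> V" and v: "v \<in> V"
  shows "cmod (ip (E B (cutoff S u)) v - ip (E B u) v)
    \<le> nrm (\<lambda>x. u x - cutoff S u x) * nrm v"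
proof -
  let ?w = "\<lambda>x. u x - cutoff S u x"
  have w: "?w \<in> V" using u by auto
  have "E B u = E B (\<lambda>x. ?w x + cutoff S u x)" by simp
  also have "\<dots> = (\<lambda>x. E B ?w x + E B (cutoff S u) x)" by (rule E_add[OF B w]) (use u in auto)
  finally have "ip (E B u) v = ip (E B ?w) v + ip (E B (cutoff S u)) v"
    using B u v w by (simp add: ell2_inner_add_left E_ell2 cutoff_ell2)
  hence "cmod (ip (E B (cutoff S u)) v - ip (E B u) v) = cmod (ip (E B ?w) v)"
    by (simp add: norm_minus_commute)
  also have "\<dots> \<le> nrm (E B ?w) * nrm v"
    by (rule ell2_cauchy_schwarz) (use B w v in auto)
  also have "\<dots> \<le> nrm ?w * nrm v"
    by (intro mult_right_mono E_norm_le B w) auto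
  finally show ?thesis .
qed

text \<open>\<open>\<langle>E(B) u, v\<rangle>\<close> is approximated uniformly in \<open>B\<close> when \<open>u\<close> is cut off to a finite set.\<close>

lemma dens_exists_left:
  assumes u: "u \<in> V" and v: "v \<in> V"
    and d: "\<And>b. b \<in> verts \<Gamma> \<Longrightarrow> \<exists>d. dens (delta b) v d" and ne: "verts \<Gamma> \<noteq> {}"
  shows "\<exists>d. dens u v d"
proof -
  obtain d where d: "\<And>b. b \<in> verts \<Gamma> \<Longrightarrow> dens (delta b) v (d b)" using d by metis
  obtain S where S: "\<And>n. finite (S n)" "\<And>n. S n \<subseteq> verts \<Gamma>"
    "(\<lambda>n. nrm (\<lambda>x. u x - cutoff (S n) u x)) \<longlonglongrightarrow> 0" using ell2_approx_seq[OF u] by blast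
  have dn: "dens (cutoff (S n) u) v (\<lambda>t. \<Sum>b\<in>S n. u b * d b t)" for n
    by (rule dens_cutoff_left[OF S(1,2) v d ne])
  have "\<exists>g. integrable \<mu> g \<and> (\<forall>B\<in>sets borel. (LINT t:B|\<mu>. g t) = ip (E B u) v)"
  proof (rule setwise_limit_of_densities[where f = "\<lambda>n t. \<Sum>b\<in>S n. u b * d b t" and N = "\<lambda>B. ip (E B u) v"
        and e = "\<lambda>n. nrm (\<lambda>x. u x - cutoff (S n) u x) * nrm v"])
    show "integrable \<mu> (\<lambda>t. \<Sum>b\<in>S n. u b * d b t)" for n by (rule dens_integrable[OF dn])
    show "(\<lambda>n. nrm (\<lambda>x. u x - cutoff (S n) u x) * nrm v) \<longlonglongrightarrow> 0"
      using tendsto_mult_right[OF S(3), of "nrm v"] by simp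
    fix n and B :: "real set" assume B: "B \<in> sets borel"
    show "cmod ((LINT t:B|\<mu>. \<Sum>b\<in>S n. u b * d b t) - ip (E B u) v) \<le>
        nrm (\<lambda>x. u x - cutoff (S n) u x) * nrm v"
      unfolding dens_inner[OF dn B, symmetric] by (rule E_inner_cutoff_le[OF B u v])
  qed blast
  thus ?thesis by (auto simp: dens_def)
qed

lemma dens_exists:
  assumes u: "u \<in> V" and v: "v \<in> V"
  shows "\<exists>d. dens u v d"
proof (cases "verts \<Gamma> = {}")
  case True
  hence "ip f g = 0" for f g by (simp add: ell2_inner_def)
  hence "dens u v (\<lambda>t. 0)" by (simp add: dens_def set_lebesgue_integral_def)
  thus ?thesis by blast
next
  case ne: False
  show ?thesis
  proof (rule dens_exists_left[OF u v _ ne])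
    fix b assume b: "b \<in> verts \<Gamma>"
    \<comment> \<open>First the left argument is general and the right one a point mass; conjugation swaps the roles.\<close>
    hence "\<exists>d. dens v (delta b) d"
      by (intro dens_exists_left[OF v _ _ ne]) (auto intro: dens_delta)
    thus "\<exists>d. dens (delta b) v d" using dens_cnj b v by blast
  qed
qed

lemma dens_E_left:
  assumes "dens u v d" "B \<in> sets borel" "u \<in> V"
  shows "dens (E B u) v (\<lambda>t. indicator B t *\<^sub>R d t)"
  unfolding dens_def
proof (intro conjI ballI)
  show "integrable \<mu> (\<lambda>t. indicat_real B t *\<^sub>R d t)"
    using integrable_restrict[OF dens_integrable[OF assms(1)] assms(2)] by (simp add: set_integrable_def)
  fix A :: "real set" assume A: "A \<in> sets borel"
  have "ip (E A (E B u)) v = (LINT t:A \<inter> B|\<mu>. d t)"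
    using dens_inner[OF assms(1), of "A \<inter> B"] A assms by (simp add: E_Int)
  also have "\<dots> = (LINT t:A|\<mu>. indicator B t *\<^sub>R d t)"
    by (simp add: set_lebesgue_integral_def indicator_inter_arith)
  finally show "ip (E A (E B u)) v = (LINT t:A|\<mu>. indicator B t *\<^sub>R d t)" .
qed

lemma dens_nonneg:
  assumes "dens u u d" "u \<in> V" shows "AE t in \<mu>. d t \<in> \<real> \<and> 0 \<le> Re (d t)"
proof (rule AE_nonnegI[OF dens_integrable[OF assms(1)]])
  fix B :: "real set" assume B: "B \<in> sets borel"
  show "(LINT t:B|\<mu>. d t) \<in> \<real> \<and> 0 \<le> Re (LINT t:B|\<mu>. d t)"
    unfolding dens_inner[OF assms(1) B, symmetric] pvm_inner_self[OF E_pvm B assms(2)] by auto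
qed

lemma integrable_moment: "integrable \<mu> d \<Longrightarrow> integrable \<mu> (\<lambda>t. t *\<^sub>R d t :: complex)"
  by (rule integrable_bounded_mult[where C = 6]) (auto simp: space_\<mu>)

lemma lap_diagonal:
  assumes d: "dens u u d" and u: "u \<in> V"
  shows "ip (lap u) u = (LINT t|\<mu>. t *\<^sub>R d t)"
proof -
  define N where "N = scalar_measure \<Gamma> E u"
  have sN: "sets N = sets borel" unfolding N_def by (rule sets_scalar_measure[OF E_pvm u])
  have di: "integrable \<mu> d" by (rule dens_integrable[OF d])
  have nn: "AE t in \<mu>. 0 \<le> Re (d t)" and re: "AE t in \<mu>. d t = of_real (Re (d t))"
    using dens_nonneg[OF d u] by (auto elim!: eventually_mono simp: complex_is_Real_iff complex_eq_iff)
  have N: "emeasure N B = ennreal (LINT t|\<mu>. indicator B t * Re (d t))" if B: "B \<in> sets borel" for B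
  proof -
    have "Re (LINT t:B|\<mu>. d t) = (LINT t|\<mu>. Re (indicator B t *\<^sub>R d t))"
      using integrable_restrict[OF di B] unfolding set_integrable_def set_lebesgue_integral_def
      by (rule integral_Re[symmetric])
    thus ?thesis unfolding N_def emeasure_scalar_measure[OF E_pvm u B] dens_inner[OF d B] by simp
  qed
  have "ip (lap u) u = of_real (LINT t|N. t)"
    using sp u unfolding spectral_projections_def N_def by blast
  also have "\<dots> = of_real (LINT t|\<mu>. Re (d t) * t)"
    using integral_density_eq[OF sN integrable_Re[OF di] nn N, of "\<lambda>t. t"] by simp
  also have "\<dots> = (LINT t|\<mu>. complex_of_real (Re (d t) * t))" by (rule integral_complex_of_real[symmetric])
  also have "\<dots> = (LINT t|\<mu>. t *\<^sub>R d t)"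
  proof (rule integral_cong_AE)
    show "(\<lambda>t. t *\<^sub>R d t) \<in> borel_measurable \<mu>"
      by (rule borel_measurable_integrable[OF integrable_moment[OF di]])
    show "(\<lambda>t. complex_of_real (Re (d t) * t)) \<in> borel_measurable \<mu>"
      using borel_measurable_integrable[OF integrable_Re[OF di]] id_measurable by measurable
    show "AE t in \<mu>. complex_of_real (Re (d t) * t) = t *\<^sub>R d t"
      using re by eventually_elim (metis mult.commute of_real_mult scaleR_conv_of_real)
  qed
  finally show ?thesis .
qed

text \<open>Polarization of \<open>lap_diagonal\<close>: the defect \<open>X\<close> of the formula for \<open>u, v\<close> and the defect \<open>Y\<close> for
  \<open>v, u\<close> satisfy \<open>cnj c * X + c * Y = 0\<close> for all \<open>c\<close>, in particular for \<open>c = 1\<close> and \<open>c = \<i>\<close>.\<close>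

lemma lap_moment:
  assumes d: "dens u v d" and u: "u \<in> V" and v: "v \<in> V"
  shows "ip (lap u) v = (LINT t|\<mu>. t *\<^sub>R d t)"
proof -
  define J where "J d = (LINT t|\<mu>. t *\<^sub>R d t)" for d :: "real \<Rightarrow> complex"
  have J_add: "J (\<lambda>t. d t + d' t) = J d + J d'" if "integrable \<mu> d" "integrable \<mu> d'" for d d'
    unfolding J_def scaleR_add_right
    by (rule Bochner_Integration.integral_add[OF that[THEN integrable_moment]])
  have J_scale: "J (\<lambda>t. c * d t) = c * J d" for c d
    unfolding J_def mult_scaleR_right[symmetric] by (rule integral_mult_right_zero)
  obtain du dv where du: "dens u u du" and dv: "dens v v dv" using dens_exists[OF u u] dens_exists[OF v v] by blast
  note dc = dens_cnj[OF d u v]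
  have i: "integrable \<mu> du" "integrable \<mu> dv" "integrable \<mu> d" "integrable \<mu> (\<lambda>t. cnj (d t))"
    by (rule dens_integrable[OF du] dens_integrable[OF dv] dens_integrable[OF d] dens_integrable[OF dc])+
  define X where "X = ip (lap u) v - J d"
  define Y where "Y = ip (lap v) u - J (\<lambda>t. cnj (d t))"
  have key: "cnj c * X + c * Y = 0" for c
  proof -
    let ?w = "\<lambda>x. u x + c * v x"
    have cv: "(\<lambda>x. c * v x) \<in> V" and w: "?w \<in> V" using u v by auto
    have 1: "dens u ?w (\<lambda>t. du t + cnj c * d t)"
      by (rule dens_add_right[OF du dens_scale_right[OF d u v] u u cv])
    have 2: "dens (\<lambda>x. c * v x) ?w (\<lambda>t. c * (cnj (d t) + cnj c * dv t))"
      by (rule dens_scale_left[OF dens_add_right[OF dc dens_scale_right[OF dv v v] v u cv] v])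
    have "dens ?w ?w (\<lambda>t. (du t + cnj c * d t) + c * (cnj (d t) + cnj c * dv t))"
      by (rule dens_add_left[OF 1 2 u cv w])
    hence "ip (lap ?w) ?w = J (\<lambda>t. (du t + cnj c * d t) + c * (cnj (d t) + cnj c * dv t))"
      unfolding J_def by (rule lap_diagonal[OF _ w])
    also have "\<dots> = (J du + cnj c * J d) + c * (J (\<lambda>t. cnj (d t)) + cnj c * J dv)"
      using i by (simp add: J_add J_scale del: integral_mult_right_zero)
    finally have eq: "ip (lap ?w) ?w = (J du + cnj c * J d) + c * (J (\<lambda>t. cnj (d t)) + cnj c * J dv)" .
    have lw: "lap ?w = (\<lambda>x. lap u x + c * lap v x)"
      by (simp add: laplacian_eq[OF u] laplacian_eq[OF v] laplacian_eq[OF w]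
          inc_add inc_scale inc_adj_add inc_adj_scale algebra_simps)
    have lu: "lap u \<in> V" and lv: "lap v \<in> V" using u v lap_ell2 by auto
    have "ip (lap ?w) ?w = ip (lap u) u + cnj c * ip (lap u) v
        + c * (ip (lap v) u + cnj c * ip (lap v) v)"
      unfolding lw ell2_inner_add_left[OF lu ell2_scale[OF lv] w] ell2_inner_scale_left
        ell2_inner_add_right[OF u cv lu] ell2_inner_add_right[OF u cv lv] ell2_inner_scale_right
      by simp
    moreover have "ip (lap u) u = J du" "ip (lap v) v = J dv"
      unfolding J_def by (rule lap_diagonal[OF du u], rule lap_diagonal[OF dv v])
    ultimately show ?thesis using eq unfolding X_def Y_def by (simp add: algebra_simps)
  qed
  have "X + Y = 0" "- \<i> * X + \<i> * Y = 0" using key[of 1] key[of \<i>] by auto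
  hence "X = 0" by (simp add: add_eq_0_iff2)
  thus ?thesis by (simp add: X_def J_def)
qed

lemma dens_lap_left:
  assumes d: "dens u v d" and u: "u \<in> V" and v: "v \<in> V"
  shows "dens (lap u) v (\<lambda>t. t *\<^sub>R d t)"
  unfolding dens_def
proof (intro conjI ballI)
  show "integrable \<mu> (\<lambda>t. t *\<^sub>R d t)" by (rule integrable_moment[OF dens_integrable[OF d]])
  fix B :: "real set" assume B: "B \<in> sets borel"
  have "dens u (E B v) (\<lambda>t. indicator B t *\<^sub>R d t)"
    using dens_cnj[OF dens_E_left[OF dens_cnj[OF d u v] B v]] u v B by (simp add: E_ell2)
  hence "ip (lap u) (E B v) = (LINT t|\<mu>. t *\<^sub>R indicator B t *\<^sub>R d t)"
    by (rule lap_moment) (use u v B in auto)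
  thus "ip (E B (lap u)) v = (LINT t:B|\<mu>. t *\<^sub>R d t)"
    using B u v by (simp add: E_selfadjoint lap_ell2 set_lebesgue_integral_def mult.commute)
qed

end

section \<open>Lifting the spectral measure to the edges\<close>

context cubic_spectral
begin

text \<open>A choice among densities that agree almost everywhere.\<close>

definition D :: "('a \<Rightarrow> complex) \<Rightarrow> ('a \<Rightarrow> complex) \<Rightarrow> real \<Rightarrow> complex" where
  "D u v = (SOME d. dens u v d)"

lemma dens_D: "u \<in> V \<Longrightarrow> v \<in> V \<Longrightarrow> dens u v (D u v)"
  unfolding D_def by (rule someI_ex[OF dens_exists])

lemma integrable_D: "u \<in> V \<Longrightarrow> v \<in> V \<Longrightarrow> integrable \<mu> (D u v)"
  by (rule dens_integrable[OF dens_D])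

lemma D_eqI: "dens u v d \<Longrightarrow> u \<in> V \<Longrightarrow> v \<in> V \<Longrightarrow> AE t in \<mu>. D u v t = d t"
  by (rule dens_unique[OF dens_D])

lemma dens_sum_left:
  assumes "finite I" "\<And>i. i \<in> I \<Longrightarrow> dens (u i) v (d i)" "\<And>i. i \<in> I \<Longrightarrow> u i \<in> V" "v \<in> V"
  shows "dens (\<lambda>x. \<Sum>i\<in>I. u i x) v (\<lambda>t. \<Sum>i\<in>I. d i t)"
  using assms
proof (induction I)
  case empty
  show ?case using dens_zero[OF dens_D[OF ell2_zero \<open>v \<in> ell2 \<Gamma>\<close>]] by simp
next
  case (insert i I)
  have "dens (\<lambda>x. u i x + (\<Sum>i\<in>I. u i x)) v (\<lambda>t. d i t + (\<Sum>i\<in>I. d i t))"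
    using insert by (intro dens_add_left) (auto intro: ell2_sum)
  thus ?case using insert by simp
qed

lemma D_nonneg: "u \<in> V \<Longrightarrow> AE t in \<mu>. D u u t \<in> \<real> \<and> 0 \<le> Re (D u u t)"
  by (rule dens_nonneg[OF dens_D])

text \<open>\<open>D\<close> is positive at \<open>u + c v\<close> for \<open>c = 1, -1, \<i>, -\<i>\<close>, which bounds twice the real and twice the
  imaginary part of \<open>D u v\<close>.\<close>

lemma D_bound:
  assumes u: "u \<in> V" and v: "v \<in> V"
  shows "AE t in \<mu>. cmod (D u v t) \<le> Re (D u u t) + Re (D v v t)"
proof -
  have *: "AE t in \<mu>. 0 \<le> Re (D u u t) + Re (D v v t) + 2 * Re (cnj c * D u v t)" if c: "cmod c = 1" for c
  proof -
    let ?w = "\<lambda>x. u x + c * v x"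
    have cv: "(\<lambda>x. c * v x) \<in> V" and w: "?w \<in> V" using u v by auto
    have 1: "dens u ?w (\<lambda>t. D u u t + cnj c * D u v t)"
      by (rule dens_add_right[OF dens_D[OF u u] dens_scale_right[OF dens_D[OF u v] u v] u u cv])
    have 2: "dens (\<lambda>x. c * v x) ?w (\<lambda>t. c * (cnj (D u v t) + cnj c * D v v t))"
      by (rule dens_scale_left[OF dens_add_right[OF dens_cnj[OF dens_D[OF u v] u v]
            dens_scale_right[OF dens_D[OF v v] v v] v u cv] v])
    have "dens ?w ?w (\<lambda>t. (D u u t + cnj c * D u v t) + c * (cnj (D u v t) + cnj c * D v v t))"
      by (rule dens_add_left[OF 1 2 u cv w])
    from dens_nonneg[OF this w] show ?thesis
    proof eventually_elim
      case (elim t)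
      have cc: "c * cnj c = 1" using c by (metis complex_norm_square of_real_1 power_one)
      have "(D u u t + cnj c * D u v t) + c * (cnj (D u v t) + cnj c * D v v t)
          = D u u t + D v v t + (cnj c * D u v t + cnj (cnj c * D u v t))"
        using cc by (simp add: distrib_left mult.assoc[symmetric])
      hence "Re ((D u u t + cnj c * D u v t) + c * (cnj (D u v t) + cnj c * D v v t))
          = Re (D u u t + D v v t + (cnj c * D u v t + cnj (cnj c * D u v t)))"
        by (simp only:)
      also have "\<dots> = Re (D u u t) + Re (D v v t) + 2 * Re (cnj c * D u v t)"
        by simp
      finally show ?case using elim by linarith
    qed
  qed
  have c: "cmod 1 = 1" "cmod (-1) = 1" "cmod \<i> = 1" "cmod (-\<i>) = 1" by auto
  show ?thesis using *[OF c(1)] *[OF c(2)] *[OF c(3)] *[OF c(4)]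
  proof eventually_elim
    case (elim t)
    have "\<bar>Re (D u v t)\<bar> + \<bar>Im (D u v t)\<bar> \<le> Re (D u u t) + Re (D v v t)" using elim by simp
    thus ?case using cmod_le[of "D u v t"] by linarith
  qed
qed

text \<open>The reciprocal of \<open>6 - t\<close> on \<open>{0..6}\<close>, with value 0 at 6 as in \<open>edge_kernel\<close>; 0 beyond 6 keeps it
  nonnegative on the whole line.\<close>

definition weight :: "real \<Rightarrow> real" where
  "weight t = (if t < 6 then 1 / (6 - t) else 0)"

lemma weight_nonneg: "0 \<le> weight t" by (simp add: weight_def)

lemma weight_measurable: "weight \<in> borel_measurable borel"
  unfolding weight_def by measurable

text \<open>The vector \<open>g = h(L) T\<^sup>* F\<close> is a finite combination of spectral projections, because \<open>h\<close> is simple.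
  It satisfies \<open>\<parallel>T g\<parallel>\<^sup>2 = \<langle>(6 - L) g, g\<rangle> = \<integral> (6 - t) h\<^sup>2 \<le> \<integral> h\<close>, as \<open>(6 - t) h \<le> 1\<close>, and
  \<open>\<integral> h = \<langle>g, T\<^sup>* F\<rangle> = \<langle>T g, F\<rangle> \<le> \<parallel>T g\<parallel> \<parallel>F\<parallel>\<close>, all integrals being against the spectral
  measure of \<open>T\<^sup>* F\<close>.  Together these give \<open>\<integral> h \<le> \<parallel>F\<parallel>\<^sup>2\<close>.\<close>

lemma simple_weight_bound:
  fixes h :: "real \<Rightarrow> real"
  assumes F: "F \<in> V0" and fin: "finite (range h)" and h: "h \<in> borel_measurable borel"
    and nn: "\<And>t. 0 \<le> h t" and le: "\<And>t. h t \<le> weight t"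
  defines "u \<equiv> inc_adj F"
  shows "integrable \<mu> (\<lambda>t. h t * Re (D u u t))" "(LINT t|\<mu>. h t * Re (D u u t)) \<le> (nrm0 F)\<^sup>2"
proof -
  have u: "u \<in> V" unfolding u_def using F by auto
  define B where "B y = h -` {y}" for y
  have B: "B y \<in> sets borel" for y
    using measurable_sets[OF h, of "{y}"] by (simp add: B_def)
  define g where "g = (\<lambda>x. \<Sum>y\<in>range h. of_real y * E (B y) u x)"
  have g: "g \<in> V" unfolding g_def using B u by (intro ell2_sum ell2_scale E_ell2)
  have pt: "(\<Sum>y\<in>range h. of_real y * indicat_real (B y) t *\<^sub>R z) = h t *\<^sub>R (z::complex)" for t z
  proof -
    have "(\<Sum>y\<in>range h. of_real y * indicat_real (B y) t *\<^sub>R z) = (\<Sum>y\<in>range h. if y = h t then h t *\<^sub>R z else 0)"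
      by (intro sum.cong) (auto simp: B_def indicator_def scaleR_conv_of_real)
    thus ?thesis using fin by simp
  qed
  have dg: "dens g v (\<lambda>t. h t *\<^sub>R d t)" if d: "dens u v d" and v: "v \<in> V" for v d
  proof -
    have "dens g v (\<lambda>t. \<Sum>y\<in>range h. of_real y * indicat_real (B y) t *\<^sub>R d t)"
      unfolding g_def by (intro dens_sum_left dens_scale_left dens_E_left d fin B u v ell2_scale E_ell2)
    thus ?thesis unfolding pt .
  qed
  have du: "dens u u (D u u)" by (rule dens_D[OF u u])
  have gu: "dens g u (\<lambda>t. h t *\<^sub>R D u u t)" by (rule dg[OF du u])
  have gg: "dens g g (\<lambda>t. h t *\<^sub>R cnj (h t *\<^sub>R D u u t))"
    by (rule dg[OF dens_cnj[OF gu g u] g])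
  have i1: "integrable \<mu> (\<lambda>t. h t *\<^sub>R D u u t)" by (rule dens_integrable[OF gu])
  have "integrable \<mu> (\<lambda>t. Re (h t *\<^sub>R D u u t))" using i1 by (rule integrable_Re)
  thus ih: "integrable \<mu> (\<lambda>t. h t * Re (D u u t))" by simp
  define x where "x = (LINT t|\<mu>. h t * Re (D u u t))"
  define y where "y = nrm0 (inc g)"
  define f where "f = nrm0 F"
  have "Re (ip g u) = (LINT t|\<mu>. Re (h t *\<^sub>R D u u t))"
    using dens_inner[OF gu, of UNIV] i1 by (simp add: E_UNIV g set_lebesgue_integral_def flip: integral_Re)
  hence x: "x = Re (ip g u)" by (simp add: x_def)
  also have "ip g u = ip0 (inc g) F" unfolding u_def using inc_adjoint[OF g F] by simp
  also have "Re \<dots> \<le> y * f"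
    unfolding y_def f_def
    by (rule order_trans[OF complex_Re_le_cmod ell2_cauchy_schwarz[OF inc_ell2[OF g] F]])
  finally have xyf: "x \<le> y * f" .
  have i2: "integrable \<mu> (\<lambda>t. h t *\<^sub>R cnj (h t *\<^sub>R D u u t))" by (rule dens_integrable[OF gg])
  have "of_real (y\<^sup>2) = 6 * ip g g - ip (lap g) g"
    using lap_inner[OF g g] ell2_inner_self[OF inc_ell2[OF g]] by (simp add: y_def)
  also have "\<dots> = 6 * (LINT t|\<mu>. h t *\<^sub>R cnj (h t *\<^sub>R D u u t)) - (LINT t|\<mu>. t *\<^sub>R h t *\<^sub>R cnj (h t *\<^sub>R D u u t))"
    using dens_inner[OF gg, of UNIV] lap_diagonal[OF gg g] by (simp add: E_UNIV g set_lebesgue_integral_def)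
  also have "\<dots> = (LINT t|\<mu>. 6 * (h t *\<^sub>R cnj (h t *\<^sub>R D u u t)) - t *\<^sub>R h t *\<^sub>R cnj (h t *\<^sub>R D u u t))"
    by (subst Bochner_Integration.integral_diff[OF integrable_mult_right[OF i2] integrable_moment[OF i2]])
       (simp only: integral_mult_right_zero)
  also have "\<dots> = (LINT t|\<mu>. (6 - t) *\<^sub>R h t *\<^sub>R cnj (h t *\<^sub>R D u u t))"
    by (rule Bochner_Integration.integral_cong) (auto simp: scaleR_conv_of_real algebra_simps)
  finally have "complex_of_real (y\<^sup>2) = (LINT t|\<mu>. (6 - t) *\<^sub>R h t *\<^sub>R cnj (h t *\<^sub>R D u u t))" .
  moreover have i3: "integrable \<mu> (\<lambda>t. (6 - t) *\<^sub>R h t *\<^sub>R cnj (h t *\<^sub>R D u u t))"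
    by (rule integrable_bounded_mult[OF i2, where C = 6]) (auto simp: space_\<mu>)
  ultimately have "y\<^sup>2 = (LINT t|\<mu>. Re ((6 - t) *\<^sub>R h t *\<^sub>R cnj (h t *\<^sub>R D u u t)))"
    by (metis Re_complex_of_real integral_Re)
  also have "\<dots> \<le> x"
    unfolding x_def
  proof (rule integral_mono_AE)
    show "integrable \<mu> (\<lambda>t. Re ((6 - t) *\<^sub>R h t *\<^sub>R cnj (h t *\<^sub>R D u u t)))" using i3 by (rule integrable_Re)
    show "AE t in \<mu>. Re ((6 - t) *\<^sub>R h t *\<^sub>R cnj (h t *\<^sub>R D u u t)) \<le> h t * Re (D u u t)"
      using D_nonneg[OF u]
    proof eventually_elim
      case (elim t)
      have "(6 - t) * h t \<le> 1"
      proof (cases "t < 6")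
        case True
        thus ?thesis using le[of t] by (simp add: weight_def field_simps)
      next
        case False
        hence "(6 - t) * h t \<le> 0" using nn[of t] by (simp add: mult_nonpos_nonneg)
        thus ?thesis by simp
      qed
      hence "((6 - t) * h t) * (h t * Re (D u u t)) \<le> 1 * (h t * Re (D u u t))"
        using nn[of t] elim by (intro mult_right_mono) auto
      thus ?case by (simp add: mult.assoc)
    qed
  qed (rule ih)
  finally have yx: "y\<^sup>2 \<le> x" .
  have "x \<le> f\<^sup>2"
  proof (cases "y = 0")
    case True thus ?thesis using xyf by (simp add: order_trans[of x 0])
  next
    case False
    hence "y > 0" using ell2_norm_nonneg[of \<Gamma>\<^sub>0 "inc g"] by (simp add: y_def less_le)
    moreover have "y * y \<le> y * f" using yx xyf by (simp add: power2_eq_square)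
    ultimately have "y \<le> f" by simp
    moreover have "0 \<le> f" by (simp add: f_def)
    ultimately have "y * f \<le> f * f" by (intro mult_right_mono)
    thus ?thesis using xyf by (simp add: power2_eq_square)
  qed
  thus "(LINT t|\<mu>. h t * Re (D u u t)) \<le> (nrm0 F)\<^sup>2" by (simp add: x_def f_def)
qed

text \<open>Monotone convergence along simple functions increasing to the weight.\<close>

lemma weight_bound:
  assumes F: "F \<in> V0"
  defines "u \<equiv> inc_adj F"
  shows "integrable \<mu> (\<lambda>t. weight t * Re (D u u t))" "(LINT t|\<mu>. weight t * Re (D u u t)) \<le> (nrm0 F)\<^sup>2"
proof -
  have u: "u \<in> V" unfolding u_def using F by auto
  have wm: "(\<lambda>t. ennreal (weight t)) \<in> borel_measurable borel"
    using weight_measurable by measurable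
  obtain f where f: "\<And>i. simple_function borel (f i)" "incseq f" "\<And>i t. f i t < top"
      "\<And>t. (SUP i. f i t) = ennreal (weight t)"
    using borel_measurable_implies_simple_function_sequence'[OF wm] by blast
  define h where "h i t = enn2real (f i t)" for i t
  have fle: "f i t \<le> ennreal (weight t)" for i t unfolding f(4)[symmetric] by (rule SUP_upper) simp
  have hle: "h i t \<le> weight t" for i t
    unfolding h_def using enn2real_mono[OF fle[of i t]] weight_nonneg[of t] by simp
  have hnn: "0 \<le> h i t" for i t by (simp add: h_def)
  have hmono: "h i t \<le> h j t" if "i \<le> j" for i j t
    unfolding h_def using f(2) that f(3)[of j t] by (intro enn2real_mono) (auto simp: incseq_def le_fun_def)
  have hlim: "(\<lambda>i. h i t) \<longlonglongrightarrow> weight t" for t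
  proof -
    have "incseq (\<lambda>i. f i t)" using f(2) by (auto simp: incseq_def le_fun_def)
    hence "(\<lambda>i. f i t) \<longlonglongrightarrow> ennreal (weight t)" unfolding f(4)[symmetric] by (rule LIMSEQ_SUP)
    thus ?thesis unfolding h_def by (rule tendsto_enn2real[OF _ weight_nonneg])
  qed
  have hm: "h i \<in> borel_measurable borel" for i
    unfolding h_def using borel_measurable_simple_function[OF f(1)] by measurable
  have hfin: "finite (range (h i))" for i
  proof -
    have "finite (f i ` UNIV)" using simple_functionD(1)[OF f(1)[of i]] by simp
    hence "finite (enn2real ` f i ` UNIV)" by simp
    thus ?thesis by (simp add: h_def[abs_def] image_image)
  qed
  note sw = simple_weight_bound[OF F hfin hm hnn hle, folded u_def]
  have mono: "AE t in \<mu>. mono (\<lambda>i. h i t * Re (D u u t))"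
    using D_nonneg[OF u] by eventually_elim (auto intro!: monoI mult_right_mono hmono)
  have "incseq (\<lambda>i. LINT t|\<mu>. h i t * Re (D u u t))"
  proof (rule incseq_SucI)
    fix i show "(LINT t|\<mu>. h i t * Re (D u u t)) \<le> (LINT t|\<mu>. h (Suc i) t * Re (D u u t))"
      using mono by (intro integral_mono_AE sw(1)) (auto elim!: eventually_mono simp: mono_def)
  qed
  then obtain l where l: "(\<lambda>i. LINT t|\<mu>. h i t * Re (D u u t)) \<longlonglongrightarrow> l"
    using incseq_convergent[where B = "(nrm0 F)\<^sup>2"] sw(2) by blast
  have m: "(\<lambda>t. weight t * Re (D u u t)) \<in> borel_measurable \<mu>"
    by (rule borel_measurable_times[OF borel_measurableI[OF weight_measurable]
          borel_measurable_integrable[OF integrable_Re[OF integrable_D[OF u u]]]])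
  have lim: "AE t in \<mu>. (\<lambda>i. h i t * Re (D u u t)) \<longlonglongrightarrow> weight t * Re (D u u t)"
    by (intro AE_I2 tendsto_mult hlim tendsto_const)
  show "integrable \<mu> (\<lambda>t. weight t * Re (D u u t))"
    by (rule integrable_monotone_convergence[OF sw(1) mono lim l m])
  have "(LINT t|\<mu>. weight t * Re (D u u t)) = l"
    by (rule integral_monotone_convergence[OF sw(1) mono lim l m])
  also have "l \<le> (nrm0 F)\<^sup>2" by (rule LIMSEQ_le_const2[OF l]) (use sw(2) in blast)
  finally show "(LINT t|\<mu>. weight t * Re (D u u t)) \<le> (nrm0 F)\<^sup>2" .
qed

text \<open>The density of \<open>B \<mapsto> \<langle>(6 - L)\<^sup>-\<^sup>1 E(B) T\<^sup>* F, T\<^sup>* G\<rangle>\<close>.\<close>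

definition W :: "('a set \<Rightarrow> complex) \<Rightarrow> ('a set \<Rightarrow> complex) \<Rightarrow> real \<Rightarrow> complex" where
  "W F G t = weight t *\<^sub>R D (inc_adj F) (inc_adj G) t"

lemma W_dens:
  assumes "dens (inc_adj F) (inc_adj G) d" "F \<in> V0" "G \<in> V0"
  shows "AE t in \<mu>. W F G t = weight t *\<^sub>R d t"
  using D_eqI[OF assms(1) inc_adj_ell2[OF assms(2)] inc_adj_ell2[OF assms(3)]]
  by eventually_elim (simp add: W_def)

lemma W_measurable:
  assumes "F \<in> V0" "G \<in> V0" shows "W F G \<in> borel_measurable \<mu>"
  unfolding W_def
  by (rule borel_measurable_scaleR[OF borel_measurableI[OF weight_measurable]
        borel_measurable_integrable[OF integrable_D]]) (use assms in auto)

lemma W_integrable_crude: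
  assumes F: "F \<in> V0" and G: "G \<in> V0"
  shows "integrable \<mu> (W F G)" "(LINT t|\<mu>. cmod (W F G t)) \<le> (nrm0 F)\<^sup>2 + (nrm0 G)\<^sup>2"
proof -
  let ?u = "inc_adj F" and ?v = "inc_adj G"
  let ?b = "\<lambda>t. weight t * Re (D ?u ?u t) + weight t * Re (D ?v ?v t)"
  have uv: "?u \<in> V" "?v \<in> V" using F G by auto
  have bi: "integrable \<mu> ?b" by (intro Bochner_Integration.integrable_add weight_bound(1) F G)
  have le: "AE t in \<mu>. cmod (W F G t) \<le> ?b t"
    using D_bound[OF uv]
  proof eventually_elim
    case (elim t)
    have "weight t * cmod (D ?u ?v t) \<le> weight t * (Re (D ?u ?u t) + Re (D ?v ?v t))"
      by (rule mult_left_mono[OF elim weight_nonneg])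
    thus ?case by (simp add: W_def weight_nonneg distrib_left)
  qed
  show i: "integrable \<mu> (W F G)"
    by (rule Bochner_Integration.integrable_bound[OF bi W_measurable[OF F G]])
       (use le in \<open>auto elim!: eventually_mono\<close>)
  have "(LINT t|\<mu>. cmod (W F G t)) \<le> (LINT t|\<mu>. ?b t)"
    by (rule integral_mono_AE[OF integrable_norm[OF i] bi le])
  also have "\<dots> \<le> (nrm0 F)\<^sup>2 + (nrm0 G)\<^sup>2"
    using weight_bound[OF F] weight_bound[OF G] by simp
  finally show "(LINT t|\<mu>. cmod (W F G t)) \<le> (nrm0 F)\<^sup>2 + (nrm0 G)\<^sup>2" .
qed

lemmas W_integrable = W_integrable_crude(1)

lemma W_add_left:
  assumes "F \<in> V0" "F' \<in> V0" "G \<in> V0"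
  shows "AE t in \<mu>. W (\<lambda>x. F x + F' x) G t = W F G t + W F' G t"
proof -
  have "dens (\<lambda>a. inc_adj F a + inc_adj F' a) (inc_adj G)
      (\<lambda>t. D (inc_adj F) (inc_adj G) t + D (inc_adj F') (inc_adj G) t)"
    by (intro dens_add_left dens_D inc_adj_ell2 assms)
  from W_dens[OF this[folded inc_adj_add] ell2_add[OF assms(1,2)] assms(3)]
  show ?thesis by eventually_elim (simp add: W_def scaleR_add_right)
qed

lemma W_scale_left:
  assumes "F \<in> V0" "G \<in> V0"
  shows "AE t in \<mu>. W (\<lambda>x. c * F x) G t = c * W F G t"
proof -
  have "dens (\<lambda>a. c * inc_adj F a) (inc_adj G) (\<lambda>t. c * D (inc_adj F) (inc_adj G) t)"
    by (intro dens_scale_left dens_D inc_adj_ell2 assms)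
  from W_dens[OF this[folded inc_adj_scale] ell2_scale[OF assms(1)] assms(2)]
  show ?thesis by eventually_elim (simp add: W_def)
qed

lemma W_cnj:
  assumes "F \<in> V0" "G \<in> V0"
  shows "AE t in \<mu>. W G F t = cnj (W F G t)"
proof -
  have "dens (inc_adj G) (inc_adj F) (\<lambda>t. cnj (D (inc_adj F) (inc_adj G) t))"
    by (intro dens_cnj dens_D inc_adj_ell2 assms)
  from W_dens[OF this assms(2,1)] show ?thesis by eventually_elim (simp add: W_def)
qed

lemma W_add_right:
  assumes "F \<in> V0" "G \<in> V0" "G' \<in> V0"
  shows "AE t in \<mu>. W F (\<lambda>x. G x + G' x) t = W F G t + W F G' t"
  using W_add_left[OF assms(2,3,1)] W_cnj[OF assms(1,2)] W_cnj[OF assms(1,3)] W_cnj[OF ell2_add[OF assms(2,3)] assms(1)]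
  by eventually_elim simp

lemma W_scale_right:
  assumes "F \<in> V0" "G \<in> V0"
  shows "AE t in \<mu>. W F (\<lambda>x. c * G x) t = cnj c * W F G t"
  using W_scale_left[OF assms(2,1), of c] W_cnj[OF assms] W_cnj[OF ell2_scale[OF assms(2), of c] assms(1)]
  by eventually_elim simp

text \<open>\<open>W F G\<close> does not change when \<open>F\<close> is multiplied by \<open>s > 0\<close> and \<open>G\<close> by \<open>1 / s\<close>; optimize the crude
  bound over \<open>s\<close>.\<close>

lemma W_L1_bound:
  assumes F: "F \<in> V0" and G: "G \<in> V0"
  shows "(LINT t|\<mu>. cmod (W F G t)) \<le> 2 * (nrm0 F * nrm0 G)"
proof -
  have "(LINT t|\<mu>. cmod (W F G t)) \<le> 2 * 1 * (nrm0 F * nrm0 G)"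
  proof (rule amgm_optimize)
    fix s :: real assume s: "s > 0"
    let ?F = "\<lambda>x. of_real s * F x" and ?G = "\<lambda>x. of_real (1 / s) * G x"
    have FG: "?F \<in> V0" "?G \<in> V0"
      by (rule ell2_scale[OF F], rule ell2_scale[OF G])
    have "AE t in \<mu>. W ?F ?G t = W F G t"
      using W_scale_left[OF F FG(2), of "of_real s"] W_scale_right[OF F G, of "of_real (1/s)"]
      by eventually_elim (use s in simp)
    hence "(LINT t|\<mu>. cmod (W F G t)) = (LINT t|\<mu>. cmod (W ?F ?G t))"
      by (intro integral_cong_AE borel_measurable_integrable[OF integrable_norm[OF W_integrable[OF F G]]]
            borel_measurable_integrable[OF integrable_norm[OF W_integrable[OF FG]]])
         (auto elim!: eventually_mono)
    also have "\<dots> \<le> (nrm0 ?F)\<^sup>2 + (nrm0 ?G)\<^sup>2"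
      by (rule W_integrable_crude(2)[OF FG])
    also have "\<dots> = 1 * (s\<^sup>2 * (nrm0 F)\<^sup>2 + (nrm0 G)\<^sup>2 / s\<^sup>2)"
      unfolding ell2_norm_scale using s by (simp add: power_mult_distrib power_divide norm_divide)
    finally show "(LINT t|\<mu>. cmod (W F G t)) \<le> 1 * (s\<^sup>2 * (nrm0 F)\<^sup>2 + (nrm0 G)\<^sup>2 / s\<^sup>2)" .
  qed auto
  thus ?thesis by simp
qed

text \<open>On the range of \<open>E {6}\<close> one has \<open>L = 6\<close>, so \<open>\<parallel>T k\<parallel>\<^sup>2 = \<langle>(6 - L) k, k\<rangle> = 0\<close> there.  Thus \<open>T E {6} = 0\<close>,
  and taking adjoints gives the claim.  An atom of the spectral measure at 6 is therefore invisible on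
  the edges.\<close>

lemma E6_inc_adj:
  assumes F: "F \<in> V0" shows "E {6} (inc_adj F) = (\<lambda>x. 0)"
proof (rule ell2_eqI)
  have s6: "{6::real} \<in> sets borel" by simp
  have u: "inc_adj F \<in> V" using F by auto
  thus "E {6} (inc_adj F) \<in> V" using s6 by auto
  fix g assume g: "g \<in> V"
  define k where "k = E {6} g"
  have k: "k \<in> V" unfolding k_def by (rule E_ell2[OF s6 g])
  have Ek: "E {6} k = k" unfolding k_def using E_Int[OF s6 s6 g] by simp
  let ?d = "\<lambda>t. indicat_real {6} t *\<^sub>R D k k t"
  have d: "dens k k ?d" using dens_E_left[OF dens_D[OF k k] s6 k] by (simp only: Ek)
  have "ip (lap k) k = (LINT t|\<mu>. t *\<^sub>R ?d t)" by (rule lap_diagonal[OF d k])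
  also have "\<dots> = (LINT t|\<mu>. 6 * ?d t)"
    by (rule Bochner_Integration.integral_cong) (auto simp: indicator_def scaleR_conv_of_real)
  also have "\<dots> = 6 * (LINT t|\<mu>. ?d t)" by (rule integral_mult_right_zero)
  also have "\<dots> = 6 * ip k k"
    using dens_inner[OF d, of UNIV] by (simp add: E_UNIV k set_lebesgue_integral_def)
  finally have "ip0 (inc k) (inc k) = 0" using lap_inner[OF k k] by simp
  hence "inc k = (\<lambda>x. 0)"
    using ell2_norm_eq_0_iff[OF inc_ell2[OF k]] ell2_inner_self[OF inc_ell2[OF k]] by simp
  thus "ip (E {6} (inc_adj F)) g = ip (\<lambda>x. 0) g"
    using E_selfadjoint[OF s6 u g] inc_adjoint'[OF F k] by (simp add: k_def)
qed auto

lemma D_vanishes: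
  assumes u: "u \<in> V" and v: "v \<in> V" and B: "B \<in> sets borel" and 0: "E B u = (\<lambda>x. 0)"
  shows "AE t in \<mu>. t \<in> B \<longrightarrow> D u v t = 0"
proof -
  have "dens (\<lambda>x. 0) v (\<lambda>t. indicat_real B t *\<^sub>R D u v t)"
    using dens_E_left[OF dens_D[OF u v] B u] by (simp only: 0)
  from dens_unique[OF this dens_zero[OF this]] show ?thesis
    by eventually_elim (auto simp: indicator_def)
qed

lemma set_integral_cong_ae:
  assumes "integrable \<mu> f" "integrable \<mu> g" "AE t in \<mu>. f t = (g t :: complex)" "B \<in> sets borel"
  shows "(LINT t:B|\<mu>. f t) = (LINT t:B|\<mu>. g t)"
  unfolding set_lebesgue_integral_def
  using integrable_restrict[OF assms(1,4)] integrable_restrict[OF assms(2,4)] assms(3)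
  unfolding set_integrable_def
  by (intro integral_cong_AE borel_measurable_integrable) (auto elim!: eventually_mono)

lemma set_integral_norm_le:
  assumes "integrable \<mu> f" "B \<in> sets borel"
  shows "cmod (LINT t:B|\<mu>. f t) \<le> (LINT t|\<mu>. cmod (f t))"
proof -
  have i: "integrable \<mu> (\<lambda>t. indicat_real B t *\<^sub>R f t)"
    using integrable_restrict[OF assms] by (simp add: set_integrable_def)
  have "cmod (LINT t:B|\<mu>. f t) \<le> (LINT t|\<mu>. cmod (indicat_real B t *\<^sub>R f t))"
    unfolding set_lebesgue_integral_def by (rule integral_norm_bound)
  also have "\<dots> \<le> (LINT t|\<mu>. cmod (f t))"
    by (rule integral_mono[OF integrable_norm[OF i] integrable_norm[OF assms(1)]]) (auto simp: indicator_def)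
  finally show ?thesis .
qed

lemma W_eq_0:
  assumes F: "F \<in> V0" and G: "G \<in> V0" and 0: "inc_adj G = (\<lambda>a. 0)"
  shows "AE t in \<mu>. W F G t = 0"
proof -
  have u: "inc_adj F \<in> V" using F by auto
  have "dens (\<lambda>a. 0) (inc_adj F) (\<lambda>t. 0)" by (rule dens_zero[OF dens_D[OF u u]])
  hence "dens (inc_adj F) (inc_adj G) (\<lambda>t. cnj 0)" unfolding 0 by (rule dens_cnj) (use u in auto)
  from W_dens[OF this F G] show ?thesis by simp
qed

section \<open>Projections away from the eigenvalue 6\<close>

text \<open>The operator \<open>T (6 - L)\<^sup>-\<^sup>1 E(B) T\<^sup>*\<close>, given by its matrix elements.\<close>

definition Q :: "real set \<Rightarrow> ('a set \<Rightarrow> complex) \<Rightarrow> 'a set \<Rightarrow> complex" where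
  "Q B F = (\<lambda>x. if x \<in> verts \<Gamma>\<^sub>0 then LINT t:B|\<mu>. W F (delta x) t else 0)"

lemma
  assumes B: "B \<in> sets borel" and F: "F \<in> V0"
  shows Q_ell2: "Q B F \<in> V0"
    and Q_inner: "G \<in> V0 \<Longrightarrow> ip0 (Q B F) G = (LINT t:B|\<mu>. W F G t)"
proof -
  let ?q = "\<lambda>F G. LINT t:B|\<mu>. W F G t"
  have add: "?q F (\<lambda>x. H x + K x) = ?q F H + ?q F K" if "H \<in> V0" "K \<in> V0" for H K
  proof -
    note i = W_integrable[OF F that(1)] W_integrable[OF F that(2)]
    have "?q F (\<lambda>x. H x + K x) = (LINT t:B|\<mu>. W F H t + W F K t)"
      by (rule set_integral_cong_ae[OF W_integrable[OF F ell2_add[OF that]] Bochner_Integration.integrable_add[OF i]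
            W_add_right[OF F that] B])
    also have "\<dots> = ?q F H + ?q F K"
      by (rule set_integral_add(2)[OF i[THEN integrable_restrict[OF _ B]]])
    finally show ?thesis .
  qed
  have scale: "?q F (\<lambda>x. c * H x) = cnj c * ?q F H" if "H \<in> V0" for c H
  proof -
    have "?q F (\<lambda>x. c * H x) = (LINT t:B|\<mu>. cnj c * W F H t)"
      by (rule set_integral_cong_ae[OF W_integrable[OF F ell2_scale[OF that]]
            integrable_mult_right[OF W_integrable[OF F that]] W_scale_right[OF F that] B])
    thus ?thesis by simp
  qed
  have bound: "cmod (?q F H) \<le> (2 * nrm0 F) * nrm0 H" if "H \<in> V0" for H
    using set_integral_norm_le[OF W_integrable[OF F that] B] W_L1_bound[OF F that] by simp
  note r = bounded_form_represented[of \<Gamma>\<^sub>0 "?q F", OF add scale bound]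
  show "Q B F \<in> V0" unfolding Q_def by (rule r(1)) simp_all
  show "ip0 (Q B F) G = (LINT t:B|\<mu>. W F G t)" if "G \<in> V0"
    unfolding Q_def by (rule r(2)) (simp_all add: that)
qed

lemma Q_eqI:
  assumes "\<And>x. x \<in> verts \<Gamma>\<^sub>0 \<Longrightarrow> (LINT t:B|\<mu>. W F (delta x) t) = H x" "H \<in> V0"
  shows "Q B F = H"
  using assms(1) ell2_off[OF assms(2)] by (auto simp: Q_def fun_eq_iff)

lemma Q_linear: "B \<in> sets borel \<Longrightarrow> ell2_linear \<Gamma>\<^sub>0 (Q B)"
  unfolding ell2_linear_def
proof (intro conjI ballI allI)
  fix F G c assume B: "B \<in> sets borel" and F: "F \<in> V0"
  show "Q B F \<in> V0" by (rule Q_ell2[OF B F])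
  show "Q B (\<lambda>x. c * F x) = (\<lambda>x. c * Q B F x)"
  proof (rule Q_eqI)
    fix x assume x: "x \<in> verts \<Gamma>\<^sub>0"
    have dx: "delta x \<in> V0" by (rule delta_ell2[OF x])
    have "(LINT t:B|\<mu>. W (\<lambda>x. c * F x) (delta x) t) = (LINT t:B|\<mu>. c * W F (delta x) t)"
      by (rule set_integral_cong_ae[OF W_integrable[OF ell2_scale[OF F] dx]
            integrable_mult_right[OF W_integrable[OF F dx]] W_scale_left[OF F dx] B])
    thus "(LINT t:B|\<mu>. W (\<lambda>x. c * F x) (delta x) t) = c * Q B F x" using x by (simp add: Q_def)
  qed (use Q_ell2[OF B F] in auto)
  assume G: "G \<in> V0"
  show "Q B (\<lambda>x. F x + G x) = (\<lambda>x. Q B F x + Q B G x)"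
  proof (rule Q_eqI)
    fix x assume x: "x \<in> verts \<Gamma>\<^sub>0"
    have dx: "delta x \<in> V0" by (rule delta_ell2[OF x])
    note i = W_integrable[OF F dx] W_integrable[OF G dx]
    have "(LINT t:B|\<mu>. W (\<lambda>x. F x + G x) (delta x) t) = (LINT t:B|\<mu>. W F (delta x) t + W G (delta x) t)"
      by (rule set_integral_cong_ae[OF W_integrable[OF ell2_add[OF F G] dx]
            Bochner_Integration.integrable_add[OF i] W_add_left[OF F G dx] B])
    also have "\<dots> = (LINT t:B|\<mu>. W F (delta x) t) + (LINT t:B|\<mu>. W G (delta x) t)"
      by (rule set_integral_add(2)[OF i[THEN integrable_restrict[OF _ B]]])
    finally show "(LINT t:B|\<mu>. W (\<lambda>x. F x + G x) (delta x) t) = Q B F x + Q B G x"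
      using x by (simp add: Q_def)
  qed (use Q_ell2[OF B F] Q_ell2[OF B G] in auto)
qed

lemma Q_selfadjoint:
  assumes B: "B \<in> sets borel" and F: "F \<in> V0" and G: "G \<in> V0"
  shows "ip0 (Q B F) G = ip0 F (Q B G)"
proof -
  have "ip0 F (Q B G) = cnj (LINT t:B|\<mu>. W G F t)"
    by (subst ell2_inner_cnj) (simp add: Q_inner[OF B G F])
  also have "\<dots> = (LINT t:B|\<mu>. cnj (W G F t))"
    unfolding set_lebesgue_integral_def by (subst Bochner_Integration.integral_cnj[symmetric]) simp
  also have "\<dots> = (LINT t:B|\<mu>. W F G t)"
    by (rule set_integral_cong_ae) (use W_integrable[OF F G] W_integrable[OF G F] W_cnj[OF G F] B in auto)
  finally show ?thesis using Q_inner[OF B F G] by simp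
qed

lemma D_lap_right:
  assumes u: "u \<in> V" and g: "g \<in> V"
  shows "dens u (lap g) (\<lambda>t. t *\<^sub>R D u g t)"
  using dens_cnj[OF dens_lap_left[OF dens_cnj[OF dens_D[OF u g] u g] g u] lap_ell2[OF g] u] by simp

lemma dens_inc_adj_inc:
  assumes u: "u \<in> V" and g: "g \<in> V"
  shows "dens u (inc_adj (inc g)) (\<lambda>t. (6 - t) *\<^sub>R D u g t)"
proof -
  have "dens u (\<lambda>x. 6 * g x + (-1) * lap g x) (\<lambda>t. cnj 6 * D u g t + cnj (-1) * (t *\<^sub>R D u g t))"
    by (intro dens_add_right dens_scale_right D_lap_right dens_D u g ell2_scale lap_ell2)
  moreover have "(\<lambda>x. 6 * g x + (-1) * lap g x) = inc_adj (inc g)"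
    by (simp add: inc_adj_inc[OF g] fun_eq_iff)
  moreover have "(\<lambda>t. cnj 6 * D u g t + cnj (-1) * (t *\<^sub>R D u g t)) = (\<lambda>t. (6 - t) *\<^sub>R D u g t)"
    by (simp add: fun_eq_iff scaleR_conv_of_real algebra_simps)
  ultimately show ?thesis by simp
qed

text \<open>Against \<open>T g\<close> the weight cancels, since \<open>T\<^sup>* T g = (6 - L) g\<close> has the density \<open>(6 - t) D\<close>; at
  \<open>t = 6\<close>, where the weight is 0, the density vanishes.\<close>

lemma inc_adj_Q:
  assumes B: "B \<in> sets borel" and F: "F \<in> V0"
  shows "inc_adj (Q B F) = E B (inc_adj F)"
proof (rule ell2_eqI)
  have u: "inc_adj F \<in> V" using F by auto
  show "E B (inc_adj F) \<in> V" using B u by auto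
  show "inc_adj (Q B F) \<in> V" using Q_ell2[OF B F] by auto
  fix g assume g: "g \<in> V"
  have ig: "inc g \<in> V0" using g by auto
  let ?u = "inc_adj F"
  note 1 = W_dens[OF dens_inc_adj_inc[OF u g] F ig]
  have 2: "AE t in \<mu>. t \<in> {6} \<longrightarrow> D ?u g t = 0"
    by (rule D_vanishes[OF u g _ E6_inc_adj[OF F]]) simp
  have AE: "AE t in \<mu>. W F (inc g) t = D ?u g t"
    using 1 2 AE_space
  proof eventually_elim
    case (elim t)
    show ?case
    proof (cases "t = 6")
      case True thus ?thesis using elim by (simp add: weight_def)
    next
      case False
      hence t: "t < 6" using elim by (simp add: space_\<mu>)
      have "W F (inc g) t = of_real (weight t * (6 - t)) * D ?u g t"
        using elim by (simp add: scaleR_conv_of_real)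
      also have "weight t * (6 - t) = 1" using t by (simp add: weight_def)
      finally show ?thesis by simp
    qed
  qed
  have "ip (inc_adj (Q B F)) g = (LINT t:B|\<mu>. W F (inc g) t)"
    using inc_adjoint'[OF Q_ell2[OF B F] g] Q_inner[OF B F ig] by simp
  also have "\<dots> = (LINT t:B|\<mu>. D ?u g t)"
    by (rule set_integral_cong_ae[OF W_integrable[OF F ig] integrable_D[OF u g] AE B])
  also have "\<dots> = ip (E B (inc_adj F)) g" by (rule dens_inner[OF dens_D[OF u g] B, symmetric])
  finally show "ip (inc_adj (Q B F)) g = ip (E B (inc_adj F)) g" .
qed

lemma W_Q:
  assumes B: "B \<in> sets borel" and F: "F \<in> V0" and G: "G \<in> V0"
  shows "AE t in \<mu>. W (Q B F) G t = indicator B t *\<^sub>R W F G t"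
proof -
  have "dens (inc_adj (Q B F)) (inc_adj G) (\<lambda>t. indicat_real B t *\<^sub>R D (inc_adj F) (inc_adj G) t)"
    unfolding inc_adj_Q[OF B F] by (intro dens_E_left dens_D B) (use F G in auto)
  from W_dens[OF this Q_ell2[OF B F] G] show ?thesis
    by eventually_elim (simp add: W_def mult.commute)
qed

lemma Q_Q:
  assumes A: "A \<in> sets borel" and B: "B \<in> sets borel" and F: "F \<in> V0"
  shows "Q A (Q B F) = Q (A \<inter> B) F"
proof (rule Q_eqI)
  fix x assume x: "x \<in> verts \<Gamma>\<^sub>0"
  have dx: "delta x \<in> V0" by (rule delta_ell2[OF x])
  have i: "integrable \<mu> (\<lambda>t. indicat_real B t *\<^sub>R W F (delta x) t)"
    using integrable_restrict[OF W_integrable[OF F dx] B] by (simp add: set_integrable_def)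
  have "(LINT t:A|\<mu>. W (Q B F) (delta x) t) = (LINT t:A|\<mu>. indicat_real B t *\<^sub>R W F (delta x) t)"
    by (rule set_integral_cong_ae[OF W_integrable[OF Q_ell2[OF B F] dx] i W_Q[OF B F dx] A])
  also have "\<dots> = Q (A \<inter> B) F x"
    using x by (simp add: Q_def set_lebesgue_integral_def indicator_inter_arith)
  finally show "(LINT t:A|\<mu>. W (Q B F) (delta x) t) = Q (A \<inter> B) F x" .
qed (use Q_ell2 A B F in auto)

text \<open>\<open>T\<^sup>*\<close> kills \<open>F - Q UNIV F\<close> because \<open>T\<^sup>* Q UNIV F = T\<^sup>* F\<close>, and \<open>Q UNIV F\<close> is orthogonal to the kernel of
  \<open>T\<^sup>*\<close> because \<open>W F k = 0\<close> for \<open>k\<close> in it.  So the orthogonal projection exists and is explicit.\<close>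

lemma proj_onto_E6:
  assumes F: "F \<in> V0"
  shows "proj_onto \<Gamma>\<^sub>0 (eigenspace \<Gamma>\<^sub>0 6) F = (\<lambda>x. F x - Q UNIV F x)"
proof -
  have U: "(UNIV :: real set) \<in> sets borel" by simp
  note QF = Q_ell2[OF U F]
  let ?h = "\<lambda>x. F x - Q UNIV F x"
  have h: "?h \<in> V0" using F QF by auto
  have h6: "?h \<in> eigenspace \<Gamma>\<^sub>0 6"
    using h by (simp add: eigenspace6 inc_adj_diff inc_adj_Q[OF U F] E_UNIV inc_adj_ell2[OF F])
  have orth: "ip0 (\<lambda>x. F x - ?h x) k = 0" if "k \<in> eigenspace \<Gamma>\<^sub>0 6" for k
  proof -
    have k: "k \<in> V0" "inc_adj k = (\<lambda>a. 0)" using that by (auto simp: eigenspace6)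
    have "ip0 (\<lambda>x. F x - ?h x) k = (LINT t:UNIV|\<mu>. W F k t)" using Q_inner[OF U F k(1)] by simp
    also have "\<dots> = (LINT t:UNIV|\<mu>. 0)"
      by (rule set_integral_cong_ae[OF W_integrable[OF F k(1)] _ W_eq_0[OF F k]]) auto
    finally show ?thesis by (simp add: set_lebesgue_integral_def)
  qed
  show ?thesis
    unfolding proj_onto_def
  proof (rule the_equality)
    show "?h \<in> eigenspace \<Gamma>\<^sub>0 6 \<and> (\<forall>k\<in>eigenspace \<Gamma>\<^sub>0 6. ip0 (\<lambda>x. F x - ?h x) k = 0)"
      using h6 orth by blast
    fix g assume g: "g \<in> eigenspace \<Gamma>\<^sub>0 6 \<and> (\<forall>k\<in>eigenspace \<Gamma>\<^sub>0 6. ip0 (\<lambda>x. F x - g x) k = 0)"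
    have gl: "g \<in> V0" using g by (simp add: eigenspace6)
    let ?k = "\<lambda>x. ?h x - g x"
    have kl: "?k \<in> V0" using h gl by auto
    have k: "?k \<in> eigenspace \<Gamma>\<^sub>0 6"
      using g h6 kl by (simp add: eigenspace6 inc_adj_diff[of ?h g])
    have "ip0 (\<lambda>x. (F x - g x) - (F x - ?h x)) ?k = 0"
      using g orth[OF k] k F gl h kl by (subst ell2_inner_diff_left) (auto intro!: ell2_diff Q_ell2)
    hence "ip0 ?k ?k = 0" by (simp add: algebra_simps)
    hence "?k = (\<lambda>x. 0)" using ell2_norm_eq_0_iff[OF kl] ell2_inner_self[OF kl] by simp
    thus "g = ?h" by (simp add: fun_eq_iff)
  qed
qed

end

section \<open>Generalized eigenfunctions on the edge graph\<close>

context cubic_spectral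
begin

lemma dens_shift:
  fixes z :: real
  assumes "dens u v d" "u \<in> V" "v \<in> V"
  shows "dens (\<lambda>x. lap u x - of_real z * u x) v (\<lambda>t. (t - z) *\<^sub>R d t)"
proof -
  have "dens (\<lambda>x. lap u x + (- of_real z) * u x) v (\<lambda>t. t *\<^sub>R d t + (- of_real z) * d t)"
    by (intro dens_add_left dens_lap_left dens_scale_left assms lap_ell2 ell2_scale)
  moreover have "(\<lambda>t. t *\<^sub>R d t + (- of_real z) * d t) = (\<lambda>t. (t - z) *\<^sub>R d t)"
    by (simp add: fun_eq_iff scaleR_conv_of_real algebra_simps)
  ultimately show ?thesis by simp
qed

lemma approximate_eigenvector:
  assumes I: "I \<in> sets borel" and k: "k \<in> V" and Ek: "E I k = k"
    and le: "\<And>t. t \<in> I \<Longrightarrow> \<bar>t - z\<bar> \<le> e" and e: "0 \<le> e"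
  shows "nrm (\<lambda>x. lap k x - of_real z * k x) \<le> e * nrm k"
proof (rule power2_le_imp_le)
  let ?m = "\<lambda>x. lap k x - of_real z * k x"
  let ?d = "\<lambda>t. indicat_real I t *\<^sub>R D k k t"
  have m: "?m \<in> V" by (intro ell2_diff ell2_scale lap_ell2 k)
  have d: "dens k k ?d" using dens_E_left[OF dens_D[OF k k] I k] by (simp only: Ek)
  let ?dm = "\<lambda>t. (t - z) *\<^sub>R cnj ((t - z) *\<^sub>R ?d t)"
  have dm: "dens ?m ?m ?dm"
    by (rule dens_shift[OF dens_cnj[OF dens_shift[OF d k k] m k] k m])
  have "of_real ((nrm ?m)\<^sup>2) = (LINT t|\<mu>. ?dm t)"
    using dens_inner[OF dm, of UNIV] by (simp add: E_UNIV m ell2_inner_self set_lebesgue_integral_def)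
  hence "(nrm ?m)\<^sup>2 = (LINT t|\<mu>. Re (?dm t))"
    using integral_Re[OF dens_integrable[OF dm]] by (metis Re_complex_of_real)
  also have "\<dots> \<le> (LINT t|\<mu>. e\<^sup>2 * Re (?d t))"
  proof (rule integral_mono_AE)
    show "integrable \<mu> (\<lambda>t. Re (?dm t))" by (rule integrable_Re[OF dens_integrable[OF dm]])
    show "integrable \<mu> (\<lambda>t. e\<^sup>2 * Re (?d t))"
      by (rule integrable_mult_right[OF integrable_Re[OF dens_integrable[OF d]]])
    show "AE t in \<mu>. Re (?dm t) \<le> e\<^sup>2 * Re (?d t)"
      using D_nonneg[OF k]
    proof eventually_elim
      case (elim t)
      show ?case
      proof (cases "t \<in> I")
        case True
        have "(t - z)\<^sup>2 \<le> e\<^sup>2" using le[OF True] e by (simp add: abs_le_square_iff[symmetric])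
        hence "(t - z)\<^sup>2 * Re (D k k t) \<le> e\<^sup>2 * Re (D k k t)" using elim by (intro mult_right_mono) auto
        thus ?thesis using True by (simp add: power2_eq_square mult.assoc)
      qed simp
    qed
  qed
  also have "\<dots> = e\<^sup>2 * Re (LINT t|\<mu>. ?d t)"
    unfolding integral_mult_right_zero integral_Re[OF dens_integrable[OF d]] ..
  also have "\<dots> = e\<^sup>2 * (nrm k)\<^sup>2"
  proof -
    have "of_real ((nrm k)\<^sup>2) = (LINT t|\<mu>. ?d t)"
      using dens_inner[OF d, of UNIV] by (simp add: E_UNIV k ell2_inner_self set_lebesgue_integral_def)
    hence "Re (LINT t|\<mu>. ?d t) = (nrm k)\<^sup>2" by (metis Re_complex_of_real)
    thus ?thesis by simp
  qed
  finally show "(nrm ?m)\<^sup>2 \<le> (e * nrm k)\<^sup>2" by (simp add: power_mult_distrib)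
  show "0 \<le> e * nrm k" using e by simp
qed

text \<open>The union \<open>gap\<close> of the rational intervals with vanishing spectral projection contains all real points
  outside the spectrum.  It is a countable union, so all densities vanish almost everywhere on it.\<close>

definition gaps :: "(rat \<times> rat) set" where
  "gaps = {(p, q). \<forall>u\<in>V. E {real_of_rat p<..<real_of_rat q} u = (\<lambda>x. 0)}"

definition gap :: "real set" where
  "gap = (\<Union>(p, q)\<in>gaps. {real_of_rat p<..<real_of_rat q})"

lemma gap_borel: "gap \<in> sets borel"
  unfolding gap_def by (intro borel_open open_UN) auto

lemma D_gap:
  assumes u: "u \<in> V" and v: "v \<in> V"
  shows "AE t in \<mu>. t \<in> gap \<longrightarrow> D u v t = 0"
proof -
  have "AE t in \<mu>. \<forall>i\<in>gaps. t \<in> {real_of_rat (fst i)<..<real_of_rat (snd i)} \<longrightarrow> D u v t = 0"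
  proof (subst AE_ball_countable)
    show "countable gaps" by (rule countableI_type)
    show "\<forall>i\<in>gaps. AE t in \<mu>. t \<in> {real_of_rat (fst i)<..<real_of_rat (snd i)} \<longrightarrow> D u v t = 0"
      using u by (intro ballI D_vanishes[OF u v]) (auto simp: gaps_def)
  qed
  thus ?thesis by eventually_elim (force simp: gap_def)
qed

text \<open>On the range of \<open>E(I)\<close>, for an interval \<open>I\<close> of radius less than \<open>e\<close> around \<open>z\<close>, the operator \<open>L - z\<close>
  has norm at most \<open>e\<close>.  If \<open>e\<close> times the norm of the resolvent at \<open>z\<close> is at most \<open>1/2\<close>, the range is 0.\<close>

lemma outside_spectrum_gap:
  fixes z :: real
  assumes "complex_of_real z \<notin> spectrum \<Gamma> lap" shows "z \<in> gap"
proof -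
  obtain R where R: "ell2_bounded \<Gamma> R" and inv: "\<And>f. f \<in> V \<Longrightarrow> R (\<lambda>x. lap f x - of_real z * f x) = f"
    using assms unfolding spectrum_def by blast
  obtain C where C: "\<And>f. f \<in> V \<Longrightarrow> nrm (R f) \<le> C * nrm f"
    using R unfolding ell2_bounded_def by blast
  define e where "e = 1 / (2 * (\<bar>C\<bar> + 1))"
  have e: "0 < e" "\<bar>C\<bar> * e \<le> 1/2" by (auto simp: e_def field_simps)
  obtain p where p: "z - e < real_of_rat p" "real_of_rat p < z" using of_rat_dense[of "z - e" z] e by auto
  obtain q where q: "z < real_of_rat q" "real_of_rat q < z + e" using of_rat_dense[of z "z + e"] e by auto
  let ?I = "{real_of_rat p<..<real_of_rat q}"
  have I: "?I \<in> sets borel" by simp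
  have "E ?I u = (\<lambda>x. 0)" if u: "u \<in> V" for u
  proof -
    define k where "k = E ?I u"
    have k: "k \<in> V" unfolding k_def by (rule E_ell2[OF I u])
    have Ek: "E ?I k = k" unfolding k_def using E_Int[OF I I u] by simp
    let ?m = "\<lambda>x. lap k x - of_real z * k x"
    have m: "?m \<in> V" by (intro ell2_diff ell2_scale lap_ell2 k)
    have "nrm k \<le> C * nrm ?m" using C[OF m] inv[OF k] by simp
    also have "\<dots> \<le> \<bar>C\<bar> * nrm ?m" by (intro mult_right_mono) auto
    also have "\<dots> \<le> \<bar>C\<bar> * (e * nrm k)"
      by (intro mult_left_mono approximate_eigenvector[OF I k Ek]) (use p q e in auto)
    also have "\<dots> \<le> 1/2 * nrm k" unfolding mult.assoc[symmetric] by (intro mult_right_mono e) auto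
    finally have "nrm k = 0" using ell2_norm_nonneg[of \<Gamma> k] by linarith
    thus ?thesis using ell2_norm_eq_0_iff[OF k] by (simp add: k_def)
  qed
  hence "(p, q) \<in> gaps" by (auto simp: gaps_def)
  thus ?thesis using p q unfolding gap_def by (intro UN_I[of "(p, q)"]) auto
qed

text \<open>For uncountably many edges \<open>x\<close>, the null sets outside which \<open>W F (delta x)\<close> is well behaved need not lie in a
  common one.  But for all but countably many \<open>x\<close> this density vanishes almost everywhere: by
  \<open>charges_eq\<close> it suffices to test countably many projections of \<open>T\<^sup>* F\<close>, and the image of each under \<open>T\<close>
  has countable support.\<close>

definition test_sets :: "real set set" where
  "test_sets = insert UNIV (range (\<lambda>q::rat. {..real_of_rat q}))"

definition active :: "('a set \<Rightarrow> complex) \<Rightarrow> 'a set set" where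
  "active F = {x \<in> edges \<Gamma>. \<exists>B\<in>test_sets. inc (E B (inc_adj F)) x \<noteq> 0}"

lemma countable_active:
  assumes F: "F \<in> V0" shows "countable (active F)"
proof -
  have "countable {x \<in> edges \<Gamma>. inc (E B (inc_adj F)) x \<noteq> 0}" if "B \<in> test_sets" for B
  proof -
    have "B \<in> sets borel" using that by (auto simp: test_sets_def)
    hence "inc (E B (inc_adj F)) \<in> V0" using F by auto
    from summable_countable_real[OF ell2_summable[OF this]] show ?thesis by simp
  qed
  hence "countable (\<Union>B\<in>test_sets. {x \<in> edges \<Gamma>. inc (E B (inc_adj F)) x \<noteq> 0})"
    by (intro countable_UN) (auto simp: test_sets_def)
  moreover have "active F = (\<Union>B\<in>test_sets. {x \<in> edges \<Gamma>. inc (E B (inc_adj F)) x \<noteq> 0})"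
    by (auto simp: active_def)
  ultimately show ?thesis by simp
qed

lemma D_inactive:
  assumes F: "F \<in> V0" and x: "x \<in> edges \<Gamma>" "x \<notin> active F"
  shows "AE t in \<mu>. D (inc_adj F) (inc_adj (delta x)) t = 0"
proof -
  have dx: "delta x \<in> V0" using x by auto
  let ?u = "inc_adj F" and ?v = "inc_adj (delta x)"
  have uv: "?u \<in> V" "?v \<in> V" using F dx by auto
  have test: "ip (E B ?u) ?v = 0" if "B \<in> test_sets" for B
  proof -
    have "B \<in> sets borel" using that by (auto simp: test_sets_def)
    hence "ip (E B ?u) ?v = inc (E B ?u) x"
      using inc_adjoint[OF E_ell2[OF _ uv(1)] dx] x by (simp add: ell2_inner_delta_right)
    thus ?thesis using x that by (auto simp: active_def)
  qed
  have z: "ip (E B ?u) ?v = 0" if B: "B \<in> sets borel" for B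
  proof (rule charges_eq[where ?N2.0 = "\<lambda>_. 0", OF E_charge[OF uv] _ _ _ B])
    show "charge (\<lambda>_. 0)" by (simp add: charge_def)
    show "ip (E UNIV ?u) ?v = 0" by (rule test) (simp add: test_sets_def)
    show "ip (E {..real_of_rat q} ?u) ?v = 0" for q by (rule test) (simp add: test_sets_def)
  qed
  show ?thesis
    by (rule AE_zeroI[OF integrable_D[OF uv]]) (simp add: z dens_inner[OF dens_D[OF uv], symmetric])
qed

text \<open>A representative of \<open>t \<mapsto> W F (delta x) t\<close> that is 0 outside the spectrum, so that its integrals over
  the spectrum are integrals over the whole line, and 0 at the inactive edges, so that
  statements about all edges at once hold almost everywhere.\<close>

definition PF :: "real \<Rightarrow> ('a set \<Rightarrow> complex) \<Rightarrow> 'a set \<Rightarrow> complex" where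
  "PF t F x = (if t \<in> gap \<or> x \<notin> active F then 0 else W F (delta x) t)"

lemma PF_AE:
  assumes F: "F \<in> V0" and x: "x \<in> edges \<Gamma>"
  shows "AE t in \<mu>. PF t F x = W F (delta x) t"
proof -
  have dx: "delta x \<in> V0" using x by auto
  have uv: "inc_adj F \<in> V" "inc_adj (delta x) \<in> V" using F dx by auto
  show ?thesis
  proof (cases "x \<in> active F")
    case True
    show ?thesis using D_gap[OF uv] by eventually_elim (auto simp: PF_def W_def True)
  next
    case False
    show ?thesis using D_inactive[OF F x False] by eventually_elim (auto simp: PF_def W_def False)
  qed
qed

lemma PF_measurable:
  assumes F: "F \<in> V0" and x: "x \<in> edges \<Gamma>"
  shows "(\<lambda>t. PF t F x) \<in> borel_measurable \<mu>"
proof -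
  have dx: "delta x \<in> V0" using x by auto
  have "integrable \<mu> (\<lambda>t. indicat_real (- gap) t *\<^sub>R W F (delta x) t)"
    using integrable_restrict[OF W_integrable[OF F dx], of "- gap"] gap_borel by (simp add: set_integrable_def)
  hence "(\<lambda>t. if x \<in> active F then indicat_real (- gap) t *\<^sub>R W F (delta x) t else 0) \<in> borel_measurable \<mu>"
    by (cases "x \<in> active F") (auto dest: borel_measurable_integrable)
  moreover have "(\<lambda>t. PF t F x) = (\<lambda>t. if x \<in> active F then indicat_real (- gap) t *\<^sub>R W F (delta x) t else 0)"
    by (auto simp: PF_def indicator_def)
  ultimately show ?thesis by simp
qed

lemma PF_integrable:
  assumes F: "F \<in> V0" and x: "x \<in> edges \<Gamma>"
  shows "integrable \<mu> (\<lambda>t. PF t F x)"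
proof -
  have "delta x \<in> V0" using x by auto
  hence "integrable \<mu> (W F (delta x))" by (rule W_integrable[OF F])
  thus ?thesis
    by (rule integrable_cong_AE_imp[OF _ PF_measurable[OF F x]])
       (use PF_AE[OF F x] in \<open>auto elim!: eventually_mono\<close>)
qed

lemma PF_integral:
  assumes F: "F \<in> V0" and x: "x \<in> edges \<Gamma>" and B: "B \<in> sets borel"
  shows "(LINT t:(B \<inter> {t. complex_of_real t \<in> spectrum \<Gamma> lap})|\<mu>. PF t F x) = Q B F x"
proof -
  let ?S = "{t. complex_of_real t \<in> spectrum \<Gamma> lap}"
  have "(LINT t:(B \<inter> ?S)|\<mu>. PF t F x) = (LINT t:B|\<mu>. PF t F x)"
    unfolding set_lebesgue_integral_def
    by (rule Bochner_Integration.integral_cong)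
       (use outside_spectrum_gap in \<open>auto simp: indicator_def PF_def\<close>)
  also have "\<dots> = (LINT t:B|\<mu>. W F (delta x) t)"
    by (rule set_integral_cong_ae[OF PF_integrable[OF F x] W_integrable[OF F] PF_AE[OF F x] B]) (use x in auto)
  finally show ?thesis using x by (simp add: Q_def)
qed

lemma dens_sum_right:
  assumes "finite I" "\<And>i. i \<in> I \<Longrightarrow> dens u (v i) (d i)" "\<And>i. i \<in> I \<Longrightarrow> v i \<in> V" "u \<in> V"
  shows "dens u (\<lambda>x. \<Sum>i\<in>I. v i x) (\<lambda>t. \<Sum>i\<in>I. d i t)"
proof -
  have "dens (\<lambda>x. \<Sum>i\<in>I. v i x) u (\<lambda>t. \<Sum>i\<in>I. cnj (d i t))"
    by (rule dens_sum_left[OF assms(1)]) (use assms in \<open>auto intro: dens_cnj\<close>)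
  from dens_cnj[OF this ell2_sum[OF assms(3)] assms(4)] show ?thesis by simp
qed

lemma inc_adj_delta:
  assumes y: "y \<in> edges \<Gamma>" shows "inc_adj (delta y) = (\<lambda>a. \<Sum>b\<in>y. delta b a)"
proof
  fix a
  have 1: "(\<Sum>b\<in>y. delta b a) = (if a \<in> y then 1 else 0)"
    using finite_edge[OF y] by (simp add: delta_def)
  show "inc_adj (delta y) a = (\<Sum>b\<in>y. delta b a)"
  proof (cases "a \<in> verts \<Gamma>")
    case True
    have "inc_adj (delta y) a = (if y \<in> star a then 1 else 0)"
      using True finite_star[OF True] by (simp add: inc_adj_def delta_def)
    thus ?thesis using y 1 by (simp add: star_def)
  next
    case False
    thus ?thesis using edge_subset[OF y] 1 by (auto simp: inc_adj_def)
  qed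
qed

text \<open>\<open>T\<^sup>*\<close> maps the point mass at an edge to the sum of the point masses at its two endpoints.\<close>

lemma edge_kernel_AE:
  assumes x: "x \<in> edges \<Gamma>" and y: "y \<in> edges \<Gamma>"
  shows "AE t in \<mu>. edge_kernel P t x y = W (delta y) (delta x) t"
proof -
  have d: "delta x \<in> V0" "delta y \<in> V0" using x y by auto
  have "dens (\<lambda>c. \<Sum>b\<in>y. delta b c) (\<lambda>c. \<Sum>a\<in>x. delta a c) (\<lambda>t. \<Sum>b\<in>y. \<Sum>a\<in>x. P t a b)"
  proof (rule dens_sum_left[OF finite_edge[OF y]])
    have xv: "a \<in> verts \<Gamma>" if "a \<in> x" for a using that edge_subset[OF x] by blast
    have yv: "b \<in> verts \<Gamma>" if "b \<in> y" for b using that edge_subset[OF y] by blast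
    show "dens (delta b) (\<lambda>c. \<Sum>a\<in>x. delta a c) (\<lambda>t. \<Sum>a\<in>x. P t a b)" if "b \<in> y" for b
      by (rule dens_sum_right[OF finite_edge[OF x]]) (simp_all add: dens_delta delta_ell2 xv yv[OF that])
    show "delta b \<in> V" if "b \<in> y" for b by (rule delta_ell2[OF yv[OF that]])
    show "(\<lambda>c. \<Sum>a\<in>x. delta a c) \<in> V" by (rule ell2_sum) (rule delta_ell2[OF xv])
  qed
  from W_dens[OF this[folded inc_adj_delta[OF x] inc_adj_delta[OF y]] d(2,1)] AE_space
  show ?thesis
  proof eventually_elim
    case (elim t)
    have "1 / complex_of_real (6 - t) = of_real (weight t)"
      using elim by (auto simp: weight_def space_\<mu>)
    hence "edge_kernel P t x y = weight t *\<^sub>R (\<Sum>b\<in>y. \<Sum>a\<in>x. P t a b)"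
      unfolding edge_kernel_def by (subst sum.swap) (simp add: scaleR_conv_of_real)
    thus ?case using elim by simp
  qed
qed

lemma edge_kernel_integrable:
  assumes x: "x \<in> edges \<Gamma>" and y: "y \<in> edges \<Gamma>"
  shows "integrable \<mu> (\<lambda>t. edge_kernel P t x y)"
proof -
  have d: "delta x \<in> V0" "delta y \<in> V0" using x y by auto
  have P: "(\<lambda>t. P t a b) \<in> borel_measurable \<mu>" if "a \<in> x" "b \<in> y" for a b
  proof -
    have "a \<in> verts \<Gamma>" "b \<in> verts \<Gamma>" using that edge_subset[OF x] edge_subset[OF y] by blast+
    from borel_measurable_integrable[OF dens_integrable[OF dens_delta[OF this]]] show ?thesis .
  qed
  have "(\<lambda>t. 1 / complex_of_real (6 - t)) \<in> borel_measurable \<mu>"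
    by (rule borel_measurableI) simp
  hence "(\<lambda>t. edge_kernel P t x y) \<in> borel_measurable \<mu>"
    unfolding edge_kernel_def by (intro borel_measurable_times borel_measurable_sum P)
  thus ?thesis
    by (rule integrable_cong_AE_imp[OF W_integrable[OF d(2,1)]])
       (use edge_kernel_AE[OF x y] in \<open>auto elim!: eventually_mono\<close>)
qed

lemma W_cutoff:
  assumes S: "finite S" "S \<subseteq> edges \<Gamma>" and G: "G \<in> V0"
  shows "AE t in \<mu>. W (cutoff S F) G t = (\<Sum>y\<in>S. F y * W (delta y) G t)"
  using S
proof (induction S)
  case empty
  have "AE t in \<mu>. W (\<lambda>x. 0 * 0) G t = 0 * W (\<lambda>x. 0) G t" by (rule W_scale_left) (use G in auto)
  thus ?case by (simp add: cutoff_def)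
next
  case (insert y S)
  have eq: "cutoff (insert y S) F = (\<lambda>x. F y * delta y x + cutoff S F x)"
    using insert by (auto simp: cutoff_def delta_def fun_eq_iff)
  have c: "cutoff S F \<in> V0"
    by (rule ell2_finite_support[of S]) (use insert in \<open>auto simp: cutoff_def\<close>)
  have d: "delta y \<in> V0" using insert by auto
  have IH: "AE t in \<mu>. W (cutoff S F) G t = (\<Sum>y\<in>S. F y * W (delta y) G t)" using insert by simp
  show ?case
    using W_add_left[OF ell2_scale[OF d, of "F y"] c G] W_scale_left[OF d G, of "F y"] IH unfolding eq
    by eventually_elim (use insert in simp)
qed

text \<open>The difference to a finite partial sum is \<open>W\<close> at the tail of \<open>F\<close>, which \<open>W_L1_bound\<close> controls.\<close>

lemma PF_L1_sum:
  assumes F: "F \<in> V0" and x: "x \<in> edges \<Gamma>"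
  shows "has_L1_sum \<mu> (\<lambda>y t. edge_kernel P t x y * F y) (edges \<Gamma>) (\<lambda>t. PF t F x)"
  unfolding has_L1_sum_def
proof (intro conjI ballI)
  show "integrable \<mu> (\<lambda>t. edge_kernel P t x y * F y)" if "y \<in> edges \<Gamma>" for y
    using edge_kernel_integrable[OF x that] by simp
  show "integrable \<mu> (\<lambda>t. PF t F x)" by (rule PF_integrable[OF F x])
  have dx: "delta x \<in> V0" using x by auto
  let ?I = "\<lambda>S. \<integral>\<^sup>+t. ennreal (cmod (PF t F x - (\<Sum>y\<in>S. edge_kernel P t x y * F y))) \<partial>\<mu>"
  let ?b = "\<lambda>S. 2 * (nrm0 (\<lambda>x. F x - cutoff S F x) * nrm0 (delta x))"
  have le: "?I S \<le> ennreal (?b S)" if S: "finite S" "S \<subseteq> edges \<Gamma>" for S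
  proof -
    let ?G = "\<lambda>x. F x - cutoff S F x"
    have c: "cutoff S F \<in> V0" and G: "?G \<in> V0" using F by auto
    have 1: "AE t in \<mu>. \<forall>y\<in>S. edge_kernel P t x y = W (delta y) (delta x) t"
      using S x by (subst AE_ball_countable) (auto intro!: edge_kernel_AE countable_finite)
    have 2: "AE t in \<mu>. W F (delta x) t = W ?G (delta x) t + W (cutoff S F) (delta x) t"
      using W_add_left[OF G c dx] by simp
    have "AE t in \<mu>. PF t F x - (\<Sum>y\<in>S. edge_kernel P t x y * F y) = W ?G (delta x) t"
      using 1 2 W_cutoff[OF S dx, of F] PF_AE[OF F x] by eventually_elim (simp add: mult.commute)
    hence "?I S = (\<integral>\<^sup>+t. ennreal (cmod (W ?G (delta x) t)) \<partial>\<mu>)"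
      by (intro nn_integral_cong_AE) (auto elim!: eventually_mono)
    also have "\<dots> = ennreal (LINT t|\<mu>. cmod (W ?G (delta x) t))"
      by (rule nn_integral_eq_integral[OF integrable_norm[OF W_integrable[OF G dx]]]) simp
    also have "\<dots> \<le> ennreal (?b S)" by (rule ennreal_leI[OF W_L1_bound[OF G dx]])
    finally show ?thesis .
  qed
  have b: "((\<lambda>S. ennreal (?b S)) \<longlongrightarrow> ennreal (2 * (0 * nrm0 (delta x)))) (finite_subsets_at_top (edges \<Gamma>))"
    using ell2_norm_tail_tendsto[OF F]
    by (intro tendsto_ennrealI tendsto_mult tendsto_const) simp
  show "(?I \<longlongrightarrow> 0) (finite_subsets_at_top (edges \<Gamma>))"
  proof (rule tendsto_sandwich[OF _ _ tendsto_const])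
    show "\<forall>\<^sub>F S in finite_subsets_at_top (edges \<Gamma>). ?I S \<le> ennreal (?b S)"
      by (rule eventually_finite_subsets_at_top_weakI) (rule le)
    show "((\<lambda>S. ennreal (?b S)) \<longlongrightarrow> 0) (finite_subsets_at_top (edges \<Gamma>))" using b by simp
  qed simp
qed

text \<open>The double sum is \<open>W F (T T\<^sup>* (delta x))\<close>, and \<open>T\<^sup>* T T\<^sup>* = (6 - L) T\<^sup>*\<close>.\<close>

lemma W_eigen:
  assumes F: "F \<in> V0" and x: "x \<in> edges \<Gamma>"
  shows "AE t in \<mu>. (\<Sum>a\<in>x. \<Sum>y\<in>star a. W F (delta y) t) = of_real (6 - t) * W F (delta x) t"
proof -
  have dx: "delta x \<in> V0" using x by auto
  have vx: "a \<in> verts \<Gamma>" if "a \<in> x" for a using that edge_subset[OF x] by auto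
  have dy: "delta y \<in> V0" if "y \<in> star a" for a y using that by (auto simp: star_def)
  let ?u = "inc_adj F" and ?v = "inc_adj (delta x)"
  have uv: "?u \<in> V" "?v \<in> V" using F dx by auto
  have v: "?v a = (if a \<in> x then 1 else 0)" for a
    unfolding inc_adj_delta[OF x] using finite_edge[OF x] by (simp add: delta_def)
  have eq: "inc ?v = (\<lambda>z. \<Sum>a\<in>x. \<Sum>y\<in>star a. delta y z)"
  proof
    fix z
    have "(\<Sum>a\<in>x. \<Sum>y\<in>star a. delta y z) = (\<Sum>a\<in>x. if z \<in> star a then 1 else 0)"
      using vx by (intro sum.cong) (auto simp: delta_def finite_star)
    moreover have "inc ?v z = (\<Sum>a\<in>x. if z \<in> star a then 1 else 0)"
    proof (cases "z \<in> edges \<Gamma>")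
      case True
      have "inc ?v z = (\<Sum>a\<in>z. if a \<in> x then 1 else 0)"
        using True by (simp add: inc_def v)
      also have "\<dots> = of_nat (card (z \<inter> x))" using finite_edge[OF True] by (simp add: sum.If_cases)
      also have "\<dots> = (\<Sum>a\<in>x. if a \<in> z then 1 else 0)"
        using finite_edge[OF x] by (simp add: sum.If_cases Int_commute)
      finally show ?thesis using True by (simp add: star_def)
    next
      case False
      thus ?thesis by (simp add: inc_def star_def)
    qed
    ultimately show "inc ?v z = (\<Sum>a\<in>x. \<Sum>y\<in>star a. delta y z)" by simp
  qed
  have lin: "inc_adj (inc ?v) = (\<lambda>c. \<Sum>a\<in>x. \<Sum>y\<in>star a. inc_adj (delta y) c)"
    unfolding eq
  proof
    fix c show "inc_adj (\<lambda>z. \<Sum>a\<in>x. \<Sum>y\<in>star a. delta y z) c = (\<Sum>a\<in>x. \<Sum>y\<in>star a. inc_adj (delta y) c)"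
    proof (cases "c \<in> verts \<Gamma>")
      case True
      have "(\<Sum>z\<in>star c. \<Sum>a\<in>x. \<Sum>y\<in>star a. delta y z) = (\<Sum>a\<in>x. \<Sum>z\<in>star c. \<Sum>y\<in>star a. delta y z :: complex)"
        by (rule sum.swap)
      also have "\<dots> = (\<Sum>a\<in>x. \<Sum>y\<in>star a. \<Sum>z\<in>star c. delta y z)"
        by (intro sum.cong refl sum.swap)
      finally show ?thesis using True by (simp add: inc_adj_def)
    qed (simp add: inc_adj_def)
  qed
  have 1: "dens ?u (inc_adj (inc ?v)) (\<lambda>t. \<Sum>a\<in>x. \<Sum>y\<in>star a. D ?u (inc_adj (delta y)) t)"
    unfolding lin
    by (intro dens_sum_right dens_D ell2_sum finite_edge[OF x] finite_star inc_adj_ell2 dy vx uv)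
  show ?thesis using dens_unique[OF 1 dens_inc_adj_inc[OF uv]]
  proof eventually_elim
    case (elim t)
    have "(\<Sum>a\<in>x. \<Sum>y\<in>star a. W F (delta y) t) = weight t *\<^sub>R (\<Sum>a\<in>x. \<Sum>y\<in>star a. D ?u (inc_adj (delta y)) t)"
      by (simp add: W_def scaleR_sum_right)
    also have "\<dots> = of_real (6 - t) * W F (delta x) t"
      unfolding elim by (simp add: W_def scaleR_conv_of_real algebra_simps)
    finally show ?case .
  qed
qed

text \<open>At \<open>x\<close> the equation involves only \<open>x\<close> and the adjacent edges.  It is trivial if all of these are
  inactive, and the other edges \<open>x\<close> form the countable set \<open>Y\<close>.\<close>

lemma PF_eigen:
  assumes F: "F \<in> V0"
  shows "AE t in \<mu>. \<forall>x\<in>edges \<Gamma>. lap0 (PF t F) x = of_real t * PF t F x"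
proof -
  have ne: "nbrs \<Gamma>\<^sub>0 x \<subseteq> edges \<Gamma>" for x by (auto simp: nbrs_def)
  have fin: "finite (nbrs \<Gamma>\<^sub>0 x)" if "x \<in> edges \<Gamma>" for x
    using nbrs_edge_graph[OF that] finite_edge[OF that] edge_subset[OF that] finite_star by auto
  have ae: "active F \<subseteq> edges \<Gamma>" by (auto simp: active_def)
  define Y where "Y = active F \<union> (\<Union>x\<in>active F. nbrs \<Gamma>\<^sub>0 x)"
  have "countable (\<Union>x\<in>active F. nbrs \<Gamma>\<^sub>0 x)"
    by (rule countable_UN[OF countable_active[OF F]]) (use fin ae in \<open>auto intro!: countable_finite\<close>)
  hence Y: "countable Y" "Y \<subseteq> edges \<Gamma>"
    unfolding Y_def using countable_active[OF F] ae ne by auto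
  have "AE t in \<mu>. \<forall>x\<in>Y. lap0 (PF t F) x = of_real t * PF t F x"
  proof (subst AE_ball_countable[OF Y(1)], rule ballI)
    fix x assume "x \<in> Y"
    hence x: "x \<in> edges \<Gamma>" using Y by auto
    have vx: "a \<in> verts \<Gamma>" if "a \<in> x" for a using that edge_subset[OF x] by auto
    let ?N = "insert x (\<Union>a\<in>x. star a)"
    have "finite ?N" using finite_edge[OF x] vx finite_star by auto
    hence 1: "AE t in \<mu>. \<forall>y\<in>?N. PF t F y = W F (delta y) t"
      using x by (subst AE_ball_countable) (auto intro!: PF_AE[OF F] countable_finite simp: star_def)
    show "AE t in \<mu>. lap0 (PF t F) x = of_real t * PF t F x"
      using 1 W_eigen[OF F x]
    proof eventually_elim
      case (elim t)
      have "inc (inc_adj (PF t F)) x = (\<Sum>a\<in>x. \<Sum>y\<in>star a. PF t F y)"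
        using x vx by (simp add: inc_def inc_adj_def)
      also have "\<dots> = (\<Sum>a\<in>x. \<Sum>y\<in>star a. W F (delta y) t)"
        using elim(1) by (intro sum.cong) auto
      also have "\<dots> = of_real (6 - t) * PF t F x" using elim by simp
      finally have "6 * PF t F x - lap0 (PF t F) x = of_real (6 - t) * PF t F x"
        using inc_inc_adj_pointwise[OF x, of "PF t F"] by simp
      thus ?case by (simp add: neg_eq_iff_add_eq_0 algebra_simps)
    qed
  qed
  thus ?thesis
  proof eventually_elim
    case (elim t)
    show ?case
    proof
      fix x assume x: "x \<in> edges \<Gamma>"
      show "lap0 (PF t F) x = of_real t * PF t F x"
      proof (cases "x \<in> Y")
        case False
        have "y \<notin> active F" if "y \<in> nbrs \<Gamma>\<^sub>0 x" for y
        proof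
          assume "y \<in> active F"
          moreover have "x \<in> nbrs \<Gamma>\<^sub>0 y" using that x by (simp add: nbrs_def insert_commute)
          ultimately show False using False by (auto simp: Y_def)
        qed
        moreover have "x \<notin> active F" using False by (simp add: Y_def)
        ultimately show ?thesis by (simp add: laplacian_def PF_def)
      qed (use elim in auto)
    qed
  qed
qed

end

section \<open>The spectral projections of the edge graph\<close>

context cubic_spectral
begin

text \<open>The spectral projections of the edge graph: \<open>Q B\<close>, and at 6 also the projection onto the kernel of
  \<open>T\<^sup>*\<close>.\<close>

definition E0 :: "real set \<Rightarrow> ('a set \<Rightarrow> complex) \<Rightarrow> 'a set \<Rightarrow> complex" where
  "E0 B F = (\<lambda>x. (if 6 \<in> B then F x - Q UNIV F x else 0) + Q B F x)"

lemma Q_add: "B \<in> sets borel \<Longrightarrow> F \<in> V0 \<Longrightarrow> G \<in> V0 \<Longrightarrow>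
    Q B (\<lambda>x. F x + G x) = (\<lambda>x. Q B F x + Q B G x)"
  using Q_linear[of B] by (simp add: ell2_linear_def)

lemma Q_scale: "B \<in> sets borel \<Longrightarrow> F \<in> V0 \<Longrightarrow> Q B (\<lambda>x. c * F x) = (\<lambda>x. c * Q B F x)"
  using Q_linear[of B] by (simp add: ell2_linear_def)

lemma Q_diff:
  assumes B: "B \<in> sets borel" and F: "F \<in> V0" and G: "G \<in> V0"
  shows "Q B (\<lambda>x. F x - G x) = (\<lambda>x. Q B F x - Q B G x)"
  using Q_add[OF B F ell2_scale[OF G, of "-1"]] Q_scale[OF B G, of "-1"] by simp

lemma residual_ell2: "F \<in> V0 \<Longrightarrow> (\<lambda>x. F x - Q UNIV F x) \<in> V0"
  by (intro ell2_diff Q_ell2) auto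

lemma E0_ell2:
  assumes B: "B \<in> sets borel" and F: "F \<in> V0" shows "E0 B F \<in> V0"
  using ell2_add[OF residual_ell2[OF F] Q_ell2[OF B F]] Q_ell2[OF B F]
  by (cases "6 \<in> B") (simp_all add: E0_def)

lemma E0_inner:
  assumes B: "B \<in> sets borel" and F: "F \<in> V0" and G: "G \<in> V0"
  shows "ip0 (E0 B F) G =
    (if 6 \<in> B then ip0 F G - ip0 (Q UNIV F) G else 0) + ip0 (Q B F) G"
proof (cases "6 \<in> B")
  case True
  have U: "(UNIV :: real set) \<in> sets borel" by simp
  show ?thesis
    using True ell2_inner_add_left[OF residual_ell2[OF F] Q_ell2[OF B F] G]
      ell2_inner_diff_left[OF F Q_ell2[OF U F] G] by (simp add: E0_def)
qed (simp add: E0_def)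

lemma Q_E0:
  assumes A: "A \<in> sets borel" and B: "B \<in> sets borel" and F: "F \<in> V0"
  shows "Q A (E0 B F) = Q (A \<inter> B) F"
proof (cases "6 \<in> B")
  case True
  have U: "(UNIV :: real set) \<in> sets borel" by simp
  have "Q A (E0 B F) = (\<lambda>x. Q A (\<lambda>x. F x - Q UNIV F x) x + Q A (Q B F) x)"
    using Q_add[OF A residual_ell2[OF F] Q_ell2[OF B F]] True by (simp add: E0_def)
  thus ?thesis
    by (simp add: Q_diff[OF A F Q_ell2[OF U F]] Q_Q[OF A U F] Q_Q[OF A B F])
qed (simp add: E0_def Q_Q[OF A B F])

lemma E0_E0:
  assumes A: "A \<in> sets borel" and B: "B \<in> sets borel" and F: "F \<in> V0"
  shows "E0 A (E0 B F) = E0 (A \<inter> B) F"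
proof -
  have U: "(UNIV :: real set) \<in> sets borel" by simp
  have "E0 A (E0 B F) = (\<lambda>x. (if 6 \<in> A then E0 B F x - Q B F x else 0) + Q (A \<inter> B) F x)"
    unfolding E0_def[of A] Q_E0[OF A B F] Q_E0[OF U B F] Int_UNIV_left ..
  thus ?thesis by (simp add: E0_def fun_eq_iff)
qed

lemma E0_pvm:
  assumes E': "\<And>B F. B \<in> sets borel \<Longrightarrow> F \<in> V0 \<Longrightarrow> E' B F = E0 B F"
  shows "projection_valued_measure \<Gamma>\<^sub>0 E'"
proof -
  have U: "(UNIV :: real set) \<in> sets borel" by simp
  have lin: "ell2_linear \<Gamma>\<^sub>0 (E' B)" if B: "B \<in> sets borel" for B
    unfolding ell2_linear_def
  proof (intro conjI ballI allI)
    fix F G c assume F: "F \<in> V0"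
    show "E' B F \<in> V0" using E0_ell2[OF B F] E'[OF B F] by simp
    show "E' B (\<lambda>x. c * F x) = (\<lambda>x. c * E' B F x)"
      unfolding E'[OF B F] E'[OF B ell2_scale[OF F]]
      by (simp add: E0_def Q_scale[OF B F] Q_scale[OF U F] fun_eq_iff algebra_simps)
    assume G: "G \<in> V0"
    show "E' B (\<lambda>x. F x + G x) = (\<lambda>x. E' B F x + E' B G x)"
      unfolding E'[OF B F] E'[OF B G] E'[OF B ell2_add[OF F G]]
      by (simp add: E0_def Q_add[OF B F G] Q_add[OF U F G] fun_eq_iff algebra_simps)
  qed
  have proj: "orthogonal_projection \<Gamma>\<^sub>0 (E' B)" if B: "B \<in> sets borel" for B
    unfolding orthogonal_projection_def
  proof (intro conjI ballI lin[OF B])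
    fix F G assume F: "F \<in> V0"
    show "E' B (E' B F) = E' B F"
      using E0_E0[OF B B F] by (simp add: E'[OF B F] E'[OF B E0_ell2[OF B F]])
    assume G: "G \<in> V0"
    have "ip0 F (E0 B G) = cnj (ip0 (E0 B G) F)" by (rule ell2_inner_cnj)
    also have "\<dots> = (if 6 \<in> B then ip0 F G - ip0 F (Q UNIV G) else 0) + ip0 F (Q B G)"
      unfolding E0_inner[OF B G F] using ell2_inner_cnj[of \<Gamma>\<^sub>0 F G] ell2_inner_cnj[of \<Gamma>\<^sub>0 F "Q UNIV G"]
        ell2_inner_cnj[of \<Gamma>\<^sub>0 F "Q B G"] by simp
    also have "\<dots> = ip0 (E0 B F) G"
      unfolding E0_inner[OF B F G] Q_selfadjoint[OF B F G] Q_selfadjoint[OF U F G] ..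
    finally show "ip0 (E' B F) G = ip0 F (E' B G)"
      by (simp add: E'[OF B F] E'[OF B G])
  qed
  show ?thesis
    unfolding projection_valued_measure_def
  proof (intro conjI ballI allI impI proj)
    fix F assume F: "F \<in> V0"
    show "E' UNIV F = F" unfolding E'[OF U F] by (simp add: E0_def)
    fix A B :: "real set" assume A: "A \<in> sets borel" and B: "B \<in> sets borel"
    show "E' (A \<inter> B) F = E' A (E' B F)"
      using E0_E0[OF A B F] E'[of "A \<inter> B" F] A B F by (simp add: E'[OF B F] E'[OF A E0_ell2[OF B F]])
  next
    fix B :: "nat \<Rightarrow> real set" and F G
    assume B: "range B \<subseteq> sets borel \<and> disjoint_family B" and F: "F \<in> V0" and G: "G \<in> V0"
    have Bi: "B i \<in> sets borel" for i using B by auto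
    have BU: "(\<Union>i. B i) \<in> sets borel" using Bi by auto
    define c where "c = ip0 F G - ip0 (Q UNIV F) G"
    \<comment> \<open>At most one of the disjoint sets contains 6.\<close>
    have "(\<lambda>i. if 6 \<in> B i then c else 0) sums (if 6 \<in> (\<Union>i. B i) then c else 0)"
    proof (cases "6 \<in> (\<Union>i. B i)")
      case True
      then obtain j where j: "6 \<in> B j" by auto
      have "6 \<in> B i \<longleftrightarrow> i = j" for i
      proof (cases "i = j")
        case False
        hence "B i \<inter> B j = {}" using disjoint_family_onD[of B UNIV i j] B by blast
        thus ?thesis using j False by blast
      qed (use j in simp)
      hence "(\<lambda>i. if 6 \<in> B i then c else 0) = (\<lambda>i. if i = j then c else 0)" by simp
      thus ?thesis using sums_single[of j "\<lambda>_. c"] True by simp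
    qed simp
    moreover have "(\<lambda>i. ip0 (Q (B i) F) G) sums ip0 (Q (\<Union>i. B i) F) G"
      unfolding Q_inner[OF Bi F G] Q_inner[OF BU F G]
      by (rule set_integral_sums[OF W_integrable[OF F G] Bi]) (use B in auto)
    ultimately show "(\<lambda>i. ip0 (E' (B i) F) G) sums ip0 (E' (\<Union>i. B i) F) G"
      unfolding E'[OF Bi F] E'[OF BU F] E0_inner[OF Bi F G] E0_inner[OF BU F G] c_def[symmetric]
      by (rule sums_add)
  qed
qed

text \<open>The scalar measure of \<open>F\<close> has the density \<open>g t = W F F t\<close> and an additional atom of mass \<open>p\<close> at 6.
  Since \<open>t / (6 - t) = 6 / (6 - t) - 1\<close>, its mean is
  \<open>6 p + 6 \<integral> g - \<parallel>T\<^sup>* F\<parallel>\<^sup>2 = 6 \<parallel>F\<parallel>\<^sup>2 - \<parallel>T\<^sup>* F\<parallel>\<^sup>2 = \<langle>(6 - T T\<^sup>*) F, F\<rangle>\<close>.\<close>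

lemma E0_spectral_projections:
  assumes E': "\<And>B F. B \<in> sets borel \<Longrightarrow> F \<in> V0 \<Longrightarrow> E' B F = E0 B F"
  shows "spectral_projections \<Gamma>\<^sub>0 lap0 E'"
  unfolding spectral_projections_def
proof (intro conjI ballI)
  show pvm: "projection_valued_measure \<Gamma>\<^sub>0 E'" by (rule E0_pvm) (rule E')
  have U: "(UNIV :: real set) \<in> sets borel" by simp
  fix F assume F: "F \<in> V0"
  let ?u = "inc_adj F"
  have u: "?u \<in> V" using F by auto
  define N where "N = scalar_measure \<Gamma>\<^sub>0 E' F"
  define g where "g t = Re (W F F t)" for t
  define p where "p = (nrm0 F)\<^sup>2 - (LINT t|\<mu>. g t)"
  note Wi = W_integrable[OF F F]
  have sN: "sets N = sets borel"
    unfolding N_def by (rule sets_scalar_measure[OF pvm F])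
  have gi: "integrable \<mu> g" unfolding g_def[abs_def] by (rule integrable_Re[OF Wi])
  have gD: "g t = weight t * Re (D ?u ?u t)" for t by (simp add: g_def W_def)
  have gnn: "AE t in \<mu>. 0 \<le> g t"
    using D_nonneg[OF u] by eventually_elim (simp add: gD weight_nonneg)
  have g6: "g 6 = 0" by (simp add: gD weight_def)
  have QF: "Re (ip0 (Q B F) F) = (LINT t|\<mu>. indicator B t * g t)" if B: "B \<in> sets borel" for B
  proof -
    have "integrable \<mu> (\<lambda>t. indicat_real B t *\<^sub>R W F F t)"
      using integrable_restrict[OF Wi B] by (simp add: set_integrable_def)
    from integral_Re[OF this] show ?thesis
      unfolding Q_inner[OF B F F] by (simp add: set_lebesgue_integral_def g_def)
  qed
  have eN: "emeasure N B = ennreal ((if 6 \<in> B then p else 0) + (LINT t|\<mu>. indicator B t * g t))"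
    if B: "B \<in> sets borel" for B
    unfolding N_def emeasure_scalar_measure[OF pvm F B] E'[OF B F] E0_inner[OF B F F]
    using QF[OF B] QF[OF U] ell2_inner_self[OF F] by (simp add: p_def flip: of_real_power)
  have "0 \<le> p"
  proof -
    have "Re (ip0 (E0 {6} F) F) = Re (ip0 (E' {6} F) F)" by (simp add: E' F)
    also have "\<dots> \<ge> 0" using pvm_inner_self[OF pvm _ F, of "{6}"] by simp
    finally have "0 \<le> p + (LINT t|\<mu>. indicator {6} t * g t)"
      using QF[of "{6}"] QF[OF U] ell2_inner_self[OF F] by (simp add: E0_inner F p_def flip: of_real_power)
    moreover have "(LINT t|\<mu>. indicator {6} t * g t) = (LINT t|\<mu>. 0)"
      by (rule Bochner_Integration.integral_cong) (auto simp: indicator_def g6)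
    ultimately show ?thesis by simp
  qed
  \<comment> \<open>Split off the point 6; the rest has the density \<open>g\<close>.\<close>
  let ?A = "- {6::real}"
  have A: "?A \<in> sets borel" and s6: "{6::real} \<in> sets borel" by auto
  define N1 where "N1 = density N (indicator ?A)"
  have sN1: "sets N1 = sets borel" unfolding N1_def by (simp add: sN)
  have N1: "emeasure N1 B = ennreal (LINT t|\<mu>. indicator B t * g t)" if B: "B \<in> sets borel" for B
  proof -
    have AB: "?A \<inter> B \<in> sets borel" using A B by (rule sets.Int)
    have "emeasure N1 B = emeasure N (?A \<inter> B)"
      unfolding N1_def using A B sN by (simp add: emeasure_density indicator_inter_arith[symmetric])
    also have "\<dots> = ennreal (LINT t|\<mu>. indicator (?A \<inter> B) t * g t)" by (simp add: eN[OF AB])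
    also have "(LINT t|\<mu>. indicator (?A \<inter> B) t * g t) = (LINT t|\<mu>. indicator B t * g t)"
      by (rule Bochner_Integration.integral_cong) (auto simp: indicator_def g6)
    finally show ?thesis .
  qed
  have gt: "integrable \<mu> (\<lambda>t. g t * t)"
  proof -
    have "integrable \<mu> (\<lambda>t. Re (t *\<^sub>R W F F t))" by (rule integrable_Re[OF integrable_moment[OF Wi]])
    thus ?thesis by (simp add: g_def mult.commute)
  qed
  have idb: "(\<lambda>t::real. t) \<in> borel_measurable borel" by simp
  have i1: "integrable N1 (\<lambda>t. t)" and v1: "(LINT t|N1. t) = (LINT t|\<mu>. g t * t)"
    using integrable_density_iff[OF sN1 gi gnn N1 idb] integral_density_eq[OF sN1 gi gnn N1 idb] gt by auto
  have mN: "(\<lambda>t. t) \<in> borel_measurable N" "(indicator ?A :: real \<Rightarrow> real) \<in> borel_measurable N"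
    unfolding measurable_cong_sets[OF sN refl] by (rule idb, rule borel_measurable_indicator[OF A])
  have N1': "N1 = density N (\<lambda>t. ennreal (indicat_real ?A t))"
    unfolding N1_def by (rule arg_cong[where f = "density N"]) (auto simp: indicator_def fun_eq_iff)
  have iA: "integrable N (\<lambda>t. indicat_real ?A t * t)" and vA: "(LINT t|N. indicat_real ?A t * t) = (LINT t|\<mu>. g t * t)"
  proof -
    have nn: "AE t in N. 0 \<le> indicat_real ?A t" by simp
    show "integrable N (\<lambda>t. indicat_real ?A t * t)"
      using i1 integrable_density[OF mN nn] unfolding N1' by simp
    show "(LINT t|N. indicat_real ?A t * t) = (LINT t|\<mu>. g t * t)"
      using v1 integral_density[OF mN nn] unfolding N1' by simp
  qed
  have m6: "emeasure N {6} = ennreal p"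
  proof -
    have "(LINT t|\<mu>. indicator {6} t * g t) = (LINT t|\<mu>. 0)"
      by (rule Bochner_Integration.integral_cong) (auto simp: indicator_def g6)
    thus ?thesis by (simp add: eN)
  qed
  have i6: "integrable N (\<lambda>t. 6 * indicat_real {6} t)" and v6: "(LINT t|N. 6 * indicat_real {6} t) = 6 * p"
    using m6 sN \<open>0 \<le> p\<close> sets_eq_imp_space_eq[OF sN] by (auto simp: measure_def)
  have split: "t = 6 * indicat_real {6} t + indicat_real ?A t * t" for t :: real
    by (simp add: indicator_def)
  have "integrable N (\<lambda>t. 6 * indicat_real {6} t + indicat_real ?A t * t)"
    by (rule Bochner_Integration.integrable_add[OF i6 iA])
  hence iN: "integrable N (\<lambda>t. t)" by (simp only: split[symmetric])
  thus "integrable (scalar_measure \<Gamma>\<^sub>0 E' F) (\<lambda>t. t)" by (simp add: N_def)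
  have "(LINT t|N. t) = (LINT t|N. 6 * indicat_real {6} t + indicat_real ?A t * t)"
    by (simp only: split[symmetric])
  also have "\<dots> = 6 * p + (LINT t|\<mu>. g t * t)"
    unfolding Bochner_Integration.integral_add[OF i6 iA] v6 vA ..
  also have "(LINT t|\<mu>. g t * t) = (LINT t|\<mu>. 6 * g t - Re (D ?u ?u t))"
  proof (rule integral_cong_AE)
    have "AE t in \<mu>. t \<in> {6} \<longrightarrow> D ?u ?u t = 0"
      by (rule D_vanishes[OF u u s6 E6_inc_adj[OF F]])
    thus "AE t in \<mu>. g t * t = 6 * g t - Re (D ?u ?u t)"
      using AE_space
    proof eventually_elim
      case (elim t)
      show ?case
      proof (cases "t = 6")
        case False
        hence "weight t * (6 - t) = 1" using elim by (simp add: weight_def space_\<mu>)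
        hence "weight t * (6 - t) * Re (D ?u ?u t) = Re (D ?u ?u t)" by simp
        thus ?thesis by (simp add: gD algebra_simps)
      qed (use elim in \<open>simp add: g6\<close>)
    qed
  qed (use gt gi integrable_D[OF u u] in auto)
  also have "\<dots> = 6 * (LINT t|\<mu>. g t) - Re (LINT t|\<mu>. D ?u ?u t)"
    using gi integrable_Re[OF integrable_D[OF u u]] integral_Re[OF integrable_D[OF u u]] by simp
  also have "(LINT t|\<mu>. D ?u ?u t) = of_real ((nrm ?u)\<^sup>2)"
    using dens_inner[OF dens_D[OF u u] U] by (simp add: E_UNIV u ell2_inner_self set_lebesgue_integral_def)
  finally have "(LINT t|N. t) = 6 * (nrm0 F)\<^sup>2 - (nrm ?u)\<^sup>2" by (simp add: p_def)
  thus "ip0 (lap0 F) F = complex_of_real (LINT t|scalar_measure \<Gamma>\<^sub>0 E' F. t)"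
    using lap0_inner[OF F F] ell2_inner_self[OF F] ell2_inner_self[OF u] by (simp add: N_def)
qed

end

section \<open>Comparison of the spectra\<close>

text \<open>With \<open>w = 6 - z\<close> and \<open>R = (w - S T)\<^sup>-\<^sup>1\<close>, the inverse of \<open>w - T S\<close> is \<open>w\<^sup>-\<^sup>1 (1 + T R S)\<close> if
  \<open>w \<noteq> 0\<close>.  If \<open>w = 0\<close> it is \<open>- T R\<^sup>2 S\<close>, provided that \<open>S\<close> is injective: \<open>S (T R S F + F) = 0\<close> then gives
  \<open>T R S = -1\<close>.\<close>

lemma spectrum_transfer:
  fixes T :: "('a \<Rightarrow> complex) \<Rightarrow> 'b \<Rightarrow> complex" and S :: "('b \<Rightarrow> complex) \<Rightarrow> 'a \<Rightarrow> complex"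
  assumes T: "\<And>f. f \<in> ell2 G \<Longrightarrow> T f \<in> ell2 H" "\<And>f. f \<in> ell2 G \<Longrightarrow> ell2_norm H (T f) \<le> c * ell2_norm G f"
      "\<And>f g. T (\<lambda>x. f x + g x) = (\<lambda>x. T f x + T g x)" "\<And>a f. T (\<lambda>x. a * f x) = (\<lambda>x. a * T f x)"
    and S: "\<And>f. f \<in> ell2 H \<Longrightarrow> S f \<in> ell2 G" "\<And>f. f \<in> ell2 H \<Longrightarrow> ell2_norm G (S f) \<le> c * ell2_norm H f"
      "\<And>f g. S (\<lambda>x. f x + g x) = (\<lambda>x. S f x + S g x)" "\<And>a f. S (\<lambda>x. a * f x) = (\<lambda>x. a * S f x)"
    and A: "\<And>f. f \<in> ell2 G \<Longrightarrow> A f = (\<lambda>x. 6 * f x - S (T f) x)"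
    and B: "\<And>f. f \<in> ell2 H \<Longrightarrow> B f = (\<lambda>x. 6 * f x - T (S f) x)"
    and c: "0 \<le> c"
    and z: "z \<notin> spectrum G A" and ok: "z \<noteq> 6 \<or> (\<forall>F\<in>ell2 H. S F = (\<lambda>x. 0) \<longrightarrow> F = (\<lambda>x. 0))"
  shows "z \<notin> spectrum H B"
proof -
  obtain R where R: "ell2_bounded G R"
    and inv: "\<And>f. f \<in> ell2 G \<Longrightarrow> R (\<lambda>x. A f x - z * f x) = f"
             "\<And>f. f \<in> ell2 G \<Longrightarrow> (\<lambda>x. A (R f) x - z * R f x) = f"
    using z unfolding spectrum_def by blast
  have Rl: "ell2_linear G R" using R by (simp add: ell2_bounded_def)
  have R2: "R f \<in> ell2 G" if "f \<in> ell2 G" for f using Rl that by (simp add: ell2_linear_def)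
  have Radd: "R (\<lambda>x. f x + g x) = (\<lambda>x. R f x + R g x)" if "f \<in> ell2 G" "g \<in> ell2 G" for f g
    using Rl that by (simp add: ell2_linear_def)
  have Rsc: "R (\<lambda>x. a * f x) = (\<lambda>x. a * R f x)" if "f \<in> ell2 G" for a f
    using Rl that by (simp add: ell2_linear_def)
  obtain C where C0: "\<And>f. f \<in> ell2 G \<Longrightarrow> ell2_norm G (R f) \<le> C * ell2_norm G f"
    using R unfolding ell2_bounded_def by blast
  define C' where "C' = \<bar>C\<bar>"
  have C': "0 \<le> C'" by (simp add: C'_def)
  have C: "ell2_norm G (R f) \<le> C' * ell2_norm G f" if "f \<in> ell2 G" for f
    unfolding C'_def by (rule order_trans[OF C0[OF that] mult_right_mono[OF abs_ge_self ell2_norm_nonneg]])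
  define w where "w = 6 - z"
  have Tdiff: "T (\<lambda>x. f x - g x) = (\<lambda>x. T f x - T g x)" for f g
    using T(3)[of f "\<lambda>x. (-1) * g x"] T(4)[of "-1" g] by simp
  have Sdiff: "S (\<lambda>x. f x - g x) = (\<lambda>x. S f x - S g x)" for f g
    using S(3)[of f "\<lambda>x. (-1) * g x"] S(4)[of "-1" g] by simp
  have Aw: "(\<lambda>x. A f x - z * f x) = (\<lambda>x. w * f x - S (T f) x)" if "f \<in> ell2 G" for f
    by (simp add: A[OF that] w_def fun_eq_iff algebra_simps)
  have Bw: "(\<lambda>x. B f x - z * f x) = (\<lambda>x. w * f x - T (S f) x)" if "f \<in> ell2 H" for f
    by (simp add: B[OF that] w_def fun_eq_iff algebra_simps)
  have i1: "R (\<lambda>x. w * f x - S (T f) x) = f" if "f \<in> ell2 G" for f using inv(1)[OF that] by (simp only: Aw[OF that])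
  have i2: "(\<lambda>x. w * R f x - S (T (R f)) x) = f" if "f \<in> ell2 G" for f
    using inv(2)[OF that] by (simp only: Aw[OF R2[OF that]])
  define K where "K F = T (R (S F))" for F
  have K2: "K F \<in> ell2 H" if "F \<in> ell2 H" for F unfolding K_def by (intro T(1) R2 S(1) that)
  have Kn: "ell2_norm H (K F) \<le> c * C' * c * ell2_norm H F" if F: "F \<in> ell2 H" for F
  proof -
    have "ell2_norm H (K F) \<le> c * ell2_norm G (R (S F))" unfolding K_def by (rule T(2)[OF R2[OF S(1)[OF F]]])
    also have "\<dots> \<le> c * (C' * ell2_norm G (S F))" by (rule mult_left_mono[OF C[OF S(1)[OF F]] c])
    also have "\<dots> \<le> c * (C' * (c * ell2_norm H F))"
      by (rule mult_left_mono[OF mult_left_mono[OF S(2)[OF F] C'] c])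
    finally show ?thesis by (simp add: mult.assoc)
  qed
  have Kadd: "K (\<lambda>x. F x + F' x) = (\<lambda>x. K F x + K F' x)" if "F \<in> ell2 H" "F' \<in> ell2 H" for F F'
    unfolding K_def S(3) Radd[OF that[THEN S(1)]] T(3) ..
  have Ksc: "K (\<lambda>x. a * F x) = (\<lambda>x. a * K F x)" if "F \<in> ell2 H" for a F
    unfolding K_def S(4) Rsc[OF S(1)[OF that]] T(4) ..
  have SK: "S (K F) = (\<lambda>x. w * R (S F) x - S F x)" if "F \<in> ell2 H" for F
    using i2[OF S(1)[OF that]] unfolding K_def by (simp add: fun_eq_iff algebra_simps)
  have KT: "K (\<lambda>x. w * F x - T (S F) x) = T (S F)" if "F \<in> ell2 H" for F
    unfolding K_def Sdiff S(4) i1[OF S(1)[OF that]] ..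
  show ?thesis
  proof (cases "z = 6")
    case False
    hence w: "w \<noteq> 0" by (simp add: w_def)
    define R0 where "R0 F = (\<lambda>x. (1 / w) * (F x + K F x))" for F
    have "ell2_bounded H R0"
      unfolding ell2_bounded_def ell2_linear_def
    proof (intro conjI ballI allI exI)
      fix F F' a assume F: "F \<in> ell2 H"
      show "R0 F \<in> ell2 H" unfolding R0_def by (intro ell2_scale ell2_add F K2)
      show "R0 (\<lambda>x. a * F x) = (\<lambda>x. a * R0 F x)" unfolding R0_def Ksc[OF F] by (simp add: algebra_simps)
      have "ell2_norm H (R0 F) = cmod (1 / w) * ell2_norm H (\<lambda>x. F x + K F x)"
        unfolding R0_def by (rule ell2_norm_scale)
      also have "\<dots> \<le> cmod (1 / w) * (ell2_norm H F + c * C' * c * ell2_norm H F)"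
        using ell2_norm_triangle[OF F K2[OF F]] Kn[OF F] by (intro mult_left_mono) auto
      finally show "ell2_norm H (R0 F) \<le> (cmod (1 / w) * (1 + c * C' * c)) * ell2_norm H F"
        by (simp add: algebra_simps)
      assume F': "F' \<in> ell2 H"
      show "R0 (\<lambda>x. F x + F' x) = (\<lambda>x. R0 F x + R0 F' x)"
        unfolding R0_def Kadd[OF F F'] by (simp add: algebra_simps)
    qed
    moreover have "R0 (\<lambda>x. B F x - z * F x) = F \<and> (\<lambda>x. B (R0 F) x - z * R0 F x) = F" if F: "F \<in> ell2 H" for F
    proof
      show "R0 (\<lambda>x. B F x - z * F x) = F"
        unfolding Bw[OF F] R0_def KT[OF F] using w by simp
      have R0F: "R0 F \<in> ell2 H" unfolding R0_def by (intro ell2_scale ell2_add F K2)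
      have "S (R0 F) = R (S F)"
        unfolding R0_def S(4) S(3) SK[OF F] using w by simp
      thus "(\<lambda>x. B (R0 F) x - z * R0 F x) = F"
        unfolding Bw[OF R0F] using w by (simp add: R0_def K_def)
    qed
    ultimately show ?thesis unfolding spectrum_def by blast
  next
    case True
    hence w: "w = 0" by (simp add: w_def)
    have inj: "F = F'" if "F \<in> ell2 H" "F' \<in> ell2 H" "S F = S F'" for F F'
    proof -
      have "S (\<lambda>x. F x - F' x) = (\<lambda>x. 0)" unfolding Sdiff that(3) by simp
      hence "(\<lambda>x. F x - F' x) = (\<lambda>x. 0)" using ok True that(1,2) by blast
      thus ?thesis by (simp add: fun_eq_iff)
    qed
    have Kid: "K F = (\<lambda>x. (-1) * F x)" if F: "F \<in> ell2 H" for F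
      by (rule inj[OF K2[OF F] ell2_scale[OF F]]) (unfold SK[OF F] S(4) w, simp)
    define R0 where "R0 F = (\<lambda>x. (-1) * T (R (R (S F))) x)" for F
    have R02: "R0 F \<in> ell2 H" if "F \<in> ell2 H" for F unfolding R0_def by (intro ell2_scale T(1) R2 S(1) that)
    have "ell2_bounded H R0"
      unfolding ell2_bounded_def ell2_linear_def
    proof (intro conjI ballI allI exI)
      fix F F' a assume F: "F \<in> ell2 H"
      note RS = R2[OF S(1)[OF F]]
      show "R0 F \<in> ell2 H" by (rule R02[OF F])
      show "R0 (\<lambda>x. a * F x) = (\<lambda>x. a * R0 F x)"
        unfolding R0_def S(4) Rsc[OF S(1)[OF F]] Rsc[OF RS] T(4) by (simp add: algebra_simps)
      have "ell2_norm H (R0 F) = ell2_norm H (T (R (R (S F))))"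
        unfolding R0_def ell2_norm_scale by simp
      also have "\<dots> \<le> c * ell2_norm G (R (R (S F)))" by (rule T(2)[OF R2[OF RS]])
      also have "\<dots> \<le> c * (C' * ell2_norm G (R (S F)))" by (rule mult_left_mono[OF C[OF RS] c])
      also have "\<dots> \<le> c * (C' * (C' * ell2_norm G (S F)))"
        by (rule mult_left_mono[OF mult_left_mono[OF C[OF S(1)[OF F]] C'] c])
      also have "\<dots> \<le> c * (C' * (C' * (c * ell2_norm H F)))"
        by (rule mult_left_mono[OF mult_left_mono[OF mult_left_mono[OF S(2)[OF F] C'] C'] c])
      finally show "ell2_norm H (R0 F) \<le> (c * C' * C' * c) * ell2_norm H F" by (simp add: mult.assoc)
      assume F': "F' \<in> ell2 H"
      show "R0 (\<lambda>x. F x + F' x) = (\<lambda>x. R0 F x + R0 F' x)"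
        unfolding R0_def S(3) Radd[OF S(1)[OF F] S(1)[OF F']] Radd[OF RS R2[OF S(1)[OF F']]] T(3)
        by (simp add: algebra_simps)
    qed
    moreover have "R0 (\<lambda>x. B F x - z * F x) = F \<and> (\<lambda>x. B (R0 F) x - z * R0 F x) = F" if F: "F \<in> ell2 H" for F
    proof
      note RS = R2[OF S(1)[OF F]]
      have "R (S (\<lambda>x. w * F x - T (S F) x)) = S F"
        unfolding Sdiff S(4) by (rule i1[OF S(1)[OF F]])
      thus "R0 (\<lambda>x. B F x - z * F x) = F"
        unfolding Bw[OF F] R0_def using Kid[OF F] by (simp add: K_def)
      have "S (R0 F) = R (S F)"
        unfolding R0_def S(4) using i2[OF RS] w by simp
      thus "(\<lambda>x. B (R0 F) x - z * R0 F x) = F"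
        unfolding Bw[OF R02[OF F]] using Kid[OF F] w by (simp add: K_def)
    qed
    ultimately show ?thesis unfolding spectrum_def by blast
  qed
qed

context cubic_graph
begin

text \<open>A function in the kernel of \<open>T\<close> changes its sign along every edge, so its modulus is constant on
  components.  By square-summability the set \<open>C\<close> where the modulus takes a given nonzero value is finite.
  It is a union of components, and so the number of edges \<open>EC\<close> in it is \<open>3/2\<close> times the number
  of its vertices.  Thus \<open>T\<^sup>*\<close> cannot be injective on functions on \<open>EC\<close>, by the
  pigeonhole principle: there are \<open>8 ^ card EC\<close> functions with values at
  most 7, their images have values at most 21, and \<open>22 ^ card C < 8 ^ card EC\<close> as \<open>22\<^sup>2 < 8\<^sup>3\<close>.\<close>

lemma inc_kernel_gives_inc_adj_kernel:
  assumes f: "f \<in> V" and inc0: "inc f = (\<lambda>x. 0)" and ne: "f \<noteq> (\<lambda>x. 0)"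
  shows "\<exists>G\<in>V0. inc_adj G = (\<lambda>a. 0) \<and> G \<noteq> (\<lambda>x. 0)"
proof -
  obtain a where a: "f a \<noteq> 0" using ne by auto
  hence av: "a \<in> verts \<Gamma>" using ell2_off[OF f] by blast
  define r where "r = (cmod (f a))\<^sup>2"
  have r: "r > 0" using a by (simp add: r_def)
  define C where "C = {b \<in> verts \<Gamma>. (cmod (f b))\<^sup>2 = r}"
  have aC: "a \<in> C" using av by (simp add: C_def r_def)
  have finC: "finite C"
  proof (rule ccontr)
    assume inf: "infinite C"
    obtain n :: nat where n: "(nrm f)\<^sup>2 < real n * r" using r ex_less_of_nat_mult by blast
    obtain X where X: "X \<subseteq> C" "finite X" "card X = n" using infinite_arbitrarily_large[OF inf] by blast
    have "real n * r = (\<Sum>b\<in>X. (cmod (f b))\<^sup>2)" using X by (simp add: C_def subset_iff)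
    also have "\<dots> \<le> (nrm f)\<^sup>2"
      unfolding ell2_norm_square using X by (intro finite_sum_le_infsum ell2_summable f) (auto simp: C_def)
    finally show False using n by simp
  qed
  have closed: "x \<subseteq> C" if b: "b \<in> C" and x: "x \<in> star b" for b x
  proof
    fix y assume y: "y \<in> x"
    have xe: "x \<in> edges \<Gamma>" "b \<in> x" using x by (auto simp: star_def)
    have yv: "y \<in> verts \<Gamma>" using edge_subset[OF xe(1)] y by auto
    show "y \<in> C"
    proof (cases "y = b")
      case False
      have "x = {b, y}"
        using card_subset_eq[of x "{b, y}"] finite_edge[OF xe(1)] edge_card[OF xe(1)] xe(2) y False by simp
      hence "f b + f y = 0" using fun_cong[OF inc0, of x] xe(1) False by (simp add: inc_def)
      hence "f y = - f b" by (simp add: eq_neg_iff_add_eq_0 add.commute)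
      thus ?thesis using b yv by (simp add: C_def)
    qed (use b in simp)
  qed
  define EC where "EC = (\<Union>b\<in>C. star b)"
  have Cv: "C \<subseteq> verts \<Gamma>" by (auto simp: C_def)
  have finE: "finite EC" unfolding EC_def using finC Cv finite_star by auto
  have EC: "x \<in> edges \<Gamma>" "x \<subseteq> C" if "x \<in> EC" for x
    using that closed unfolding EC_def by (auto simp: star_def)
  have count: "2 * card EC = 3 * card C"
  proof -
    have "2 * card EC = (\<Sum>x\<in>EC. card x)" using EC(1) by (simp add: edge_card)
    also have "\<dots> = (\<Sum>x\<in>EC. \<Sum>b\<in>C. if b \<in> x then 1 else 0)"
    proof (rule sum.cong[OF refl])
      fix x assume "x \<in> EC"
      hence "C \<inter> {b. b \<in> x} = x" using EC(2) by blast
      thus "card x = (\<Sum>b\<in>C. if b \<in> x then 1 else 0)" using finC by (simp add: sum.If_cases)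
    qed
    also have "\<dots> = (\<Sum>b\<in>C. \<Sum>x\<in>EC. if b \<in> x then 1 else 0)" by (rule sum.swap)
    also have "\<dots> = (\<Sum>b\<in>C. 3)"
    proof (rule sum.cong[OF refl])
      fix b assume b: "b \<in> C"
      have "EC \<inter> {x. b \<in> x} = star b" using b EC(1) by (auto simp: EC_def star_def)
      thus "(\<Sum>x\<in>EC. if b \<in> x then 1 else 0) = (3 :: nat)" using finE b Cv card_star by (simp add: sum.If_cases subset_iff)
    qed
    finally show ?thesis by simp
  qed
  define X where "X = PiE EC (\<lambda>_. {..7::nat})"
  define Y where "Y = PiE C (\<lambda>_. {..21::nat})"
  define h where "h F = restrict (\<lambda>b. \<Sum>x\<in>star b. F x) C" for F :: "'a set \<Rightarrow> nat"
  have "h ` X \<subseteq> Y"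
  proof
    fix g assume "g \<in> h ` X"
    then obtain F where F: "F \<in> X" "g = h F" by auto
    have "(\<Sum>x\<in>star b. F x) \<le> 21" if b: "b \<in> C" for b
    proof -
      have "(\<Sum>x\<in>star b. F x) \<le> of_nat (card (star b)) * 7"
        by (rule sum_bounded_above) (use F b in \<open>auto simp: X_def EC_def PiE_def Pi_def\<close>)
      thus ?thesis using b Cv card_star by auto
    qed
    thus "g \<in> Y" by (simp add: F(2) h_def Y_def)
  qed
  have "card Y < card X"
  proof -
    have "card X = 8 ^ card EC" "card Y = 22 ^ card C"
      unfolding X_def Y_def using finE finC by (simp_all add: card_PiE)
    moreover have "(22 ^ card C :: nat)\<^sup>2 < (8 ^ card EC)\<^sup>2"
    proof -
      have "(22 ^ card C :: nat)\<^sup>2 = (22\<^sup>2) ^ card C"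
        unfolding power_mult[symmetric] by (simp only: mult.commute)
      also have "\<dots> < (8 ^ 3) ^ card C"
        by (rule power_strict_mono) (use aC finC in \<open>auto simp: card_gt_0_iff\<close>)
      also have "\<dots> = 8 ^ (2 * card EC)" unfolding count by (rule power_mult[symmetric])
      also have "\<dots> = (8 ^ card EC)\<^sup>2"
        unfolding power_mult[symmetric] by (simp only: mult.commute)
      finally show ?thesis .
    qed
    ultimately show ?thesis
      using power_less_imp_less_base[of "22 ^ card C" 2 "8 ^ card EC"] by simp
  qed
  moreover have "finite Y" unfolding Y_def using finC by (intro finite_PiE) auto
  ultimately have "\<not> inj_on h X" using card_inj_on_le[OF _ \<open>h ` X \<subseteq> Y\<close>] by fastforce
  then obtain F F' where FF: "F \<in> X" "F' \<in> X" "h F = h F'" "F \<noteq> F'" by (auto simp: inj_on_def)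
  define G where "G x = (if x \<in> EC then of_nat (F x) - of_nat (F' x) else 0 :: complex)" for x
  have "G \<in> V0"
    by (rule ell2_finite_support[OF finE]) (use EC(1) in \<open>auto simp: G_def\<close>)
  moreover have "inc_adj G = (\<lambda>a. 0)"
  proof
    fix b show "inc_adj G b = 0"
    proof (cases "b \<in> C")
      case True
      have "(\<Sum>x\<in>star b. F x) = (\<Sum>x\<in>star b. F' x)" using fun_cong[OF FF(3), of b] True by (simp add: h_def)
      hence "(\<Sum>x\<in>star b. of_nat (F x) - of_nat (F' x) :: complex) = 0"
        by (simp add: sum_subtractf flip: of_nat_sum)
      moreover have "(\<Sum>x\<in>star b. G x) = (\<Sum>x\<in>star b. of_nat (F x) - of_nat (F' x))"
        using True by (intro sum.cong) (auto simp: G_def EC_def)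
      ultimately show ?thesis by (simp add: inc_adj_def)
    next
      case False
      have "G x = 0" if "x \<in> star b" for x using that False EC(2) by (auto simp: G_def star_def)
      thus ?thesis by (simp add: inc_adj_def)
    qed
  qed
  moreover have "G \<noteq> (\<lambda>x. 0)"
  proof
    assume "G = (\<lambda>x. 0)"
    hence G0: "G x = 0" for x by simp
    have "F x = F' x" if "x \<in> EC" for x using G0[of x] that unfolding G_def by simp
    hence "F = F'" using FF(1,2) unfolding X_def by (intro PiE_ext[of F EC]) simp_all
    thus False using FF(4) by simp
  qed
  ultimately show ?thesis by blast
qed

lemma spectrum_edge_graph_subset:
  assumes "z \<notin> spectrum \<Gamma> lap" "z \<noteq> 6 \<or> eigenspace \<Gamma>\<^sub>0 6 = {\<lambda>x. 0}"
  shows "z \<notin> spectrum \<Gamma>\<^sub>0 lap0"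
proof (rule spectrum_transfer[where G = \<Gamma> and A = lap and T = inc and S = inc_adj and c = "sqrt 6"])
  show "z \<notin> spectrum \<Gamma> lap" by fact
  show "z \<noteq> 6 \<or> (\<forall>F\<in>V0. inc_adj F = (\<lambda>x. 0) \<longrightarrow> F = (\<lambda>x. 0))"
  proof (cases "z = 6")
    case True
    hence E6: "eigenspace \<Gamma>\<^sub>0 6 = {\<lambda>x. 0}" using assms(2) by simp
    show ?thesis
    proof (intro disjI2 ballI impI)
      fix F assume "F \<in> V0" "inc_adj F = (\<lambda>x. 0)"
      hence "F \<in> eigenspace \<Gamma>\<^sub>0 6" by (simp add: eigenspace6)
      thus "F = (\<lambda>x. 0)" by (simp only: E6 singleton_iff)
    qed
  qed simp
qed (simp_all add: inc_ell2 inc_adj_ell2 inc_norm_le inc_adj_norm_le inc_add inc_scale inc_adj_add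
      inc_adj_scale laplacian_eq laplacian0_eq)

lemma spectrum_subset_edge_graph:
  assumes "z \<notin> spectrum \<Gamma>\<^sub>0 lap0" "z \<noteq> 6 \<or> eigenspace \<Gamma>\<^sub>0 6 = {\<lambda>x. 0}"
  shows "z \<notin> spectrum \<Gamma> lap"
proof (rule spectrum_transfer[where G = \<Gamma>\<^sub>0 and A = lap0 and T = inc_adj and S = inc and c = "sqrt 6"])
  show "z \<notin> spectrum \<Gamma>\<^sub>0 lap0" by fact
  show "z \<noteq> 6 \<or> (\<forall>f\<in>V. inc f = (\<lambda>x. 0) \<longrightarrow> f = (\<lambda>x. 0))"
  proof (cases "z = 6")
    case True
    hence E6: "eigenspace \<Gamma>\<^sub>0 6 = {\<lambda>x. 0}" using assms(2) by simp
    show ?thesis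
    proof (intro disjI2 ballI impI, rule ccontr)
      fix f assume "f \<in> V" "inc f = (\<lambda>x. 0)" "f \<noteq> (\<lambda>x. 0)"
      from inc_kernel_gives_inc_adj_kernel[OF this] obtain G
        where "G \<in> V0" "inc_adj G = (\<lambda>a. 0)" "G \<noteq> (\<lambda>x. 0)" by blast
      hence "G \<in> eigenspace \<Gamma>\<^sub>0 6" by (simp add: eigenspace6)
      hence "G = (\<lambda>x. 0)" by (simp only: E6 singleton_iff)
      thus False using \<open>G \<noteq> (\<lambda>x. 0)\<close> by simp
    qed
  qed simp
qed (simp_all add: inc_ell2 inc_adj_ell2 inc_norm_le inc_adj_norm_le inc_add inc_scale inc_adj_add
      inc_adj_scale laplacian_eq laplacian0_eq)

lemma eigenvalue_6_in_spectrum: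
  assumes "eigenspace \<Gamma>\<^sub>0 6 \<noteq> {\<lambda>x. 0}" shows "6 \<in> spectrum \<Gamma>\<^sub>0 lap0"
proof (rule ccontr)
  have "(\<lambda>x. 0) \<in> eigenspace \<Gamma>\<^sub>0 6" by (simp add: eigenspace6)
  then obtain G where G: "G \<in> eigenspace \<Gamma>\<^sub>0 6" "G \<noteq> (\<lambda>x. 0)" using assms by blast
  have Gl: "G \<in> V0" "inc_adj G = (\<lambda>a. 0)" using G by (auto simp: eigenspace6)
  assume "6 \<notin> spectrum \<Gamma>\<^sub>0 lap0"
  then obtain R where R: "ell2_linear \<Gamma>\<^sub>0 R" "R (\<lambda>x. lap0 G x - 6 * G x) = G"
    using Gl(1) unfolding spectrum_def ell2_bounded_def by blast
  have "(\<lambda>x. lap0 G x - 6 * G x) = (\<lambda>x. 0)" using Gl by (simp add: laplacian0_eq)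
  moreover have "R (\<lambda>x. 0 * G x) = (\<lambda>x. 0 * R G x)" using R(1) Gl(1) unfolding ell2_linear_def by blast
  ultimately show False using R(2) G(2) by simp
qed

lemma spectrum_edge_graph:
  shows "eigenspace \<Gamma>\<^sub>0 6 = {\<lambda>x. 0} \<Longrightarrow> spectrum \<Gamma>\<^sub>0 lap0 = spectrum \<Gamma> lap"
    and "eigenspace \<Gamma>\<^sub>0 6 \<noteq> {\<lambda>x. 0} \<Longrightarrow> spectrum \<Gamma>\<^sub>0 lap0 = spectrum \<Gamma> lap \<union> {6}"
  using spectrum_edge_graph_subset spectrum_subset_edge_graph eigenvalue_6_in_spectrum by blast+

end

section \<open>The spectral resolution of the edge graph\<close>

theorem theorem3p1:
  fixes \<Gamma> :: "'a graph"
    and \<Gamma>\<^sub>0 :: "'a set graph"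
    and E :: "real set \<Rightarrow> ('a \<Rightarrow> complex) \<Rightarrow> 'a \<Rightarrow> complex"
    and \<mu> :: "real measure"
    and P :: "real \<Rightarrow> 'a \<Rightarrow> 'a \<Rightarrow> complex"
    and \<Sigma> :: "real set"
    and E\<^sub>6 :: "('a set \<Rightarrow> complex) set"
    and P\<^sub>6 :: "('a set \<Rightarrow> complex) \<Rightarrow> 'a set \<Rightarrow> complex"
  assumes "infinite (verts \<Gamma>)" and "regular_graph 3 \<Gamma>"
    and "spectral_projections \<Gamma> (neg_laplacian \<Gamma>) E"
    and "spectral_kernel \<Gamma> E \<mu> P"
  defines "\<Gamma>\<^sub>0 \<equiv> edge_graph \<Gamma>"
    and "\<Sigma> \<equiv> {t. complex_of_real t \<in> spectrum \<Gamma> (neg_laplacian \<Gamma>)}"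
    and "E\<^sub>6 \<equiv> eigenspace \<Gamma>\<^sub>0 6"
    and "P\<^sub>6 \<equiv> proj_onto \<Gamma>\<^sub>0 E\<^sub>6"
  shows "(\<exists>PF :: real \<Rightarrow> ('a set \<Rightarrow> complex) \<Rightarrow> 'a set \<Rightarrow> complex.
            (\<forall>F\<in>ell2 \<Gamma>\<^sub>0.
               (\<forall>x\<in>verts \<Gamma>\<^sub>0.
                  has_L1_sum \<mu> (\<lambda>y t. edge_kernel P t x y * F y) (verts \<Gamma>\<^sub>0) (\<lambda>t. PF t F x)) \<and>
               (AE t in \<mu>. \<forall>x\<in>verts \<Gamma>\<^sub>0.
                  neg_laplacian \<Gamma>\<^sub>0 (PF t F) x = complex_of_real t * PF t F x) \<and>
               (\<forall>x\<in>verts \<Gamma>\<^sub>0. F x = P\<^sub>6 F x + (LINT t:\<Sigma>|\<mu>. PF t F x))) \<and>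
            spectral_projections \<Gamma>\<^sub>0 (neg_laplacian \<Gamma>\<^sub>0)
              (\<lambda>B F x. if x \<in> verts \<Gamma>\<^sub>0
                 then (if 6 \<in> B then P\<^sub>6 F x else 0) + (LINT t:(B \<inter> \<Sigma>)|\<mu>. PF t F x)
                 else 0))
       \<and> (E\<^sub>6 = {\<lambda>x. 0} \<longrightarrow>
            spectrum \<Gamma>\<^sub>0 (neg_laplacian \<Gamma>\<^sub>0) = spectrum \<Gamma> (neg_laplacian \<Gamma>))
       \<and> (E\<^sub>6 \<noteq> {\<lambda>x. 0} \<longrightarrow>
            spectrum \<Gamma>\<^sub>0 (neg_laplacian \<Gamma>\<^sub>0) = spectrum \<Gamma> (neg_laplacian \<Gamma>) \<union> {6})"
proof -
  interpret cubic_spectral \<Gamma> E \<mu> P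
    by unfold_locales (use assms in auto)
  have U: "(UNIV :: real set) \<in> sets borel" by simp
  have P6: "P\<^sub>6 F = (\<lambda>x. F x - Q UNIV F x)" if "F \<in> ell2 (edge_graph \<Gamma>)" for F
    unfolding P\<^sub>6_def E\<^sub>6_def \<Gamma>\<^sub>0_def by (rule proj_onto_E6[OF that])
  have PQ: "(LINT t:(B \<inter> \<Sigma>)|\<mu>. PF t F x) = Q B F x"
    if "F \<in> ell2 (edge_graph \<Gamma>)" "x \<in> edges \<Gamma>" "B \<in> sets borel" for B F x
    unfolding \<Sigma>_def by (rule PF_integral[OF that])
  have sp0: "spectral_projections (edge_graph \<Gamma>) (neg_laplacian (edge_graph \<Gamma>))
      (\<lambda>B F x. if x \<in> verts (edge_graph \<Gamma>)
         then (if 6 \<in> B then P\<^sub>6 F x else 0) + (LINT t:(B \<inter> \<Sigma>)|\<mu>. PF t F x) else 0)"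
  proof (rule E0_spectral_projections)
    fix B :: "real set" and F assume B: "B \<in> sets borel" and F: "F \<in> ell2 (edge_graph \<Gamma>)"
    show "(\<lambda>x. if x \<in> verts (edge_graph \<Gamma>)
         then (if 6 \<in> B then P\<^sub>6 F x else 0) + (LINT t:(B \<inter> \<Sigma>)|\<mu>. PF t F x) else 0) = E0 B F"
    proof
      fix x show "(if x \<in> verts (edge_graph \<Gamma>)
         then (if 6 \<in> B then P\<^sub>6 F x else 0) + (LINT t:(B \<inter> \<Sigma>)|\<mu>. PF t F x) else 0) = E0 B F x"
        using ell2_off[OF F, of x] ell2_off[OF Q_ell2[OF U F], of x] ell2_off[OF Q_ell2[OF B F], of x]
        by (simp add: P6[OF F] PQ[OF F _ B] E0_def)
    qed
  qed
  have res: "F x = P\<^sub>6 F x + (LINT t:\<Sigma>|\<mu>. PF t F x)" if F: "F \<in> ell2 (edge_graph \<Gamma>)" "x \<in> edges \<Gamma>" for F x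
    using PQ[OF F U] by (simp add: P6[OF F(1)])
  show ?thesis
    using sp0 res PF_L1_sum PF_eigen spectrum_edge_graph
    unfolding \<Gamma>\<^sub>0_def E\<^sub>6_def verts_edge_graph
    by (intro conjI exI[of _ PF] ballI impI) auto
qed

end
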